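(* Let $d,l\ge2$ be fixed integers, let $\beta\in(0,1/d)$, and let $m\to\infty$ through integers with $lm/d\in\mathbb N$ and $m\beta\in\mathbb N$. For each such $m$ let $M_0\subseteq[m]$ be a fixed set of $m\beta$ hyperedges and let $A_{M_0}$ be the event that $M_0$ is a matching of $\mathcal G_{m,d,l}$. Put, for $k\ge1$, $$\lambda_k:=\frac{(d-1)^k(l-1)^k}{2k},\qquad\mu_{\beta,k}:=\lambda_k\left(1+\frac{(-1)^k\beta^k}{(1-\beta)^k}\right).$$ For each fixed $b\in\mathbb N$ the following hold as $m\to\infty$. (1) The vector $(C_1,\ldots,C_b)$ of cycle counts converges in distribution to a vector of independent Poisson random variables with means $\lambda_1,\ldots,\lambda_b$. (2) Conditional on $A_{M_0}$, the vector $(C_1,\ldots,C_b)$ converges in distribution to a vector of independent Poisson random variables with means $\mu_{\beta,1},\ldots,\mu_{\beta,b}$.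
   Context: Random hypergraph model. Let $d,l\ge2$ and let $m$ be such that $lm/d\in\mathbb N$. The hyperedge set is $[m]$, the half-edge set is $[lm]$, and half-edge $i$ belongs to hyperedge $\lceil i/l\rceil$. A $(d,l)$-regular hypergraph (configuration) is obtained by partitioning $[lm]$ into $lm/d$ classes of size $d$, called vertices; a half-edge is incident to the vertex that contains it. $\mathcal G_{m,d,l}$ is the configuration given by a uniformly random such partition. A set $M$ of hyperedges is a matching if all $l|M|$ half-edges contained in hyperedges of $M$ are incident to distinct vertices. Cycles. The incidence multigraph of a configuration is the bipartite multigraph whose two classes are the hyperedges and the vertices, with one edge (incidence) for each half-edge, joining its hyperedge to its vertex. A $k$-cycle is a cycle of length $2k$ in the incidence multigraph (as a subgraph, i.e. not counting choice of starting point or direction): an alternating sequence $v_0,e_1,v_1,\ldots,v_{k-1},e_k,v_k=v_0$ with distinct hyperedges $e_1,\dots,e_k$, distinct vertices $v_0,\dots,v_{k-1}$, the two incidences of $e_i$ with $v_{i-1}$ and $v_i$ being realised by two distinct half-edges of $e_i$. For $k=1$ it is an unordered pair of distinct half-edges of one hyperedge incident to the same vertex. $C_k$ is the number of $k$-cycles of $\mathcal G_{m,d,l}$. *)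

theory Defs
  imports "HOL-Probability.Probability"
begin

definition hyperedge_of :: "nat \<Rightarrow> nat \<Rightarrow> nat" where
  "hyperedge_of l h = nat \<lceil>real h / real l\<rceil>"

definition half_edges_of :: "nat \<Rightarrow> nat \<Rightarrow> nat set \<Rightarrow> nat set" where
  "half_edges_of l m M = {h \<in> {1..l * m}. hyperedge_of l h \<in> M}"

text \<open>A configuration is the set of its vertices, a vertex being a class of half-edges;
  the half-edge \<open>h\<close> is incident to the vertex \<open>v\<close> iff \<open>h \<in> v\<close>.\<close>

definition configurations :: "nat \<Rightarrow> nat \<Rightarrow> nat \<Rightarrow> nat set set set" where
  "configurations d l m = {G. partition_on {1..l * m} G \<and> (\<forall>v\<in>G. card v = d)}"

text \<open>Only meaningful if \<open>d > 0\<close> and \<open>d dvd l * m\<close>, since otherwise there need not be any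
  configuration.\<close>

definition random_configuration :: "nat \<Rightarrow> nat \<Rightarrow> nat \<Rightarrow> nat set set pmf" where
  "random_configuration d l m = pmf_of_set (configurations d l m)"

definition is_matching :: "nat \<Rightarrow> nat \<Rightarrow> nat set set \<Rightarrow> nat set \<Rightarrow> bool" where
  "is_matching l m G M \<longleftrightarrow> M \<subseteq> {1..m} \<and>
     (\<forall>h\<in>half_edges_of l m M. \<forall>h'\<in>half_edges_of l m M. \<forall>v\<in>G. h \<in> v \<and> h' \<in> v \<longrightarrow> h = h')"

text \<open>The edges of the incidence multigraph are the half-edges, so a cycle, being a subgraph
  without isolated nodes, is identified with its set \<open>H\<close> of half-edges; this
  forgets the starting point and the direction. The alternating sequence is
  \<open>v 0, e 0, v 1, \<dots>, v (k - 1), e (k - 1), v 0\<close>, where \<open>e i\<close> is joined to \<open>v i\<close> by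
  the half-edge \<open>a i\<close> and to the next vertex by the half-edge \<open>c i\<close>.\<close>

definition is_cycle :: "nat \<Rightarrow> nat \<Rightarrow> nat set set \<Rightarrow> nat \<Rightarrow> nat set \<Rightarrow> bool" where
  "is_cycle l m G k H \<longleftrightarrow> k \<ge> 1 \<and>
     (\<exists>(e :: nat \<Rightarrow> nat) (v :: nat \<Rightarrow> nat set) (a :: nat \<Rightarrow> nat) (c :: nat \<Rightarrow> nat).
        inj_on e {..<k} \<and> e ` {..<k} \<subseteq> {1..m} \<and>
        inj_on v {..<k} \<and> v ` {..<k} \<subseteq> G \<and>
        (\<forall>i<k. a i \<noteq> c i \<and>
               hyperedge_of l (a i) = e i \<and> hyperedge_of l (c i) = e i \<and>
               a i \<in> v i \<and> c i \<in> v (Suc i mod k)) \<and>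
        H = a ` {..<k} \<union> c ` {..<k})"

definition cycle_count :: "nat \<Rightarrow> nat \<Rightarrow> nat \<Rightarrow> nat set set \<Rightarrow> nat" where
  "cycle_count l m k G = card {H. is_cycle l m G k H}"

text \<open>Laws on \<open>\<real>\<^sup>b\<close>: vectors are the extensional functions on \<open>{1..b}\<close>.\<close>

definition cycle_vector_law :: "nat \<Rightarrow> nat \<Rightarrow> nat \<Rightarrow> nat set set pmf \<Rightarrow> (nat \<Rightarrow> real) measure" where
  "cycle_vector_law l m b p =
     distr (measure_pmf p) (PiM {1..b} (\<lambda>_. borel)) (\<lambda>G. \<lambda>k\<in>{1..b}. real (cycle_count l m k G))"

definition indep_poisson_law :: "nat \<Rightarrow> (nat \<Rightarrow> real) \<Rightarrow> (nat \<Rightarrow> real) measure" where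
  "indep_poisson_law b r = PiM {1..b} (\<lambda>k. distr (measure_pmf (poisson_pmf (r k))) borel real)"

text \<open>Convergence in distribution (weak convergence) of Borel probability measures on \<open>\<real>\<^sup>b\<close>,
  by testing against the bounded continuous functions.\<close>

definition conv_in_distribution ::
    "nat \<Rightarrow> ('i \<Rightarrow> (nat \<Rightarrow> real) measure) \<Rightarrow> (nat \<Rightarrow> real) measure \<Rightarrow> 'i filter \<Rightarrow> bool" where
  "conv_in_distribution b N L F \<longleftrightarrow>
     (\<forall>f :: (nat \<Rightarrow> real) \<Rightarrow> real.
        continuous_map (product_topology (\<lambda>_. euclideanreal) {1..b}) euclideanreal f \<and>
        bounded (f ` ({1..b} \<rightarrow>\<^sub>E UNIV)) \<longrightarrow>
        ((\<lambda>i. \<integral>x. f x \<partial>N i) \<longlongrightarrow> (\<integral>x. f x \<partial>L)) F)"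

definition cycle_rate :: "nat \<Rightarrow> nat \<Rightarrow> nat \<Rightarrow> real" where
  "cycle_rate d l k = (real d - 1) ^ k * (real l - 1) ^ k / (2 * real k)"

definition planted_cycle_rate :: "nat \<Rightarrow> nat \<Rightarrow> real \<Rightarrow> nat \<Rightarrow> real" where
  "planted_cycle_rate d l \<beta> k = cycle_rate d l k * (1 + (-1) ^ k * \<beta> ^ k / (1 - \<beta>) ^ k)"

definition admissible :: "nat \<Rightarrow> nat \<Rightarrow> real \<Rightarrow> nat set" where
  "admissible d l \<beta> = {m. d dvd l * m \<and> real m * \<beta> \<in> \<nat>}"

end

theory Submission
  imports Defs
begin

text \<open>Both parts are one statement about the uniform configuration in which a set \<open>M\<close> of hyperedges
  is a matching: part (1) is the case \<open>M = {}\<close>, \<open>\<beta> = 0\<close>. By the method of factorial moments it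
  suffices to count families of distinct cycles of prescribed lengths.

  Families of pairwise node-disjoint cycles are counted through tuples of half-edges that are linked
  in pairs both by the hyperedges and by the vertices. The law of the configuration is invariant under
  the permutations of the half-edges that preserve the half-edges of \<open>M\<close> (the marked ones). Hence,
  for each pattern of marks, the expected number of such tuples is the number of tuples linked by the
  hyperedges times the number of those linked by the vertices, divided by the number of all tuples.
  The number of pairs of half-edges of a vertex with prescribed marks is the same for all
  configurations. The sum over the patterns of marks along a cycle is the trace of a power of a
  two by two transfer matrix with the eigenvalues \<open>1\<close> and \<open>- \<beta> / (1 - \<beta>)\<close>.

  A family of distinct cycles that are not node-disjoint covers a set of half-edges that meets fewer
  nodes than it has elements; the same invariance shows that the expected number of such sets of
  bounded size tends to \<open>0\<close>.\<close>

section \<open>The method of factorial moments\<close>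

text \<open>The probability that prescribed half-edges share vertices, given that \<open>M\<close>
  is a matching, is awkward to compute directly; the double counting avoids it, and the number of
  configurations is never computed. A hyperedge is marked as a whole, so a pattern is one bit per
  hyperedge and marks change only at vertices. Each hyperedge of a cycle contributes l (l - 1) times
  the density of its mark from the hyperedge links, l (d - 1) times the density of a pair of marks
  from the vertex links, and in the denominator the square of l times the density of its mark. The
  quotient is (l - 1) (d - 1) times the chance that a vertex-mate of a half-edge with the first mark
  has the second mark. A vertex-mate of a marked half-edge is never marked; one of an unmarked
  half-edge is marked with chance r = \<beta> / (1 - \<beta>). The matrix with rows (1 - r, r) and
  (1, 0) is stochastic, whence the eigenvalue 1, and has trace 1 - r, whence the eigenvalue -r.
  Dividing the trace of its k-th power, times ((l - 1) (d - 1))^k, by the 2k labellings of a k-cycle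
  yields the planted rate.\<close>

definition avg :: "'g set \<Rightarrow> ('g \<Rightarrow> real) \<Rightarrow> real" where
  "avg A f = (\<Sum>x\<in>A. f x) / real (card A)"

text \<open>Division by 0 makes \<open>avg\<close> equal to 0 on an empty or infinite set, so the
  rules below hold for every \<open>A\<close>.\<close>

lemma avg_mono: "(\<And>x. x \<in> A \<Longrightarrow> f x \<le> g x) \<Longrightarrow> avg A f \<le> avg A g"
  unfolding avg_def by (intro divide_right_mono sum_mono) auto

lemma avg_cong: "(\<And>x. x \<in> A \<Longrightarrow> f x = g x) \<Longrightarrow> avg A f = avg A g"
  unfolding avg_def by (metis (mono_tags, lifting) sum.cong)

lemma avg_nonneg: "(\<And>x. x \<in> A \<Longrightarrow> 0 \<le> f x) \<Longrightarrow> 0 \<le> avg A f"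
  unfolding avg_def by (intro divide_nonneg_nonneg sum_nonneg) auto

lemma avg_add: "avg A (\<lambda>x. f x + g x) = avg A f + avg A g"
  unfolding avg_def by (simp add: sum.distrib add_divide_distrib)

lemma avg_diff: "avg A (\<lambda>x. f x - g x) = avg A f - avg A g"
  unfolding avg_def by (simp add: sum_subtractf diff_divide_distrib)

lemma avg_sum: "avg A (\<lambda>x. \<Sum>i\<in>I. f i x) = (\<Sum>i\<in>I. avg A (f i))"
  unfolding avg_def by (subst sum.swap) (simp add: sum_divide_distrib)

lemma avg_cmult: "avg A (\<lambda>x. c * f x) = c * avg A f"
  unfolding avg_def by (simp add: sum_distrib_left)

lemma avg_abs_le: "\<bar>avg A f\<bar> \<le> avg A (\<lambda>x. \<bar>f x\<bar>)"
  unfolding avg_def by (simp add: abs_divide divide_right_mono sum_abs)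

text \<open>The indicator of \<open>n = x\<close> is \<open>\<Sum>j. (-1) ^ (j + x) * (j choose x) * (n choose j)\<close>;
  the error of a truncation is at most the first omitted term (Bonferroni).\<close>

lemma bonferroni_point:
  fixes n x r :: nat
  assumes "x \<le> r"
  shows "\<bar>of_bool (n = x) - (\<Sum>j\<le>r. (-1) ^ (j + x) * real (j choose x) * real (n choose j))\<bar>
          \<le> real (Suc r choose x) * real (n choose Suc r)"
proof (cases "n \<le> x")
  case True
  \<comment> \<open>For n \<le> x every term with j different from x vanishes, because one of its
    two binomial coefficients is 0. The truncated sum is then exact.\<close>
  have "(\<Sum>j\<le>r. (-1) ^ (j + x) * real (j choose x) * real (n choose j)) =
        (\<Sum>j\<le>r. if j = x then of_bool (n = x) else 0)"
  proof (rule sum.cong[OF refl])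
    fix j assume "j \<in> {..r}"
    show "(-1) ^ (j + x) * real (j choose x) * real (n choose j) = (if j = x then of_bool (n = x) else 0)"
    proof (cases "j = x")
      case True
      then show ?thesis using \<open>n \<le> x\<close> by (auto simp: power_add simp flip: power_mult_distrib)
    next
      case False
      then have "j < x \<or> n < j" using \<open>n \<le> x\<close> by auto
      then show ?thesis using False by auto
    qed
  qed
  then show ?thesis using assms by (simp add: sum.delta)
next
  case False
  \<comment> \<open>Since (n choose j) (j choose x) = (n choose x) (a choose (j - x)), the sum
    becomes an alternating partial sum of row a of Pascal's triangle. It telescopes to one entry of
    row a - 1, which is at most the next entry of row a.\<close>
  define a where "a = n - x"
  have a: "a > 0" "n = a + x" using False by (auto simp: a_def)
  have tm: "real (j choose x) * real (n choose j) = real (n choose x) * real (a choose (j - x))"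
    if "x \<le> j" for j
  proof (cases "j \<le> n")
    case True
    then have "(n choose j) * (j choose x) = (n choose x) * ((n - x) choose (j - x))"
      using choose_mult[OF that True] by simp
    then show ?thesis by (metis a_def mult.commute of_nat_mult)
  next
    case False
    then show ?thesis using a by (simp add: binomial_eq_0)
  qed
  have sgn: "(-1::real) ^ (j + x) = (-1) ^ (j - x)" if "x \<le> j" for j
    using that by (simp add: minus_one_power_iff)
  have "(\<Sum>j\<le>r. (-1) ^ (j + x) * real (j choose x) * real (n choose j)) =
        (\<Sum>j\<in>{x..r}. (-1) ^ (j + x) * (real (j choose x) * real (n choose j)))"
    by (rule sum.mono_neutral_cong_right) (auto simp: binomial_eq_0)
  also have "\<dots> = (\<Sum>j\<in>{x..r}. (-1) ^ (j + x) * (real (n choose x) * real (a choose (j - x))))"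
    by (intro sum.cong refl) (simp add: tm)
  also have "\<dots> = (\<Sum>i\<le>r - x. (-1) ^ i * (real (n choose x) * real (a choose i)))"
    by (rule sum.reindex_bij_witness[of _ "\<lambda>i. i + x" "\<lambda>j. j - x"])
       (use assms in \<open>auto simp: sgn\<close>)
  also have "\<dots> = real (n choose x) * (\<Sum>i\<le>r - x. (real a gchoose i) * (-1) ^ i)"
    by (simp add: sum_distrib_left binomial_gbinomial mult_ac)
  also have "\<dots> = real (n choose x) * ((-1) ^ (r - x) * real ((a - 1) choose (r - x)))"
    using a by (simp add: gbinomial_sum_lower_neg binomial_gbinomial of_nat_diff)
  finally have S: "(\<Sum>j\<le>r. (-1) ^ (j + x) * real (j choose x) * real (n choose j)) =
     real (n choose x) * ((-1) ^ (r - x) * real ((a - 1) choose (r - x)))" .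
  have "(a - 1) choose (r - x) \<le> a choose Suc (r - x)"
    using a by (cases a) auto
  then have "real (n choose x) * real ((a - 1) choose (r - x)) \<le> real (n choose x) * real (a choose (Suc r - x))"
    using assms by (intro mult_left_mono) (auto simp: Suc_diff_le)
  also have "\<dots> = real (Suc r choose x) * real (n choose Suc r)"
    using tm[of "Suc r"] assms by simp
  finally show ?thesis
    using False unfolding S by (simp add: abs_mult)
qed

text \<open>The mean of (N choose j) for a Poisson variable N of mean c is c^j / j!. Shifted by x,
  the terms are c^x / x! times those of the series of exp (- c).\<close>

lemma poisson_bonferroni_sums:
  fixes c :: real
  shows "(\<lambda>r. \<Sum>j\<le>r. (-1) ^ (j + x) * real (j choose x) * (c ^ j / fact j)) \<longlonglongrightarrow> c ^ x / fact x * exp (- c)"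
proof -
  define a where "a j = (-1) ^ (j + x) * real (j choose x) * (c ^ j / fact j)" for j
  have "(\<lambda>i. a (i + x)) = (\<lambda>i. c ^ x / fact x * ((- c) ^ i /\<^sub>R fact i))"
  proof
    fix i
    have "real ((i + x) choose x) = fact (i + x) / (fact x * fact i)"
      by (subst binomial_fact) auto
    moreover have p: "(-1::real) ^ (i + x + x) = (-1) ^ i" by (simp add: minus_one_power_iff)
    ultimately show "a (i + x) = c ^ x / fact x * ((- c) ^ i /\<^sub>R fact i)"
      using p by (simp add: a_def power_add field_simps power_minus[of c i])
  qed
  moreover have "(\<lambda>i. c ^ x / fact x * ((- c) ^ i /\<^sub>R fact i)) sums (c ^ x / fact x * exp (- c))"
    by (intro sums_mult exp_converges)
  ultimately have "(\<lambda>i. a (i + x)) sums (c ^ x / fact x * exp (- c))" by simp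
  moreover have "(\<Sum>i<x. a i) = 0" by (intro sum.neutral) (auto simp: a_def)
  ultimately have "a sums (c ^ x / fact x * exp (- c))"
    using sums_iff_shift[of a x "c ^ x / fact x * exp (- c)"] by simp
  then show ?thesis unfolding sums_def_le a_def .
qed

lemma poisson_bonferroni_error:
  fixes c :: real
  shows "(\<lambda>r. real (Suc r choose x) * (c ^ Suc r / fact (Suc r))) \<longlonglongrightarrow> 0"
proof -
  have "(\<lambda>i. c ^ x / fact x * (c ^ i / fact i)) \<longlonglongrightarrow> c ^ x / fact x * 0"
    by (intro tendsto_mult tendsto_const) (use summable_LIMSEQ_zero[OF summable_exp[of c]] in \<open>simp add: field_simps\<close>)
  also have "(\<lambda>i. c ^ x / fact x * (c ^ i / fact i)) = (\<lambda>i. real ((i + x) choose x) * (c ^ (i + x) / fact (i + x)))"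
  proof
    fix i
    have "real ((i + x) choose x) = fact (i + x) / (fact x * fact i)"
      by (subst binomial_fact) auto
    then show "c ^ x / fact x * (c ^ i / fact i) = real ((i + x) choose x) * (c ^ (i + x) / fact (i + x))"
      by (simp add: power_add field_simps)
  qed
  finally have "(\<lambda>i. real (i choose x) * (c ^ i / fact i)) \<longlonglongrightarrow> 0"
    using LIMSEQ_offset[of "\<lambda>i. real (i choose x) * (c ^ i / fact i)" x 0] by simp
  then show ?thesis by (rule LIMSEQ_Suc)
qed

text \<open>Takes two limits in turn: along \<open>F\<close> at fixed r, then r to infinity. Here r
  is first the truncation order of Bonferroni's inequality and later the index of a finite set
  carrying most of the mass.\<close>

lemma tendsto_by_approximation:
  fixes f :: "'i \<Rightarrow> real" and g h :: "nat \<Rightarrow> 'i \<Rightarrow> real"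
  assumes bound: "\<And>r. r \<ge> r0 \<Longrightarrow> eventually (\<lambda>i. \<bar>f i - g r i\<bar> \<le> h r i) F"
    and g: "\<And>r. (g r \<longlongrightarrow> g' r) F" and h: "\<And>r. (h r \<longlongrightarrow> h' r) F"
    and g': "g' \<longlonglongrightarrow> l" and h': "h' \<longlonglongrightarrow> 0"
  shows "(f \<longlongrightarrow> l) F"
proof (rule tendstoI)
  fix e :: real assume "e > 0"
  then have e4: "e / 4 > 0" by simp
  have "eventually (\<lambda>r. \<bar>g' r - l\<bar> < e/4) sequentially"
    using tendstoD[OF g' e4] by (simp add: dist_real_def)
  moreover have "eventually (\<lambda>r. \<bar>h' r\<bar> < e/4) sequentially"
    using tendstoD[OF h' e4] by (simp add: dist_real_def)
  ultimately have "eventually (\<lambda>r. r \<ge> r0 \<and> \<bar>g' r - l\<bar> < e/4 \<and> \<bar>h' r\<bar> < e/4) sequentially"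
    using eventually_ge_at_top[of r0] by eventually_elim auto
  then obtain r where r: "r \<ge> r0" "\<bar>g' r - l\<bar> < e/4" "\<bar>h' r\<bar> < e/4"
    using eventually_happens[of _ sequentially] by auto
  have "eventually (\<lambda>i. \<bar>g r i - g' r\<bar> < e/4) F" "eventually (\<lambda>i. \<bar>h r i - h' r\<bar> < e/4) F"
    using tendstoD[OF g e4, of r] tendstoD[OF h e4, of r] by (auto simp: dist_real_def)
  with bound[OF r(1)] show "eventually (\<lambda>i. dist (f i) l < e) F"
  proof eventually_elim
    case (elim i)
    with r show ?case unfolding dist_real_def by linarith
  qed
qed

text \<open>The weight \<open>W\<close> stands for the factors of the other coordinates, so that the
  coordinates of a vector can be treated one after another. Bonferroni's bound survives
  multiplication by \<open>W\<close> because \<open>W\<close> is nonnegative.\<close>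

lemma avg_point_of_factorial_moments:
  fixes W :: "'i \<Rightarrow> 'g \<Rightarrow> real" and X :: "'i \<Rightarrow> 'g \<Rightarrow> nat"
  assumes W: "\<And>i G. W i G \<ge> 0"
    and mom: "\<And>j. ((\<lambda>i. avg (\<Omega> i) (\<lambda>G. W i G * real (X i G choose j))) \<longlongrightarrow> w * (c ^ j / fact j)) F"
  shows "((\<lambda>i. avg (\<Omega> i) (\<lambda>G. W i G * of_bool (X i G = x))) \<longlongrightarrow> w * (c ^ x / fact x * exp (- c))) F"
proof -
  define g where "g r i = (\<Sum>j\<le>r. (-1) ^ (j + x) * real (j choose x) *
    avg (\<Omega> i) (\<lambda>G. W i G * real (X i G choose j)))" for r i
  define h where "h r i = real (Suc r choose x) * avg (\<Omega> i) (\<lambda>G. W i G * real (X i G choose Suc r))" for r i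
  show ?thesis
  proof (rule tendsto_by_approximation)
    show "(g r \<longlongrightarrow> (\<Sum>j\<le>r. (-1) ^ (j + x) * real (j choose x) * (w * (c ^ j / fact j)))) F" for r
      unfolding g_def by (intro tendsto_intros mom)
    show "(h r \<longlongrightarrow> real (Suc r choose x) * (w * (c ^ Suc r / fact (Suc r)))) F" for r
      unfolding h_def by (intro tendsto_intros mom)
    show "(\<lambda>r. \<Sum>j\<le>r. (-1) ^ (j + x) * real (j choose x) * (w * (c ^ j / fact j)))
       \<longlonglongrightarrow> w * (c ^ x / fact x * exp (- c))"
      using tendsto_mult[OF tendsto_const[of w] poisson_bonferroni_sums[of x c]]
      by (simp add: sum_distrib_left mult_ac)
    show "(\<lambda>r. real (Suc r choose x) * (w * (c ^ Suc r / fact (Suc r)))) \<longlonglongrightarrow> 0"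
      using tendsto_mult[OF tendsto_const[of w] poisson_bonferroni_error[of x c]]
      by (simp only: mult_ac mult_zero_right mult_zero_left)
    show "eventually (\<lambda>i. \<bar>avg (\<Omega> i) (\<lambda>G. W i G * of_bool (X i G = x)) - g r i\<bar> \<le> h r i) F" if "r \<ge> x" for r
    proof (rule always_eventually, rule allI)
      fix i
      let ?S = "\<lambda>G. \<Sum>j\<le>r. (-1) ^ (j + x) * real (j choose x) * real (X i G choose j)"
      have g: "g r i = avg (\<Omega> i) (\<lambda>G. W i G * ?S G)"
        unfolding g_def by (simp add: sum_distrib_left mult_ac avg_sum flip: avg_cmult)
      have "\<bar>avg (\<Omega> i) (\<lambda>G. W i G * of_bool (X i G = x)) - g r i\<bar>
          \<le> avg (\<Omega> i) (\<lambda>G. \<bar>W i G * of_bool (X i G = x) - W i G * ?S G\<bar>)"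
        unfolding g by (subst avg_diff[symmetric]) (rule avg_abs_le)
      also have "\<dots> \<le> avg (\<Omega> i) (\<lambda>G. W i G * (real (Suc r choose x) * real (X i G choose Suc r)))"
      proof (rule avg_mono)
        fix G
        have "\<bar>W i G * of_bool (X i G = x) - W i G * ?S G\<bar> = W i G * \<bar>of_bool (X i G = x) - ?S G\<bar>"
          using W[of i G] by (simp add: abs_mult flip: right_diff_distrib)
        also have "\<dots> \<le> W i G * (real (Suc r choose x) * real (X i G choose Suc r))"
          by (intro mult_left_mono bonferroni_point W that)
        finally show "\<bar>W i G * of_bool (X i G = x) - W i G * ?S G\<bar> \<le> \<dots>" .
      qed
      also have "\<dots> = h r i" unfolding h_def by (simp add: mult_ac flip: avg_cmult)
      finally show "\<bar>avg (\<Omega> i) (\<lambda>G. W i G * of_bool (X i G = x)) - g r i\<bar> \<le> h r i" .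
    qed
  qed
qed

text \<open>The induction exchanges binomial coefficients for indicators coordinate by coordinate:
  \<open>A\<close> is the set of coordinates already exchanged. The exponents \<open>j\<close> of
  the others stay arbitrary, because the next exchange needs all moments of its coordinate.\<close>

lemma avg_joint_point_of_factorial_moments:
  fixes X :: "'i \<Rightarrow> 'g \<Rightarrow> 'k \<Rightarrow> nat" and c :: "'k \<Rightarrow> real"
  assumes K: "finite K"
    and mom: "\<And>j. ((\<lambda>i. avg (\<Omega> i) (\<lambda>G. \<Prod>k\<in>K. real (X i G k choose j k))) \<longlongrightarrow> (\<Prod>k\<in>K. c k ^ j k / fact (j k))) F"
  shows "((\<lambda>i. avg (\<Omega> i) (\<lambda>G. \<Prod>k\<in>K. of_bool (X i G k = x k))) \<longlongrightarrow> (\<Prod>k\<in>K. c k ^ x k / fact (x k) * exp (- c k))) F"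
proof -
  have "((\<lambda>i. avg (\<Omega> i) (\<lambda>G. (\<Prod>k\<in>A. of_bool (X i G k = x k)) * (\<Prod>k\<in>K - A. real (X i G k choose j k))))
     \<longlongrightarrow> (\<Prod>k\<in>A. c k ^ x k / fact (x k) * exp (- c k)) * (\<Prod>k\<in>K - A. c k ^ j k / fact (j k))) F"
    if "A \<subseteq> K" for A j
    using finite_subset[OF that K] that
  proof (induction A arbitrary: j rule: finite_induct)
    case empty
    show ?case using mom by simp
  next
    case (insert a A)
    have aK: "a \<in> K" "A \<subseteq> K" using insert by auto
    define B where "B = K - insert a A"
    have KA: "K - A = insert a B" "a \<notin> B" "finite B" using aK insert(2) K by (auto simp: B_def)
    let ?W = "\<lambda>i G. (\<Prod>k\<in>A. of_bool (X i G k = x k)) * (\<Prod>k\<in>B. real (X i G k choose j k))"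
    let ?w = "(\<Prod>k\<in>A. c k ^ x k / fact (x k) * exp (- c k)) * (\<Prod>k\<in>B. c k ^ j k / fact (j k))"
    have "((\<lambda>i. avg (\<Omega> i) (\<lambda>G. ?W i G * of_bool (X i G a = x a))) \<longlongrightarrow> ?w * (c a ^ x a / fact (x a) * exp (- c a))) F"
    proof (rule avg_point_of_factorial_moments)
      show "0 \<le> ?W i G" for i G by (intro mult_nonneg_nonneg prod_nonneg) auto
      fix r
      have e: "(\<Prod>k\<in>B. real (X i G k choose (if k = a then r else j k))) = (\<Prod>k\<in>B. real (X i G k choose j k))" for i G
        using KA(2) by (intro prod.cong) auto
      have e2: "(\<Prod>k\<in>B. c k ^ (if k = a then r else j k) / fact (if k = a then r else j k)) = (\<Prod>k\<in>B. c k ^ j k / fact (j k))"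
        using KA(2) by (intro prod.cong) auto
      show "((\<lambda>i. avg (\<Omega> i) (\<lambda>G. ?W i G * real (X i G a choose r))) \<longlongrightarrow> ?w * (c a ^ r / fact r)) F"
        using insert.IH[OF aK(2), of "j(a := r)"] KA
        by (simp add: prod.insert e e2 mult_ac)
    qed
    then show ?case using insert(1,2) KA by (simp add: B_def[symmetric] mult_ac)
  qed
  from this[OF subset_refl] show ?thesis by simp
qed

section \<open>Weak convergence of laws carried by lattice points\<close>

text \<open>On functions over all of \<open>UNIV\<close> the product sigma-algebra is the Borel one,
  so continuity gives measurability there. Hence the detour: a point over \<open>I\<close> is
  extended by 0, and \<open>f\<close> is applied after restricting back to \<open>I\<close>.\<close>

lemma continuous_test_function_measurable:
  fixes f :: "(nat \<Rightarrow> real) \<Rightarrow> real"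
  assumes f: "continuous_map (product_topology (\<lambda>_. euclideanreal) I) euclideanreal f"
  shows "f \<in> borel_measurable (PiM I (\<lambda>_. borel))"
proof -
  let ?ext = "\<lambda>x i. if i \<in> I then x i else 0"
  have "continuous_map (product_topology (\<lambda>_. euclideanreal) UNIV) (product_topology (\<lambda>_. euclideanreal) I) (\<lambda>x. restrict x I)"
    by (auto simp: continuous_map_componentwise intro!: continuous_map_product_projection)
  then have "continuous_map (product_topology (\<lambda>_. euclideanreal) UNIV) euclideanreal (\<lambda>x. f (restrict x I))"
    using continuous_map_compose[OF _ f] by (simp add: o_def)
  then have "continuous_on UNIV (\<lambda>x. f (restrict x I))"
    by (simp add: euclidean_product_topology)
  then have "(\<lambda>x. f (restrict x I)) \<in> borel_measurable borel"
    by (rule borel_measurable_continuous_onI)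
  then have meas: "(\<lambda>x. f (restrict x I)) \<in> borel_measurable (PiM UNIV (\<lambda>_. borel))"
    using measurable_cong_sets[OF sets_PiM_equal_borel[symmetric] refl] by blast
  have "?ext \<in> measurable (PiM I (\<lambda>_. borel)) (PiM UNIV (\<lambda>_. borel))"
  proof (rule measurable_PiM_single')
    show "(\<lambda>x. ?ext x i) \<in> borel_measurable (PiM I (\<lambda>_. borel))" for i
      by (cases "i \<in> I") auto
  qed auto
  from measurable_compose[OF this meas]
  have "(\<lambda>x. f (restrict (?ext x) I)) \<in> borel_measurable (PiM I (\<lambda>_. borel))" .
  moreover have "f (restrict (?ext x) I) = f x" if "x \<in> space (PiM I (\<lambda>_. borel))" for x
  proof -
    have "restrict (?ext x) I = x"
      using that by (auto simp: space_PiM fun_eq_iff PiE_def extensional_def)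
    then show ?thesis by simp
  qed
  ultimately show ?thesis by (simp cong: measurable_cong)
qed

lemma restrict_measurable_PiM_borel:
  fixes X :: "'g \<Rightarrow> 'k \<Rightarrow> real"
  shows "(\<lambda>G. \<lambda>k\<in>I. X G k) \<in> measurable (measure_pmf p) (PiM I (\<lambda>_. borel))"
  by (rule measurable_restrict) auto

text \<open>Presents the limit as the image of a discrete law, so that it can be compared with the
  cycle counts probability by probability. Two measures on a product agree once they agree on
  boxes.\<close>

lemma indep_poisson_law_eq:
  "indep_poisson_law b r =
     distr (measure_pmf (Pi_pmf {1..b} 0 (\<lambda>k. poisson_pmf (r k)))) (PiM {1..b} (\<lambda>_. borel))
       (\<lambda>x. \<lambda>k\<in>{1..b}. real (x k))"
proof -
  let ?M = "\<lambda>k. distr (measure_pmf (poisson_pmf (r k))) borel real"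
  let ?P = "Pi_pmf {1..b} 0 (\<lambda>k. poisson_pmf (r k))"
  interpret prob_space "?M k" for k
    by (rule prob_space.prob_space_distr) (auto intro: prob_space_measure_pmf)
  interpret product_sigma_finite ?M by standard
  have sets_eq: "sets (PiM {1..b} ?M) = sets (PiM {1..b} (\<lambda>_. borel))"
    by (intro sets_PiM_cong) auto
  have "distr (measure_pmf ?P) (PiM {1..b} (\<lambda>_. borel)) (\<lambda>x. \<lambda>k\<in>{1..b}. real (x k)) = PiM {1..b} ?M"
  proof (rule PiM_eqI)
    show "sets (distr (measure_pmf ?P) (PiM {1..b} (\<lambda>_. borel)) (\<lambda>x. \<lambda>k\<in>{1..b}. real (x k))) = sets (PiM {1..b} ?M)"
      by (simp only: sets_distr sets_eq)
    fix A assume "\<And>i. i \<in> {1..b} \<Longrightarrow> A i \<in> sets (?M i)"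
    then have A: "\<And>i. i \<in> {1..b} \<Longrightarrow> A i \<in> sets borel" by simp
    have "emeasure (distr (measure_pmf ?P) (PiM {1..b} (\<lambda>_. borel)) (\<lambda>x. \<lambda>k\<in>{1..b}. real (x k))) (Pi\<^sub>E {1..b} A)
       = emeasure ?P ((\<lambda>x. \<lambda>k\<in>{1..b}. real (x k)) -` Pi\<^sub>E {1..b} A)"
      using A by (subst emeasure_distr) (auto intro!: restrict_measurable_PiM_borel sets_PiM_I_finite simp: space_PiM)
    also have "(\<lambda>x. \<lambda>k\<in>{1..b}. real (x k)) -` Pi\<^sub>E {1..b} A = Pi {1..b} (\<lambda>k. real -` A k)"
      by (auto simp: Pi_iff PiE_iff)
    also have "emeasure ?P \<dots> = ennreal (\<Prod>k\<in>{1..b}. measure (poisson_pmf (r k)) (real -` A k))"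
      by (simp add: measure_pmf.emeasure_eq_measure measure_Pi_pmf_Pi)
    also have "\<dots> = (\<Prod>k\<in>{1..b}. emeasure (?M k) (A k))"
      using A by (simp add: emeasure_distr measure_pmf.emeasure_eq_measure prod_ennreal)
    finally show "emeasure (distr (measure_pmf ?P) (PiM {1..b} (\<lambda>_. borel)) (\<lambda>x. \<lambda>k\<in>{1..b}. real (x k))) (Pi\<^sub>E {1..b} A)
      = (\<Prod>k\<in>{1..b}. emeasure (?M k) (A k))" .
  qed simp
  then show ?thesis by (simp add: indep_poisson_law_def)
qed

lemma expectation_restrict_finite_error:
  fixes f :: "'a \<Rightarrow> real" and p :: "'a pmf"
  assumes K: "finite K" and f: "\<And>x. \<bar>f x\<bar> \<le> B"
  shows "\<bar>measure_pmf.expectation p f - (\<Sum>x\<in>K. pmf p x * f x)\<bar> \<le> B * (1 - (\<Sum>x\<in>K. pmf p x))"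
proof -
  have int: "integrable p (\<lambda>x. f x * indicator S x)" for S
    by (rule measure_pmf.integrable_const_bound[where B = B])
       (use f in \<open>auto simp: indicator_def intro: order.trans[OF abs_ge_zero]\<close>)
  have "measure_pmf.expectation p f = measure_pmf.expectation p (\<lambda>x. f x * indicator K x + f x * indicator (- K) x)"
    by (rule Bochner_Integration.integral_cong) (auto simp: indicator_def)
  also have "\<dots> = measure_pmf.expectation p (\<lambda>x. f x * indicator K x) + measure_pmf.expectation p (\<lambda>x. f x * indicator (-K) x)"
    by (rule Bochner_Integration.integral_add[OF int int])
  also have "measure_pmf.expectation p (\<lambda>x. f x * indicator K x) = (\<Sum>x\<in>K. f x * indicator K x * pmf p x)"
    by (rule integral_measure_pmf_real[OF K]) (auto simp: indicator_def split: if_splits)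
  also have "\<dots> = (\<Sum>x\<in>K. pmf p x * f x)"
    by (intro sum.cong) auto
  finally have "\<bar>measure_pmf.expectation p f - (\<Sum>x\<in>K. pmf p x * f x)\<bar> = \<bar>measure_pmf.expectation p (\<lambda>x. f x * indicator (-K) x)\<bar>"
    by simp
  also have "\<dots> \<le> measure_pmf.expectation p (\<lambda>x. \<bar>f x * indicator (-K) x\<bar>)"
    by (rule integral_abs_bound)
  also have "\<dots> \<le> measure_pmf.expectation p (\<lambda>x. B * indicator (-K) x)"
  proof (rule integral_mono[OF integrable_abs[OF int]])
    show "integrable p (\<lambda>x. B * indicator (- K) x)"
      by (rule measure_pmf.integrable_const_bound[where B = "\<bar>B\<bar>"]) (auto simp: indicator_def)
  qed (use f in \<open>auto simp: indicator_def\<close>)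
  also have "\<dots> = B * measure p (- K)" by simp
  also have "measure p (- K) = 1 - (\<Sum>x\<in>K. pmf p x)"
    using measure_pmf.prob_compl[of K p] measure_measure_pmf_finite[OF K, of p] by (simp add: Compl_eq_Diff_UNIV)
  finally show ?thesis .
qed

lemma pmf_finite_mass:
  fixes p :: "'a pmf"
  assumes "e > 0"
  shows "\<exists>K. finite K \<and> (\<Sum>x\<in>K. pmf p x) > 1 - e"
proof -
  have "pmf p summable_on UNIV"
    using pmf_abs_summable[of p UNIV] abs_summable_equivalent[of "pmf p" UNIV] by (auto intro: abs_summable_summable)
  moreover have "infsum (pmf p) UNIV = 1"
    using infsetsum_pmf_eq_1[of p UNIV] infsetsum_infsum[OF pmf_abs_summable[of p UNIV]] by simp
  ultimately have "(pmf p has_sum 1) UNIV"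
    using has_sum_infsum by fastforce
  then have "eventually (\<lambda>K. sum (pmf p) K > 1 - e) (finite_subsets_at_top UNIV)"
    unfolding has_sum_def using assms by (intro order_tendstoD) auto
  then show ?thesis by (auto simp: eventually_finite_subsets_at_top)
qed

text \<open>Scheffe: it suffices to compare the expectations on a finite set carrying almost all the
  mass of the limit.\<close>

lemma expectation_tendsto_of_pmf_tendsto:
  fixes f :: "'a \<Rightarrow> real" and p :: "'i \<Rightarrow> 'a pmf" and q :: "'a pmf"
  assumes p: "\<And>x. ((\<lambda>i. pmf (p i) x) \<longlongrightarrow> pmf q x) F" and f: "\<And>x. \<bar>f x\<bar> \<le> B"
  shows "((\<lambda>i. measure_pmf.expectation (p i) f) \<longlongrightarrow> measure_pmf.expectation q f) F"
proof -
  have "\<exists>K. finite K \<and> (\<Sum>x\<in>K. pmf q x) > 1 - inverse (real (Suc r))" for r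
    by (rule pmf_finite_mass) auto
  then obtain K where K: "\<And>r. finite (K r)" "\<And>r. (\<Sum>x\<in>K r. pmf q x) > 1 - inverse (real (Suc r))"
    by metis
  define t where "t r = 1 - (\<Sum>x\<in>K r. pmf q x)" for r
  have t0: "0 \<le> t r" for r
    using measure_pmf.prob_le_1[of q "K r"] by (simp add: t_def measure_measure_pmf_finite[OF K(1)])
  have "t \<longlonglongrightarrow> 0"
    by (rule tendsto_sandwich[OF _ _ tendsto_const LIMSEQ_inverse_real_of_nat])
       (use t0 K(2) in \<open>auto simp: t_def intro!: always_eventually less_imp_le\<close>, smt (verit) K(2))
  have "(\<lambda>r. (\<Sum>x\<in>K r. pmf q x * f x) - measure_pmf.expectation q f) \<longlonglongrightarrow> 0"
  proof (rule Lim_null_comparison)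
    show "eventually (\<lambda>r. norm ((\<Sum>x\<in>K r. pmf q x * f x) - measure_pmf.expectation q f) \<le> B * t r) sequentially"
      using expectation_restrict_finite_error[OF K(1) f, where p = q]
      by (intro always_eventually allI) (simp add: t_def abs_minus_commute)
    show "(\<lambda>r. B * t r) \<longlonglongrightarrow> 0"
      using tendsto_mult[OF tendsto_const[of B] \<open>t \<longlonglongrightarrow> 0\<close>] by simp
  qed
  then have lim_q: "(\<lambda>r. \<Sum>x\<in>K r. pmf q x * f x) \<longlonglongrightarrow> measure_pmf.expectation q f"
    by (rule LIM_zero_cancel)
  show ?thesis
  proof (rule tendsto_by_approximation[OF _ _ _ lim_q])
    show "eventually (\<lambda>i. \<bar>measure_pmf.expectation (p i) f - (\<Sum>x\<in>K r. pmf (p i) x * f x)\<bar>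
      \<le> B * (1 - (\<Sum>x\<in>K r. pmf (p i) x))) F" for r
      by (intro always_eventually allI expectation_restrict_finite_error K f)
    show "((\<lambda>i. \<Sum>x\<in>K r. pmf (p i) x * f x) \<longlongrightarrow> (\<Sum>x\<in>K r. pmf q x * f x)) F" for r
      by (intro tendsto_intros p)
    show "((\<lambda>i. B * (1 - (\<Sum>x\<in>K r. pmf (p i) x))) \<longlongrightarrow> B * t r) F" for r
      unfolding t_def by (intro tendsto_intros p)
    show "(\<lambda>r. B * t r) \<longlonglongrightarrow> 0"
      using tendsto_mult[OF tendsto_const[of B] \<open>t \<longlonglongrightarrow> 0\<close>] by simp
  qed
qed
text \<open>Before passing to real vectors all laws are discrete on the same type, where convergence
  of point probabilities controls every bounded function. Vectors are padded with 0 outside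
  \<open>{1..b}\<close> to match the default value of \<open>Pi_pmf\<close>.\<close>

lemma conv_in_distribution_of_pmf_tendsto:
  assumes "\<And>x. ((\<lambda>i. pmf (map_pmf (\<lambda>G k. if k \<in> {1..b} then X i G k else 0) (p i)) x)
      \<longlongrightarrow> pmf (Pi_pmf {1..b} 0 (\<lambda>k. poisson_pmf (r k))) x) F"
  shows "conv_in_distribution b
     (\<lambda>i. distr (measure_pmf (p i)) (PiM {1..b} (\<lambda>_. borel)) (\<lambda>G. \<lambda>k\<in>{1..b}. real (X i G k)))
     (indep_poisson_law b r) F"
  unfolding conv_in_distribution_def
proof (intro allI impI, elim conjE)
  fix f :: "(nat \<Rightarrow> real) \<Rightarrow> real"
  assume f: "continuous_map (product_topology (\<lambda>_. euclideanreal) {1..b}) euclideanreal f"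
    and bounded: "bounded (f ` ({1..b} \<rightarrow>\<^sub>E UNIV))"
  note meas = continuous_test_function_measurable[OF f]
  obtain B where B: "\<And>x. x \<in> {1..b} \<rightarrow>\<^sub>E UNIV \<Longrightarrow> \<bar>f x\<bar> \<le> B"
    using bounded by (auto simp: bounded_iff)
  let ?g = "\<lambda>x. f (\<lambda>k\<in>{1..b}. real (x k))"
  have lhs: "(\<integral>x. f x \<partial>distr (measure_pmf (p i)) (PiM {1..b} (\<lambda>_. borel)) (\<lambda>G. \<lambda>k\<in>{1..b}. real (X i G k)))
     = measure_pmf.expectation (map_pmf (\<lambda>G k. if k \<in> {1..b} then X i G k else 0) (p i)) ?g" for i
  proof -
    have "(\<lambda>k\<in>{1..b}. real (if k \<in> {1..b} then X i G k else 0)) = (\<lambda>k\<in>{1..b}. real (X i G k))" for G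
      by (auto simp: restrict_def)
    then show ?thesis
      by (simp only: integral_distr[OF restrict_measurable_PiM_borel meas] integral_map_pmf)
  qed
  have rhs: "(\<integral>x. f x \<partial>indep_poisson_law b r) = measure_pmf.expectation (Pi_pmf {1..b} 0 (\<lambda>k. poisson_pmf (r k))) ?g"
    unfolding indep_poisson_law_eq by (simp only: integral_distr[OF restrict_measurable_PiM_borel meas])
  show "((\<lambda>i. \<integral>x. f x \<partial>distr (measure_pmf (p i)) (PiM {1..b} (\<lambda>_. borel)) (\<lambda>G. \<lambda>k\<in>{1..b}. real (X i G k)))
     \<longlongrightarrow> (\<integral>x. f x \<partial>indep_poisson_law b r)) F"
    unfolding lhs rhs
    by (rule expectation_tendsto_of_pmf_tendsto[where B = B, OF assms]) (rule B, auto)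
qed

lemma conv_in_distribution_poisson_of_factorial_moments:
  fixes \<Omega> :: "'i \<Rightarrow> 'g set" and X :: "'i \<Rightarrow> 'g \<Rightarrow> nat \<Rightarrow> nat"
  assumes \<Omega>: "eventually (\<lambda>i. finite (\<Omega> i) \<and> \<Omega> i \<noteq> {}) F" and r: "\<And>k. k \<in> {1..b} \<Longrightarrow> r k > 0"
    and p: "eventually (\<lambda>i. p i = pmf_of_set (\<Omega> i)) F"
    and mom: "\<And>j. ((\<lambda>i. avg (\<Omega> i) (\<lambda>G. \<Prod>k=1..b. real (X i G k choose j k))) \<longlongrightarrow> (\<Prod>k=1..b. r k ^ j k / fact (j k))) F"
  shows "conv_in_distribution b
     (\<lambda>i. distr (measure_pmf (p i)) (PiM {1..b} (\<lambda>_. borel)) (\<lambda>G. \<lambda>k\<in>{1..b}. real (X i G k)))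
     (indep_poisson_law b r) F"
proof (rule conv_in_distribution_of_pmf_tendsto)
  fix x :: "nat \<Rightarrow> nat"
  let ?q = "\<lambda>i. pmf (map_pmf (\<lambda>G k. if k \<in> {1..b} then X i G k else 0) (p i)) x"
  let ?Q = "pmf (Pi_pmf {1..b} 0 (\<lambda>k. poisson_pmf (r k))) x"
  show "(?q \<longlongrightarrow> ?Q) F"
  proof (cases "\<forall>k. k \<notin> {1..b} \<longrightarrow> x k = 0")
    case True
    have Q: "?Q = (\<Prod>k=1..b. r k ^ x k / fact (x k) * exp (- r k))"
    proof -
      have "?Q = (\<Prod>k=1..b. pmf (poisson_pmf (r k)) (x k))"
        using True by (subst pmf_Pi') auto
      also have "\<dots> = (\<Prod>k=1..b. r k ^ x k / fact (x k) * exp (- r k))"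
        by (intro prod.cong refl pmf_poisson r)
      finally show ?thesis .
    qed
    have "((\<lambda>i. avg (\<Omega> i) (\<lambda>G. \<Prod>k=1..b. of_bool (X i G k = x k))) \<longlongrightarrow> ?Q) F"
      unfolding Q using avg_joint_point_of_factorial_moments[OF _ mom, of x] by simp
    moreover have "eventually (\<lambda>i. avg (\<Omega> i) (\<lambda>G. \<Prod>k=1..b. of_bool (X i G k = x k)) = ?q i) F"
      using \<Omega> p
    proof eventually_elim
      case (elim i)
      have *: "(\<lambda>G k. if k \<in> {1..b} then X i G k else 0) -` {x} = {G. \<forall>k\<in>{1..b}. X i G k = x k}"
        using True by (auto simp: fun_eq_iff)
      have "?q i = real (card (\<Omega> i \<inter> {G. \<forall>k\<in>{1..b}. X i G k = x k})) / card (\<Omega> i)"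
        using elim by (simp only: pmf_map *) (simp add: measure_pmf_of_set)
      also have "\<dots> = avg (\<Omega> i) (\<lambda>G. of_bool (\<forall>k\<in>{1..b}. X i G k = x k))"
        using elim by (simp add: avg_def of_bool_def sum.If_cases)
      also have "\<dots> = avg (\<Omega> i) (\<lambda>G. \<Prod>k=1..b. of_bool (X i G k = x k))"
        by (rule avg_cong) auto
      finally show ?case by simp
    qed
    ultimately show ?thesis by (rule Lim_transform_eventually)
  next
    case False
    then obtain k where k: "k \<notin> {1..b}" "x k \<noteq> 0" by auto
    have "?Q = 0" by (rule pmf_Pi_outside) (use k in auto)
    moreover have "?q i = 0" for i
      using k by (auto simp: pmf_eq_0_set_pmf)
    ultimately show ?thesis by simp
  qed
qed

section \<open>Counting linked tuples\<close>

text \<open>Serves three counts: \<open>g = id\<close> gives injective tuples, while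
  \<open>g\<close> taking a pair to the block of its first component gives pairs in distinct
  hyperedges or in distinct vertices.\<close>

definition injfam :: "('q \<Rightarrow> 'x set) \<Rightarrow> ('x \<Rightarrow> 'y) \<Rightarrow> 'q set \<Rightarrow> ('q \<Rightarrow> 'x) set" where
  "injfam S g R = {f \<in> PiE R S. inj_on (\<lambda>q. g (f q)) R}"

text \<open>A choice on \<open>R\<close> is extended by a value at \<open>q\<close>. At most
  \<open>card R\<close> blocks are forbidden for it, and each of them holds at most \<open>c\<close>
  candidates.\<close>

lemma card_injfam_insert:
  assumes R: "finite R" "q \<notin> R" and S: "\<And>r. r \<in> insert q R \<Longrightarrow> finite (S r)"
    and c: "\<And>z. card {y \<in> S q. g y = z} \<le> c"
  shows "card (injfam S g (insert q R)) \<le> card (injfam S g R) * card (S q)"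
    and "real (card (injfam S g (insert q R))) \<ge> real (card (injfam S g R)) * (real (card (S q)) - real (card R * c))"
proof -
  let ?T = "\<lambda>f. {y \<in> S q. g y \<notin> (\<lambda>r. g (f r)) ` R}"
  have fin: "finite (injfam S g R)"
    by (rule finite_subset[of _ "PiE R S"]) (use R S in \<open>auto simp: injfam_def intro: finite_PiE\<close>)
  have finT: "finite (?T f)" for f using S by auto
  have "bij_betw (\<lambda>(f, y). f(q := y)) (Sigma (injfam S g R) ?T) (injfam S g (insert q R))"
  proof (rule bij_betw_byWitness[where f' = "\<lambda>f. (f(q := undefined), f q)"])
    show "\<forall>a\<in>Sigma (injfam S g R) ?T. (\<lambda>f. (f(q := undefined), f q)) ((\<lambda>(f, y). f(q := y)) a) = a"
      using R by (auto simp: injfam_def PiE_def extensional_def fun_eq_iff)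
    show "\<forall>a'\<in>injfam S g (insert q R). (\<lambda>(f, y). f(q := y)) ((\<lambda>f. (f(q := undefined), f q)) a') = a'"
      by auto
    show "(\<lambda>(f, y). f(q := y)) ` Sigma (injfam S g R) ?T \<subseteq> injfam S g (insert q R)"
    proof clarify
      fix f y assume f: "f \<in> injfam S g R" and y: "y \<in> S q" "g y \<notin> (\<lambda>r. g (f r)) ` R"
      have "inj_on (\<lambda>r. g ((f(q := y)) r)) R = inj_on (\<lambda>r. g (f r)) R"
        using R by (intro inj_on_cong) auto
      moreover have "(\<lambda>r. g ((f(q := y)) r)) ` R = (\<lambda>r. g (f r)) ` R"
        using R by (intro image_cong) auto
      ultimately show "f(q := y) \<in> injfam S g (insert q R)"
        using f y R by (auto simp: injfam_def PiE_fun_upd)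
    qed
    show "(\<lambda>f. (f(q := undefined), f q)) ` injfam S g (insert q R) \<subseteq> Sigma (injfam S g R) ?T"
    proof (intro subsetI, elim imageE)
      fix p f assume p: "p = (f(q := undefined), f q)" and f: "f \<in> injfam S g (insert q R)"
      have "inj_on (\<lambda>r. g ((f(q := undefined)) r)) R = inj_on (\<lambda>r. g (f r)) R"
        using R by (intro inj_on_cong) auto
      moreover have "(\<lambda>r. g ((f(q := undefined)) r)) ` R = (\<lambda>r. g (f r)) ` R"
        using R by (intro image_cong) auto
      ultimately show "p \<in> Sigma (injfam S g R) ?T"
        using f R unfolding p by (auto simp: injfam_def fun_upd_in_PiE)
    qed
  qed
  then have eq: "card (injfam S g (insert q R)) = (\<Sum>f\<in>injfam S g R. card (?T f))"
    using fin finT by (simp add: card_SigmaI flip: bij_betw_same_card)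
  have "card (?T f) \<le> card (S q)" for f by (intro card_mono S) auto
  then show "card (injfam S g (insert q R)) \<le> card (injfam S g R) * card (S q)"
    unfolding eq using sum_bounded_above[of "injfam S g R" "\<lambda>f. card (?T f)" "card (S q)"] by simp
  have le: "card (S q) \<le> card (?T f) + card R * c" for f
  proof -
    have "S q = ?T f \<union> (\<Union>r\<in>R. {y \<in> S q. g y = g (f r)})" by auto
    then have "card (S q) \<le> card (?T f) + card (\<Union>r\<in>R. {y \<in> S q. g y = g (f r)})"
      using card_Un_le[of "?T f" "\<Union>r\<in>R. {y \<in> S q. g y = g (f r)}"] by (simp only:)
    also have "card (\<Union>r\<in>R. {y \<in> S q. g y = g (f r)}) \<le> (\<Sum>r\<in>R. card {y \<in> S q. g y = g (f r)})"
      by (rule card_UN_le[OF R(1)])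
    also have "\<dots> \<le> card R * c" using sum_bounded_above[of R _ c] c by auto
    finally show ?thesis by simp
  qed
  have "real (card (S q)) - real (card R * c) \<le> real (card (?T f))" for f
    using of_nat_mono[OF le[of f], where 'a = real] by (simp add: algebra_simps)
  then show "real (card (injfam S g (insert q R))) \<ge> real (card (injfam S g R)) * (real (card (S q)) - real (card R * c))"
    unfolding eq using sum_bounded_below[of "injfam S g R" "real (card (S q)) - real (card R * c)" "\<lambda>f. real (card (?T f))"] by simp
qed

text \<open>Distinctness excludes a bounded number of candidates out of a number of order u, so it
  does not affect the leading term and the counts simply multiply.\<close>

lemma card_injfam_tendsto:
  fixes S :: "'i \<Rightarrow> 'q \<Rightarrow> 'x set" and u :: "'i \<Rightarrow> real"
  assumes "finite R" and u: "filterlim u at_top F"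
    and S: "\<And>q. q \<in> R \<Longrightarrow> eventually (\<lambda>i. finite (S i q) \<and> (\<forall>z. card {y \<in> S i q. g i y = z} \<le> c)) F"
    and s: "\<And>q. q \<in> R \<Longrightarrow> ((\<lambda>i. real (card (S i q)) / u i) \<longlongrightarrow> s q) F"
  shows "((\<lambda>i. real (card (injfam (S i) (g i) R)) / u i ^ card R) \<longlongrightarrow> (\<Prod>q\<in>R. s q)) F"
  using assms(1) S s
proof (induction R rule: finite_induct)
  case empty
  have "injfam (S i) (g i) {} = {\<lambda>_. undefined}" for i by (auto simp: injfam_def)
  then show ?case by simp
next
  case (insert q R)
  let ?n = "\<lambda>i. real (card (injfam (S i) (g i) R)) / u i ^ card R"
  have IH: "(?n \<longlongrightarrow> (\<Prod>q\<in>R. s q)) F" using insert by auto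
  have u0: "((\<lambda>i. real (card R * c) / u i) \<longlongrightarrow> 0) F"
    using u by (intro tendsto_divide_0[OF tendsto_const] filterlim_at_top_imp_at_infinity)
  have fin: "eventually (\<lambda>i. \<forall>r\<in>insert q R. finite (S i r)) F"
    using insert.hyps insert.prems(1) by (simp add: eventually_ball_finite_distrib eventually_conj_iff)
  have c: "eventually (\<lambda>i. \<forall>z. card {y \<in> S i q. g i y = z} \<le> c) F"
    using insert.prems(1)[of q] by (auto elim: eventually_mono)
  have pos: "eventually (\<lambda>i. u i > 0) F" using u by (simp add: filterlim_at_top_dense)
  show ?case
  proof (rule tendsto_sandwich)
    show "((\<lambda>i. ?n i * (real (card (S i q)) / u i - real (card R * c) / u i)) \<longlongrightarrow> (\<Prod>q\<in>insert q R. s q)) F"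
      using tendsto_mult[OF IH tendsto_diff[OF insert.prems(2)[of q] u0]] insert by (simp add: mult.commute)
    show "((\<lambda>i. ?n i * (real (card (S i q)) / u i)) \<longlongrightarrow> (\<Prod>q\<in>insert q R. s q)) F"
      using tendsto_mult[OF IH insert.prems(2)[of q]] insert by (simp add: mult.commute)
    show "eventually (\<lambda>i. real (card (injfam (S i) (g i) (insert q R))) / u i ^ card (insert q R)
        \<le> ?n i * (real (card (S i q)) / u i)) F"
      using fin c pos
    proof eventually_elim
      case (elim i)
      have "real (card (injfam (S i) (g i) (insert q R))) \<le> real (card (injfam (S i) (g i) R) * card (S i q))"
        using card_injfam_insert(1)[of R q "S i" "g i" c] insert.hyps elim by (intro of_nat_mono) auto
      then have "real (card (injfam (S i) (g i) (insert q R))) / u i ^ Suc (card R)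
          \<le> real (card (injfam (S i) (g i) R) * card (S i q)) / u i ^ Suc (card R)"
        using elim(3) by (intro divide_right_mono) auto
      moreover have "?n i * (real (card (S i q)) / u i) = real (card (injfam (S i) (g i) R) * card (S i q)) / u i ^ Suc (card R)"
        by simp
      ultimately show ?case by (simp only: card_insert_disjoint[OF insert(1,2)])
    qed
    show "eventually (\<lambda>i. ?n i * (real (card (S i q)) / u i - real (card R * c) / u i)
        \<le> real (card (injfam (S i) (g i) (insert q R))) / u i ^ card (insert q R)) F"
      using fin c pos
    proof eventually_elim
      case (elim i)
      have "real (card (injfam (S i) (g i) (insert q R))) \<ge> real (card (injfam (S i) (g i) R)) * (real (card (S i q)) - real (card R * c))"
        using insert.hyps elim by (intro card_injfam_insert(2)) auto
      then have "real (card (injfam (S i) (g i) R)) * (real (card (S i q)) - real (card R * c)) / u i ^ Suc (card R)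
         \<le> real (card (injfam (S i) (g i) (insert q R))) / u i ^ Suc (card R)"
        using elim(3) by (intro divide_right_mono) auto
      moreover have "?n i * (real (card (S i q)) / u i - real (card R * c) / u i) =
          real (card (injfam (S i) (g i) R)) * (real (card (S i q)) - real (card R * c)) / u i ^ Suc (card R)"
        by (simp add: diff_divide_distrib[symmetric])
      ultimately show ?case by (simp only: card_insert_disjoint[OF insert(1,2)])
    qed
  qed
qed

text \<open>To be used for the hyperedges as well as for the vertices of a configuration.\<close>

locale blocks =
  fixes V :: "'a set" and f :: "'a \<Rightarrow> 'b" and c :: nat
  assumes finite_V: "finite V" and card_block: "\<And>x. x \<in> V \<Longrightarrow> card {y \<in> V. f y = f x} = c"
begin

definition pairs :: "'a set \<Rightarrow> 'a set \<Rightarrow> ('a \<times> 'a) set" where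
  "pairs D E = {(x, y). x \<in> D \<and> y \<in> E \<and> x \<noteq> y \<and> f x = f y}"

lemma card_block_le: "card {y \<in> V. f y = z} \<le> c"
proof (cases "\<exists>x\<in>V. f x = z")
  case True
  then show ?thesis using card_block by auto
next
  case False
  then have "{y \<in> V. f y = z} = {}" by auto
  then show ?thesis by (simp only: card.empty)
qed

lemma finite_pairs: "D \<subseteq> V \<Longrightarrow> E \<subseteq> V \<Longrightarrow> finite (pairs D E)"
  by (rule finite_subset[of _ "V \<times> V"]) (auto simp: pairs_def finite_V)

lemma card_pairs_all:
  assumes "D \<subseteq> V"
  shows "card (pairs D V) = card D * (c - 1)"
proof -
  have "pairs D V = (SIGMA x:D. {y \<in> V. f y = f x} - {x})"
    by (auto simp: pairs_def)
  also have "card \<dots> = (\<Sum>x\<in>D. card ({y \<in> V. f y = f x} - {x}))"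
    using assms finite_V by (intro card_SigmaI) (auto intro: finite_subset)
  also have "\<dots> = (\<Sum>x\<in>D. c - 1)"
    using assms finite_V by (intro sum.cong refl) (subst card_Diff_singleton, auto simp: card_block)
  finally show ?thesis by simp
qed

lemma card_pairs_conflict: 
  assumes "D \<subseteq> V" "E \<subseteq> V"
  shows "card {p \<in> pairs D E. f (fst p) = z} \<le> c * c"
proof -
  have "card {p \<in> pairs D E. f (fst p) = z} \<le> card ({y \<in> V. f y = z} \<times> {y \<in> V. f y = z})"
    using assms finite_V by (intro card_mono) (auto simp: pairs_def)
  also have "\<dots> \<le> c * c" by (simp add: card_cartesian_product mult_le_mono card_block_le)
  finally show ?thesis .
qed

lemma pairs_swap: "card (pairs D E) = card (pairs E D)"
  by (rule bij_betw_same_card[of prod.swap]) (rule bij_betw_byWitness[where f' = prod.swap], auto simp: pairs_def)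

text \<open>In a matching no two marked half-edges share a vertex, so all c - 1 partners of a marked
  half-edge are unmarked. This fixes every pair count by the sizes of \<open>V\<close> and
  \<open>L\<close> alone.\<close>

lemma pairs_transversal:
  assumes L: "L \<subseteq> V" and inj: "inj_on f L"
  shows "pairs L L = {}" and "card (pairs L (V - L)) = card L * (c - 1)"
    and "card (pairs (V - L) L) = card L * (c - 1)"
    and "card (pairs (V - L) (V - L)) + 2 * (card L * (c - 1)) = card V * (c - 1)"
proof -
  show e: "pairs L L = {}" using inj by (auto simp: pairs_def inj_on_def)
  have "pairs L V = pairs L L \<union> pairs L (V - L)" using L by (auto simp: pairs_def)
  then show 1: "card (pairs L (V - L)) = card L * (c - 1)"
    using card_pairs_all[OF L] e by simp
  then show 2: "card (pairs (V - L) L) = card L * (c - 1)" by (subst pairs_swap)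
  have "pairs (V - L) V = pairs (V - L) L \<union> pairs (V - L) (V - L)" using L by (auto simp: pairs_def)
  then have "card (pairs (V - L) V) = card (pairs (V - L) L) + card (pairs (V - L) (V - L))"
    using L finite_pairs[of "V - L" L] finite_pairs[of "V - L" "V - L"]
    by (subst card_Un_disjoint[symmetric]) (auto simp: pairs_def)
  moreover have "card V = card (V - L) + card L"
    using L finite_V by (metis add.commute card_Diff_subset card_mono finite_subset le_add_diff_inverse)
  ultimately show "card (pairs (V - L) (V - L)) + 2 * (card L * (c - 1)) = card V * (c - 1)"
    using card_pairs_all[of "V - L"] 2 by (simp add: add_mult_distrib)
qed

text \<open>A union bound: list \<open>h\<close> blocks that cover the tuple, then each coordinate
  has at most h c values. The exponent h of the number of blocks is what matters later, the second
  factor is constant.\<close>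

lemma card_tuples_few_blocks:
  assumes Q: "finite Q" "Q \<noteq> {}"
  shows "card {t \<in> Q \<rightarrow>\<^sub>E V. card (f ` t ` Q) \<le> h} \<le> card (f ` V) ^ h * (h * c) ^ card Q"
proof -
  let ?G = "{..<h} \<rightarrow>\<^sub>E f ` V"
  let ?U = "\<lambda>g. {y \<in> V. f y \<in> g ` {..<h}}"
  have "{t \<in> Q \<rightarrow>\<^sub>E V. card (f ` t ` Q) \<le> h} \<subseteq> (\<Union>g\<in>?G. Q \<rightarrow>\<^sub>E ?U g)"
  proof clarify
    fix t assume t: "t \<in> Q \<rightarrow>\<^sub>E V" "card (f ` t ` Q) \<le> h"
    let ?B = "f ` t ` Q"
    have B: "finite ?B" "?B \<noteq> {}" using Q by auto
    obtain e where e: "bij_betw e {0..<card ?B} ?B" using ex_bij_betw_nat_finite[OF B(1)] by auto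
    \<comment> \<open>If the tuple meets fewer than \<open>h\<close> blocks, the list is padded with
      \<open>e 0\<close>, which is a block because \<open>Q\<close> is nonempty.\<close>
    define g where "g = (\<lambda>i\<in>{..<h}. if i < card ?B then e i else e 0)"
    have "card ?B > 0" using B by (simp add: card_gt_0_iff)
    then have eB: "e i \<in> ?B" if "i < card ?B" for i using bij_betwE[OF e] that by auto
    have gB: "g i \<in> ?B" if "i < h" for i
      using eB \<open>card ?B > 0\<close> that unfolding g_def by auto
    have "?B \<subseteq> f ` V" using t by auto
    then have "g \<in> ?G" using gB by (intro PiE_I) (blast, simp add: g_def)
    moreover have "?B \<subseteq> g ` {..<h}"
    proof
      fix y assume "y \<in> ?B"
      then have "y \<in> e ` {0..<card ?B}" using e by (simp only: bij_betw_def)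
      then obtain i where "i < card ?B" "y = e i" by auto
      then show "y \<in> g ` {..<h}" using t(2) by (intro image_eqI[of _ _ i]) (auto simp: g_def)
    qed
    then have "t \<in> Q \<rightarrow>\<^sub>E ?U g" using t by (auto simp: PiE_iff)
    ultimately show "t \<in> (\<Union>g\<in>?G. Q \<rightarrow>\<^sub>E ?U g)" by blast
  qed
  moreover have finG: "finite ?G" by (intro finite_PiE) (auto simp: finite_V)
  moreover have finU: "finite (Q \<rightarrow>\<^sub>E ?U g)" for g by (intro finite_PiE Q) (auto simp: finite_V)
  ultimately have "card {t \<in> Q \<rightarrow>\<^sub>E V. card (f ` t ` Q) \<le> h} \<le> card (\<Union>g\<in>?G. Q \<rightarrow>\<^sub>E ?U g)"
    by (intro card_mono) auto
  also have "\<dots> \<le> (\<Sum>g\<in>?G. card (Q \<rightarrow>\<^sub>E ?U g))" by (rule card_UN_le[OF finG])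
  also have "\<dots> \<le> (\<Sum>g\<in>?G. (h * c) ^ card Q)"
  proof (rule sum_mono)
    fix g assume "g \<in> ?G"
    have "?U g = (\<Union>i<h. {y \<in> V. f y = g i})" by auto
    then have "card (?U g) \<le> (\<Sum>i<h. card {y \<in> V. f y = g i})" using card_UN_le[of "{..<h}"] by simp
    also have "\<dots> \<le> h * c" using sum_bounded_above[of "{..<h}" _ c] card_block_le by simp
    finally show "card (Q \<rightarrow>\<^sub>E ?U g) \<le> (h * c) ^ card Q" using Q by (simp add: card_PiE power_mono)
  qed
  also have "\<dots> = card (f ` V) ^ h * (h * c) ^ card Q" by (simp add: card_PiE)
  finally show ?thesis .
qed

end

section \<open>Invariance under permutations that preserve marks\<close>

lemma permutation_extending:
  assumes V: "finite V" and t: "inj_on t Q" "t ` Q \<subseteq> V" and t': "inj_on t' Q" "t' ` Q \<subseteq> V"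
  shows "\<exists>\<pi>. bij_betw \<pi> V V \<and> (\<forall>q\<in>Q. \<pi> (t q) = t' q)"
proof -
  have fin: "finite (t ` Q)" "finite (t' ` Q)" using V t t' by (auto intro: finite_subset)
  have "card (t ` Q) = card (t' ` Q)" using t t' by (simp add: card_image)
  then have "card (V - t ` Q) = card (V - t' ` Q)"
    using t t' fin by (simp add: card_Diff_subset)
  then obtain h where h: "bij_betw h (V - t ` Q) (V - t' ` Q)"
    using V finite_same_card_bij[of "V - t ` Q" "V - t' ` Q"] by auto
  define \<pi> where "\<pi> x = (if x \<in> t ` Q then t' (inv_into Q t x) else h x)" for x
  have "bij_betw (\<lambda>x. t' (inv_into Q t x)) (t ` Q) (t' ` Q)"
    using bij_betw_trans[OF bij_betw_inv_into[OF inj_on_imp_bij_betw[OF t(1)]] inj_on_imp_bij_betw[OF t'(1)]]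
    by (simp add: o_def)
  then have "bij_betw \<pi> (t ` Q) (t' ` Q)" by (rule iffD1[OF bij_betw_cong, rotated]) (simp add: \<pi>_def)
  moreover have "bij_betw \<pi> (V - t ` Q) (V - t' ` Q)"
    using h by (rule iffD1[OF bij_betw_cong, rotated]) (simp add: \<pi>_def)
  ultimately have "bij_betw \<pi> (t ` Q \<union> (V - t ` Q)) (t' ` Q \<union> (V - t' ` Q))"
    by (rule bij_betw_combine) auto
  then have "bij_betw \<pi> V V" using t t' by (simp add: Un_absorb1)
  moreover have "\<pi> (t q) = t' q" if "q \<in> Q" for q using that t by (simp add: \<pi>_def)
  ultimately show ?thesis by blast
qed

definition marked_tuples :: "'a set \<Rightarrow> 'a set \<Rightarrow> ('q \<Rightarrow> bool) \<Rightarrow> 'q set \<Rightarrow> ('q \<Rightarrow> 'a) set" where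
  "marked_tuples V L \<tau> Q = {t \<in> Q \<rightarrow>\<^sub>E V. inj_on t Q \<and> (\<forall>q\<in>Q. t q \<in> L \<longleftrightarrow> \<tau> q)}"

lemma marked_tuples_injfam:
  "L \<subseteq> V \<Longrightarrow> marked_tuples V L \<tau> Q = injfam (\<lambda>q. if \<tau> q then L else V - L) id Q"
proof -
  assume L: "L \<subseteq> V"
  have "(\<forall>q\<in>Q. t q \<in> V) \<and> (\<forall>q\<in>Q. t q \<in> L \<longleftrightarrow> \<tau> q) \<longleftrightarrow> (\<forall>q\<in>Q. t q \<in> (if \<tau> q then L else V - L))" for t
    using L by (metis Diff_iff subsetD)
  then show ?thesis
    unfolding marked_tuples_def injfam_def PiE_iff id_apply by blast
qed

text \<open>The mark-preserving permutations act transitively on the injective tuples of a given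
  pattern: the extension is built separately on \<open>L\<close> and on its complement.\<close>

lemma marked_permutation_extending:
  assumes V: "finite V" and L: "L \<subseteq> V"
    and t: "t \<in> marked_tuples V L \<tau> Q" and t': "t' \<in> marked_tuples V L \<tau> Q"
  shows "\<exists>\<pi>. bij_betw \<pi> V V \<and> (\<forall>x\<in>V. \<pi> x \<in> L \<longleftrightarrow> x \<in> L) \<and> (\<forall>q\<in>Q. \<pi> (t q) = t' q)"
proof -
  let ?T = "{q \<in> Q. \<tau> q}" and ?F = "{q \<in> Q. \<not> \<tau> q}"
  have "inj_on t Q" "inj_on t' Q" using t t' by (auto simp: marked_tuples_def)
  then have inj: "inj_on t ?T" "inj_on t ?F" "inj_on t' ?T" "inj_on t' ?F"
    by (auto intro: inj_on_subset)
  have "\<exists>\<pi>. bij_betw \<pi> L L \<and> (\<forall>q\<in>?T. \<pi> (t q) = t' q)"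
    using t t' L V by (intro permutation_extending inj) (auto simp: marked_tuples_def finite_subset)
  then obtain \<pi>1 where 1: "bij_betw \<pi>1 L L" "\<And>q. q \<in> ?T \<Longrightarrow> \<pi>1 (t q) = t' q" by blast
  have "\<exists>\<pi>. bij_betw \<pi> (V - L) (V - L) \<and> (\<forall>q\<in>?F. \<pi> (t q) = t' q)"
    using t t' L V by (intro permutation_extending inj) (auto simp: marked_tuples_def finite_subset)
  then obtain \<pi>2 where 2: "bij_betw \<pi>2 (V - L) (V - L)" "\<And>q. q \<in> ?F \<Longrightarrow> \<pi>2 (t q) = t' q" by blast
  define \<pi> where "\<pi> x = (if x \<in> L then \<pi>1 x else \<pi>2 x)" for x
  have "bij_betw \<pi> L L" using 1(1) by (rule iffD1[OF bij_betw_cong, rotated]) (simp add: \<pi>_def)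
  moreover have "bij_betw \<pi> (V - L) (V - L)" using 2(1) by (rule iffD1[OF bij_betw_cong, rotated]) (simp add: \<pi>_def)
  ultimately have "bij_betw \<pi> (L \<union> (V - L)) (L \<union> (V - L))"
    by (rule bij_betw_combine) auto
  then have "bij_betw \<pi> V V" using L by (simp add: Un_absorb1)
  moreover have "\<pi> x \<in> L \<longleftrightarrow> x \<in> L" if "x \<in> V" for x
    using bij_betwE[OF 1(1)] bij_betwE[OF 2(1)] that by (auto simp: \<pi>_def)
  moreover have "\<pi> (t q) = t' q" if "q \<in> Q" for q
    using that 1(2)[of q] 2(2)[of q] t by (auto simp: \<pi>_def marked_tuples_def)
  ultimately show ?thesis by blast
qed

text \<open>Double counting: by invariance, the number of \<open>G\<close> with \<open>t \<in> B G\<close> depends only on the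
  marks of \<open>t\<close>, so it is the total number of pairs \<open>(G, t)\<close> divided by the number of tuples
  with these marks.\<close>

lemma avg_card_invariant:
  fixes \<Omega> :: "'a set set set" and B :: "'a set set \<Rightarrow> ('q \<Rightarrow> 'a) set"
  assumes V: "finite V" and L: "L \<subseteq> V" and Q: "finite Q" and \<Omega>: "finite \<Omega>" "\<And>G. G \<in> \<Omega> \<Longrightarrow> \<Union>G = V"
    and inv: "\<And>\<pi> G. bij_betw \<pi> V V \<Longrightarrow> (\<And>x. x \<in> V \<Longrightarrow> \<pi> x \<in> L \<longleftrightarrow> x \<in> L) \<Longrightarrow> G \<in> \<Omega> \<Longrightarrow> image \<pi> ` G \<in> \<Omega>"
    and B: "\<And>\<pi> G t. bij_betw \<pi> V V \<Longrightarrow> (\<And>x. x \<in> V \<Longrightarrow> \<pi> x \<in> L \<longleftrightarrow> x \<in> L) \<Longrightarrow> G \<in> \<Omega> \<Longrightarrow> t \<in> B G \<Longrightarrow> t \<in> Q \<rightarrow>\<^sub>E V \<Longrightarrow> (\<lambda>q\<in>Q. \<pi> (t q)) \<in> B (image \<pi> ` G)"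
  shows "avg \<Omega> (\<lambda>G. real (card (A \<inter> B G \<inter> marked_tuples V L \<tau> Q))) =
    real (card (A \<inter> marked_tuples V L \<tau> Q)) / real (card (marked_tuples V L \<tau> Q))
     * avg \<Omega> (\<lambda>G. real (card (B G \<inter> marked_tuples V L \<tau> Q)))"
proof -
  let ?I = "marked_tuples V L \<tau> Q"
  let ?N = "\<lambda>t. card {G \<in> \<Omega>. t \<in> B G}"
  have finI: "finite ?I"
    by (rule finite_subset[of _ "Q \<rightarrow>\<^sub>E V"]) (auto simp: marked_tuples_def V Q intro: finite_PiE)
  \<comment> \<open>A permutation taking t to t' maps the configurations counted for t injectively
    to those counted for t'. Exchanging the two tuples gives equality.\<close>
  have le: "?N t \<le> ?N t'" if t: "t \<in> ?I" and t': "t' \<in> ?I" for t t'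
  proof -
    obtain \<pi> where \<pi>: "bij_betw \<pi> V V" "\<forall>x\<in>V. \<pi> x \<in> L \<longleftrightarrow> x \<in> L" "\<forall>q\<in>Q. \<pi> (t q) = t' q"
      using marked_permutation_extending[OF V L t t'] by blast
    have eq: "(\<lambda>q\<in>Q. \<pi> (t q)) = t'"
      using \<pi>(3) t' by (auto simp: marked_tuples_def PiE_def extensional_def fun_eq_iff)
    show ?thesis
    proof (rule card_inj_on_le)
      show "(\<lambda>G. image \<pi> ` G) ` {G \<in> \<Omega>. t \<in> B G} \<subseteq> {G \<in> \<Omega>. t' \<in> B G}"
      proof (intro subsetI, elim imageE CollectE conjE)
        fix G G' assume G: "G' = image \<pi> ` G" "G \<in> \<Omega>" "t \<in> B G"
        have "t \<in> Q \<rightarrow>\<^sub>E V" using t by (simp add: marked_tuples_def)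
        with B[OF \<pi>(1) _ G(2,3)] inv[OF \<pi>(1) _ G(2)] \<pi>(2) show "G' \<in> {G \<in> \<Omega>. t' \<in> B G}"
          unfolding eq G(1) by auto
      qed
      have "inj_on \<pi> V" using \<pi>(1) by (simp add: bij_betw_def)
      then have "inj_on (image \<pi>) (Pow V)" by (rule inj_on_image_Pow)
      then have "inj_on (image (image \<pi>)) (Pow (Pow V))" by (rule inj_on_image_Pow)
      then show "inj_on (\<lambda>G. image \<pi> ` G) {G \<in> \<Omega>. t \<in> B G}"
        by (rule inj_on_subset) (use \<Omega>(2) in auto)
    qed (use \<Omega> in auto)
  qed
  have dc: "(\<Sum>G\<in>\<Omega>. card (C \<inter> B G)) = (\<Sum>t\<in>C. ?N t)" if "C \<subseteq> ?I" for C
  proof -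
    have fC: "finite C" using that finI by (rule finite_subset)
    have "(\<Sum>G\<in>\<Omega>. card (C \<inter> B G)) = (\<Sum>G\<in>\<Omega>. \<Sum>t\<in>C. of_bool (t \<in> B G))"
      using fC by (simp add: sum.If_cases of_bool_def Int_def)
    also have "\<dots> = (\<Sum>t\<in>C. \<Sum>G\<in>\<Omega>. of_bool (t \<in> B G))" by (rule sum.swap)
    also have "\<dots> = (\<Sum>t\<in>C. ?N t)" using \<Omega>(1) by (simp add: sum.If_cases of_bool_def Int_def)
    finally show ?thesis .
  qed
  have "real (card ?I) * real (\<Sum>G\<in>\<Omega>. card (A \<inter> ?I \<inter> B G)) = real (card (A \<inter> ?I)) * real (\<Sum>G\<in>\<Omega>. card (?I \<inter> B G))"
  proof (cases "?I = {}")
    case False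
    then obtain t0 where "t0 \<in> ?I" by blast
    then have "?N t = ?N t0" if "t \<in> ?I" for t using le that by (meson order_antisym)
    then have "(\<Sum>t\<in>?I. ?N t) = card ?I * ?N t0" "(\<Sum>t\<in>A \<inter> ?I. ?N t) = card (A \<inter> ?I) * ?N t0" by auto
    then have "(\<Sum>G\<in>\<Omega>. card (?I \<inter> B G)) = card ?I * ?N t0" "(\<Sum>G\<in>\<Omega>. card (A \<inter> ?I \<inter> B G)) = card (A \<inter> ?I) * ?N t0"
      using dc[of ?I] dc[of "A \<inter> ?I"] by auto
    then show ?thesis by (simp only: of_nat_mult mult_ac)
  qed simp
  \<comment> \<open>If no tuple has this pattern, both sides are 0, because x / 0 = 0.\<close>
  moreover have "card ?I = 0 \<Longrightarrow> card (A \<inter> ?I) = 0 \<and> (\<forall>G. A \<inter> ?I \<inter> B G = {})" using finI by auto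
  ultimately have "real (\<Sum>G\<in>\<Omega>. card (A \<inter> ?I \<inter> B G)) = real (card (A \<inter> ?I)) / real (card ?I) * real (\<Sum>G\<in>\<Omega>. card (?I \<inter> B G))"
    by (cases "card ?I = 0") (auto simp: field_simps)
  moreover have "A \<inter> B G \<inter> ?I = A \<inter> ?I \<inter> B G" "B G \<inter> ?I = ?I \<inter> B G" for G by auto
  ultimately show ?thesis unfolding avg_def by (simp only: of_nat_sum times_divide_eq_right)
qed

text \<open>The average lies between the values at a minimiser and at a maximiser, and both are
  selections. This replaces error bounds that are uniform over all configurations.\<close>

lemma avg_tendsto_of_selections:
  fixes \<phi> :: "'i \<Rightarrow> 'g \<Rightarrow> real"
  assumes \<Omega>: "eventually (\<lambda>i. finite (\<Omega> i) \<and> \<Omega> i \<noteq> {}) F"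
    and sel: "\<And>s. eventually (\<lambda>i. s i \<in> \<Omega> i) F \<Longrightarrow> ((\<lambda>i. \<phi> i (s i)) \<longlongrightarrow> x) F"
  shows "((\<lambda>i. avg (\<Omega> i) (\<phi> i)) \<longlongrightarrow> x) F"
proof -
  define a where "a i = (SOME G. G \<in> \<Omega> i \<and> (\<forall>G'\<in>\<Omega> i. \<phi> i G \<le> \<phi> i G'))" for i
  define z where "z i = (SOME G. G \<in> \<Omega> i \<and> (\<forall>G'\<in>\<Omega> i. \<phi> i G' \<le> \<phi> i G))" for i
  have a: "a i \<in> \<Omega> i \<and> (\<forall>G'\<in>\<Omega> i. \<phi> i (a i) \<le> \<phi> i G')"
    and z: "z i \<in> \<Omega> i \<and> (\<forall>G'\<in>\<Omega> i. \<phi> i G' \<le> \<phi> i (z i))"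
    if fin: "finite (\<Omega> i)" "\<Omega> i \<noteq> {}" for i
  proof -
    have "Min (\<phi> i ` \<Omega> i) \<in> \<phi> i ` \<Omega> i" "Max (\<phi> i ` \<Omega> i) \<in> \<phi> i ` \<Omega> i"
      using fin by (intro Min_in Max_in; simp)+
    then obtain G1 G2 where G: "G1 \<in> \<Omega> i" "\<phi> i G1 = Min (\<phi> i ` \<Omega> i)" "G2 \<in> \<Omega> i" "\<phi> i G2 = Max (\<phi> i ` \<Omega> i)"
      by fastforce
    have "\<exists>G. G \<in> \<Omega> i \<and> (\<forall>G'\<in>\<Omega> i. \<phi> i G \<le> \<phi> i G')" using G fin by (intro exI[of _ G1]) auto
    then show "a i \<in> \<Omega> i \<and> (\<forall>G'\<in>\<Omega> i. \<phi> i (a i) \<le> \<phi> i G')" unfolding a_def by (rule someI_ex)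
    have "\<exists>G. G \<in> \<Omega> i \<and> (\<forall>G'\<in>\<Omega> i. \<phi> i G' \<le> \<phi> i G)" using G fin by (intro exI[of _ G2]) auto
    then show "z i \<in> \<Omega> i \<and> (\<forall>G'\<in>\<Omega> i. \<phi> i G' \<le> \<phi> i (z i))" unfolding z_def by (rule someI_ex)
  qed
  show ?thesis
  proof (rule tendsto_sandwich)
    show "((\<lambda>i. \<phi> i (a i)) \<longlongrightarrow> x) F" "((\<lambda>i. \<phi> i (z i)) \<longlongrightarrow> x) F"
      by (intro sel eventually_mono[OF \<Omega>]; use a z in blast)+
    show "eventually (\<lambda>i. \<phi> i (a i) \<le> avg (\<Omega> i) (\<phi> i)) F"
      using \<Omega>
    proof eventually_elim
      case (elim i)
      then have "real (card (\<Omega> i)) * \<phi> i (a i) \<le> (\<Sum>G\<in>\<Omega> i. \<phi> i G)"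
        using a[of i] by (intro sum_bounded_below) auto
      then show ?case using elim by (simp add: avg_def pos_le_divide_eq card_gt_0_iff mult.commute)
    qed
    show "eventually (\<lambda>i. avg (\<Omega> i) (\<phi> i) \<le> \<phi> i (z i)) F"
      using \<Omega>
    proof eventually_elim
      case (elim i)
      then have "(\<Sum>G\<in>\<Omega> i. \<phi> i G) \<le> real (card (\<Omega> i)) * \<phi> i (z i)"
        using z[of i] by (intro sum_bounded_above) auto
      then show ?case using elim by (simp add: avg_def pos_divide_le_eq card_gt_0_iff mult.commute)
    qed
  qed
qed

context blocks
begin

text \<open>The half-edges \<open>t (q, True)\<close> and \<open>t (\<sigma> q, False)\<close> share the \<open>q\<close>-th block. A labelled
  cycle of a configuration \<open>G\<close> is a tuple that is linked both through the hyperedges, with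
  \<open>\<sigma> = id\<close>, and through the vertices of \<open>G\<close>, with \<open>\<sigma>\<close> the cyclic shift.\<close>

definition links :: "('q \<Rightarrow> 'q) \<Rightarrow> 'q set \<Rightarrow> ('q \<times> bool \<Rightarrow> 'a) set" where
  "links \<sigma> I = {t \<in> I \<times> UNIV \<rightarrow>\<^sub>E V. (\<forall>q\<in>I. f (t (q, True)) = f (t (\<sigma> q, False))) \<and>
     inj_on (\<lambda>q. f (t (q, True))) I}"

lemma mem_pairs: "z \<in> pairs D E \<longleftrightarrow> fst z \<in> D \<and> snd z \<in> E \<and> fst z \<noteq> snd z \<and> f (fst z) = f (snd z)"
  by (cases z) (simp add: pairs_def)

text \<open>Regrouping the tuple by blocks turns it into one ordered pair per index, consisting of
  \<open>t (q, True)\<close> and \<open>t (\<sigma> q, False)\<close>. The links become the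
  condition that each pair lies in one block, and the inverse \<open>\<rho>\<close> of
  \<open>\<sigma>\<close> recovers the tuple.\<close>

lemma card_links_marked:
  assumes \<sigma>: "bij_betw \<sigma> I I" and L: "L \<subseteq> V"
  shows "card (links \<sigma> I \<inter> marked_tuples V L (\<tau> \<circ> fst) (I \<times> UNIV)) =
    card (injfam (\<lambda>q. pairs (if \<tau> q then L else V - L) (if \<tau> (\<sigma> q) then L else V - L)) (\<lambda>p. f (fst p)) I)"
proof -
  let ?D = "\<lambda>s. if s then L else V - L"
  let ?to = "\<lambda>t. \<lambda>q\<in>I. (t (q, True), t (\<sigma> q, False))"
  define \<rho> where "\<rho> = inv_into I \<sigma>"
  have \<rho>: "\<rho> q \<in> I" "\<sigma> (\<rho> q) = q" "\<rho> (\<sigma> q) = q" "\<sigma> q \<in> I" if "q \<in> I" for q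
    using that \<sigma> by (auto simp: \<rho>_def bij_betw_def inv_into_into f_inv_into_f inv_into_f_f)
  let ?from = "\<lambda>p. \<lambda>x\<in>I \<times> UNIV. if snd x then fst (p (fst x)) else snd (p (\<rho> (fst x)))"
  let ?A = "links \<sigma> I \<inter> marked_tuples V L (\<tau> \<circ> fst) (I \<times> UNIV)"
  let ?B = "injfam (\<lambda>q. pairs (?D (\<tau> q)) (?D (\<tau> (\<sigma> q)))) (\<lambda>p. f (fst p)) I"
  have D: "x \<in> ?D s \<longleftrightarrow> x \<in> V \<and> (x \<in> L \<longleftrightarrow> s)" for x s using L by auto
  have "bij_betw ?to ?A ?B"
  proof (rule bij_betw_byWitness[where f' = ?from])
    show "\<forall>t\<in>?A. ?from (?to t) = t"
    proof
      fix t assume "t \<in> ?A"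
      then have t: "t \<in> I \<times> UNIV \<rightarrow>\<^sub>E V" by (simp add: links_def)
      show "?from (?to t) = t"
      proof
        fix x show "?from (?to t) x = t x"
          using \<rho>[of "fst x"] PiE_arb[OF t, of x] by (cases x) auto
      qed
    qed
    show "\<forall>p\<in>?B. ?to (?from p) = p"
    proof
      fix p assume "p \<in> ?B"
      then have p: "p \<in> extensional I" by (auto simp: injfam_def PiE_def)
      show "?to (?from p) = p"
      proof
        fix q show "?to (?from p) q = p q"
          using \<rho>[of q] p by (auto simp: extensional_def)
      qed
    qed
    show "?to ` ?A \<subseteq> ?B"
    proof (intro subsetI, elim imageE)
      fix p t assume p: "p = ?to t" and "t \<in> ?A"
      then have t: "t \<in> I \<times> UNIV \<rightarrow>\<^sub>E V" "\<And>q. q \<in> I \<Longrightarrow> f (t (q, True)) = f (t (\<sigma> q, False))"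
        "inj_on (\<lambda>q. f (t (q, True))) I" "inj_on t (I \<times> UNIV)"
        "\<And>q s. q \<in> I \<Longrightarrow> t (q, s) \<in> L \<longleftrightarrow> \<tau> q"
        by (auto simp: links_def marked_tuples_def)
      have V: "t (q, s) \<in> V" if "q \<in> I" for q s using t(1) that by auto
      have "p \<in> PiE I (\<lambda>q. pairs (?D (\<tau> q)) (?D (\<tau> (\<sigma> q))))"
      proof (rule PiE_I)
        fix q assume q: "q \<in> I"
        \<comment> \<open>The labels True and False differ, so this holds even if
          \<open>\<sigma> q = q\<close>, as happens for a 1-cycle.\<close>
        have "t (q, True) \<noteq> t (\<sigma> q, False)"
          using inj_onD[OF t(4), of "(q, True)" "(\<sigma> q, False)"] q \<rho>[OF q] by auto
        then show "p q \<in> pairs (?D (\<tau> q)) (?D (\<tau> (\<sigma> q)))"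
          using q V \<rho>[OF q] t(2,5) by (simp only: mem_pairs D p restrict_apply' fst_conv snd_conv) simp
      qed (simp add: p)
      moreover have "inj_on (\<lambda>q. f (fst (p q))) I"
        using t(3) by (simp add: p inj_on_def)
      ultimately show "p \<in> ?B" by (simp add: injfam_def)
    qed
    show "?from ` ?B \<subseteq> ?A"
    proof (intro subsetI, elim imageE)
      fix t p assume t: "t = ?from p" and "p \<in> ?B"
      then have pB: "p \<in> PiE I (\<lambda>q. pairs (?D (\<tau> q)) (?D (\<tau> (\<sigma> q))))" and inj: "inj_on (\<lambda>q. f (fst (p q))) I"
        by (simp_all only: injfam_def mem_Collect_eq)
      note p = PiE_mem[OF pB]
      have p': "fst (p q) \<in> V" "snd (p q) \<in> V" "fst (p q) \<in> L \<longleftrightarrow> \<tau> q" "snd (p q) \<in> L \<longleftrightarrow> \<tau> (\<sigma> q)"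
        "fst (p q) \<noteq> snd (p q)" "f (fst (p q)) = f (snd (p q))" if "q \<in> I" for q
        using p[OF that] by (simp_all only: mem_pairs D not_False_eq_True simp_thms)
      have tT: "t (q, True) = fst (p q)" and tF: "t (\<sigma> q, False) = snd (p q)" and tF': "t (q, False) = snd (p (\<rho> q))"
        if "q \<in> I" for q using that \<rho>[OF that] by (auto simp: t)
      have tP: "t \<in> I \<times> UNIV \<rightarrow>\<^sub>E V"
      proof (rule PiE_I)
        fix x :: "_ \<times> bool" assume "x \<in> I \<times> UNIV"
        then show "t x \<in> V" using p'(1,2) \<rho> by (auto simp: t)
      qed (auto simp: t)
      \<comment> \<open>Equal half-edges lie in equal blocks, and different pairs lie in different
        blocks. So a coincidence could only occur inside one pair, whose components differ.\<close>
      have "inj_on t (I \<times> UNIV)"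
      proof (rule inj_onI)
        fix x y assume xy: "x \<in> I \<times> (UNIV :: bool set)" "y \<in> I \<times> (UNIV :: bool set)" "t x = t y"
        obtain q s q' s' where x: "x = (q, s)" "y = (q', s')" by (metis surj_pair)
        have q: "q \<in> I" "q' \<in> I" using xy x by auto
        have f1: "f (t (q, True)) = f (fst (p q))" if "q \<in> I" for q using tT[OF that] by simp
        have f2: "f (t (q, False)) = f (fst (p (\<rho> q)))" if "q \<in> I" for q using tF'[OF that] p'(6)[OF \<rho>(1)[OF that]] by simp
        have feq: "t (q, s) = t (q', s')" using xy x by simp
        have injD: "a = b" if "f (fst (p a)) = f (fst (p b))" "a \<in> I" "b \<in> I" for a b
          using inj_onD[OF inj, of a b] that by simp
        consider "s" "s'" | "\<not> s" "\<not> s'" | "s" "\<not> s'" | "\<not> s" "s'" by blast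
        then show "x = y"
        proof cases
          case 1
          then have "f (fst (p q)) = f (fst (p q'))" using feq f1[OF q(1)] f1[OF q(2)] by metis
          then show ?thesis using injD[OF _ q] 1 x by simp
        next
          case 2
          then have "f (fst (p (\<rho> q))) = f (fst (p (\<rho> q')))" using feq f2[OF q(1)] f2[OF q(2)] by metis
          then have "\<rho> q = \<rho> q'" using q \<rho>(1) by (intro injD)
          then have "q = q'" using \<rho>(2)[OF q(1)] \<rho>(2)[OF q(2)] by metis
          then show ?thesis using 2 x by simp
        next
          case 3
          then have "f (fst (p q)) = f (fst (p (\<rho> q')))" using feq f1[OF q(1)] f2[OF q(2)] by metis
          then have "q = \<rho> q'" using q \<rho>(1) by (intro injD)
          then have "q' = \<sigma> q" using \<rho>(2)[OF q(2)] by metis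
          then show ?thesis using 3 feq tT[OF q(1)] tF[OF q(1)] p'(5)[OF q(1)] by metis
        next
          case 4
          then have "f (fst (p q')) = f (fst (p (\<rho> q)))" using feq f1[OF q(2)] f2[OF q(1)] by metis
          then have "q' = \<rho> q" using q \<rho>(1) by (intro injD)
          then have "q = \<sigma> q'" using \<rho>(2)[OF q(1)] by metis
          then show ?thesis using 4 feq tT[OF q(2)] tF[OF q(2)] p'(5)[OF q(2)] by metis
        qed
      qed
      moreover have "t x \<in> L \<longleftrightarrow> (\<tau> \<circ> fst) x" if "x \<in> I \<times> UNIV" for x
      proof (cases x)
        case (Pair q s)
        then have q: "q \<in> I" using that by auto
        show ?thesis
          using p'(3)[OF q] p'(4)[OF \<rho>(1)[OF q]] \<rho>(2)[OF q] tT[OF q] tF'[OF q] Pair by (cases s) simp_all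
      qed
      moreover have "f (t (q, True)) = f (t (\<sigma> q, False))" if "q \<in> I" for q
        using tT[OF that] tF[OF that] p'(6)[OF that] by simp
      moreover have "inj_on (\<lambda>q. f (t (q, True))) I" using inj tT by (simp add: inj_on_def)
      ultimately show "t \<in> ?A" using tP by (simp add: links_def marked_tuples_def)
    qed
  qed
  then show ?thesis by (rule bij_betw_same_card)
qed

end

section \<open>Configurations with a planted matching\<close>

lemma hyperedge_of_eq_iff:
  assumes "l > 0" "e > 0"
  shows "hyperedge_of l h = e \<longleftrightarrow> l * (e - 1) < h \<and> h \<le> l * e"
proof -
  have "hyperedge_of l h = e \<longleftrightarrow> \<lceil>real h / real l\<rceil> = int e"
    using assms by (auto simp: hyperedge_of_def)
  also have "\<dots> \<longleftrightarrow> real e - 1 < real h / real l \<and> real h / real l \<le> real e"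
    by (simp add: ceiling_eq_iff)
  also have "\<dots> \<longleftrightarrow> real (l * (e - 1)) < real h \<and> real h \<le> real (l * e)"
    using assms by (simp add: field_simps of_nat_diff)
  finally show ?thesis by (simp only: of_nat_less_iff of_nat_le_iff)
qed

lemma hyperedge_of_in:
  assumes "h \<in> {1..l * m}"
  shows "hyperedge_of l h \<in> {1..m}"
proof -
  have l: "l > 0" using assms by (cases l) auto
  define e where "e = Suc ((h - 1) div l)"
  have "l * (e - 1) \<le> h - 1" by (simp add: e_def)
  moreover have "h - 1 < l * e" using l by (simp add: e_def dividend_less_times_div)
  ultimately have "l * (e - 1) < h" "h \<le> l * e" using assms by auto
  then have "hyperedge_of l h = e"
    using hyperedge_of_eq_iff[OF l, of e h] by (simp add: e_def)
  moreover have "(h - 1) div l < m"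
    using assms l by (intro less_mult_imp_div_less) (auto simp: mult.commute)
  ultimately show ?thesis by (simp add: e_def)
qed

lemma blocks_hyperedges:
  assumes "l > 0"
  shows "blocks {1..l * m} (hyperedge_of l) l"
proof
  fix x assume x: "x \<in> {1..l * m}"
  define e where "e = hyperedge_of l x"
  have e: "e \<in> {1..m}" unfolding e_def by (rule hyperedge_of_in[OF x])
  have "{y \<in> {1..l * m}. hyperedge_of l y = e} = {l * (e - 1)<..l * e}"
    using e assms by (auto simp: hyperedge_of_eq_iff intro: order.trans)
  then show "card {y \<in> {1..l * m}. hyperedge_of l y = hyperedge_of l x} = l"
    using e by (simp add: e_def[symmetric] diff_mult_distrib2)
qed auto

text \<open>The vertex of a half-edge, as a total function: in a partition exactly one class
  contributes to the union.\<close>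

definition cls :: "nat set set \<Rightarrow> nat \<Rightarrow> nat set" where
  "cls G h = \<Union>{v \<in> G. h \<in> v}"

lemma cls_eq: "partition_on V G \<Longrightarrow> v \<in> G \<Longrightarrow> h \<in> v \<Longrightarrow> cls G h = v"
  unfolding cls_def partition_on_def disjoint_def by blast

lemma cls_in:
  assumes "partition_on V G" "h \<in> V"
  shows "cls G h \<in> G" "h \<in> cls G h"
proof -
  obtain v where "v \<in> G" "h \<in> v" using assms by (auto simp: partition_on_def)
  then show "cls G h \<in> G" "h \<in> cls G h" using cls_eq[OF assms(1)] by auto
qed

lemma cls_image:
  assumes G: "partition_on V G" and \<pi>: "inj_on \<pi> V" and h: "h \<in> V"
  shows "cls (image \<pi> ` G) (\<pi> h) = \<pi> ` cls G h"
proof -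
  have "{v \<in> image \<pi> ` G. \<pi> h \<in> v} = {\<pi> ` cls G h}"
  proof -
    have "w = cls G h" if "w \<in> G" "\<pi> h \<in> \<pi> ` w" for w
    proof -
      have "w \<subseteq> V" using that G by (auto simp: partition_on_def)
      then have "h \<in> w" using that(2) \<pi> h by (auto dest: inj_onD)
      then show ?thesis using cls_eq[OF G that(1)] by simp
    qed
    moreover have "cls G h \<in> G" "\<pi> h \<in> \<pi> ` cls G h" using cls_in[OF G h] by auto
    ultimately show ?thesis by blast
  qed
  then show ?thesis by (simp add: cls_def[of "image \<pi> ` G"])
qed

lemma partition_on_map:
  assumes G: "partition_on V G" and \<pi>: "inj_on \<pi> V"
  shows "partition_on (\<pi> ` V) (image \<pi> ` G)"
proof -
  have "{} \<notin> image \<pi> ` G" using G by (auto simp: partition_on_def)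
  then show ?thesis using partition_on_inj_image[OF G \<pi>] by simp
qed

text \<open>\<open>d * card M \<le> m\<close> guarantees that the l |M| marked half-edges do not
  outnumber the l m / d vertices, so that a configuration in which \<open>M\<close> is a matching
  exists.\<close>

locale planted =
  fixes d l m :: nat and M :: "nat set"
  assumes d: "d \<ge> 2" and l: "l \<ge> 2" and dvd: "d dvd l * m" and M: "M \<subseteq> {1..m}" and card_M: "d * card M \<le> m"
begin

abbreviation "V \<equiv> {1..l * m}"
abbreviation "L \<equiv> half_edges_of l m M"

definition configs :: "nat set set set" where
  "configs = {G \<in> configurations d l m. is_matching l m G M}"

sublocale H: blocks V "hyperedge_of l" l
  using blocks_hyperedges[of l m] l by simp

lemma L_subset: "L \<subseteq> V" by (auto simp: half_edges_of_def)

lemma card_L: "card L = l * card M"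
proof -
  have eq: "L = (\<Union>e\<in>M. {h \<in> V. hyperedge_of l h = e})"
    by (auto simp: half_edges_of_def)
  have c: "card {h \<in> V. hyperedge_of l h = e} = l" if "e \<in> M" for e
  proof -
    have e: "e \<in> {1..m}" using that M by auto
    then have "hyperedge_of l (l * e) = e" "l * e \<in> V" using l by (auto simp: hyperedge_of_eq_iff)
    then show ?thesis using H.card_block[of "l * e"] by simp
  qed
  have "finite M" using M finite_subset by blast
  then show ?thesis unfolding eq using c by (subst card_UN_disjoint) auto
qed

lemma partition: "G \<in> configs \<Longrightarrow> partition_on V G"
  by (simp add: configs_def configurations_def)

lemma blocks_config:
  assumes "G \<in> configs"
  shows "blocks V (cls G) d"
proof
  fix x assume x: "x \<in> V"
  note P = partition[OF assms]
  have "cls G x \<subseteq> V" using cls_in[OF P x] P by (auto simp: partition_on_def)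
  then have "{y \<in> V. cls G y = cls G x} = cls G x"
    using cls_eq[OF P cls_in(1)[OF P x]] cls_in(2)[OF P] by auto
  then show "card {y \<in> V. cls G y = cls G x} = d"
    using cls_in(1)[OF P x] assms by (auto simp: configs_def configurations_def)
qed auto

lemma cls_inj_on_L:
  assumes "G \<in> configs"
  shows "inj_on (cls G) L"
proof (rule inj_onI)
  fix x y assume xy: "x \<in> L" "y \<in> L" "cls G x = cls G y"
  note P = partition[OF assms]
  have "x \<in> cls G x" "y \<in> cls G x" "cls G x \<in> G"
    using cls_in[OF P, of x] cls_in[OF P, of y] xy L_subset by auto
  moreover have "\<forall>h\<in>L. \<forall>h'\<in>L. \<forall>v\<in>G. h \<in> v \<and> h' \<in> v \<longrightarrow> h = h'"
    using assms by (simp add: configs_def is_matching_def)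
  ultimately show "x = y" using xy by metis
qed

lemma card_cls_image_le:
  assumes "G \<in> configs"
  shows "card (cls G ` V) \<le> l * m"
  using card_image_le[of V "cls G"] by simp

lemma configs_invariant:
  assumes \<pi>: "bij_betw \<pi> V V" "\<And>x. x \<in> V \<Longrightarrow> \<pi> x \<in> L \<longleftrightarrow> x \<in> L" and G: "G \<in> configs"
  shows "image \<pi> ` G \<in> configs"
proof -
  note P = partition[OF G]
  have inj: "inj_on \<pi> V" using \<pi>(1) by (simp add: bij_betw_def)
  have "partition_on (\<pi> ` V) (image \<pi> ` G)"
    by (rule partition_on_map[OF P inj])
  then have "partition_on V (image \<pi> ` G)" using \<pi>(1) by (simp add: bij_betw_def)
  moreover have "card v = d" if v: "v \<in> image \<pi> ` G" for v
  proof -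
    obtain w where w: "w \<in> G" "v = \<pi> ` w" using v by auto
    have "w \<subseteq> V" using w P by (auto simp: partition_on_def)
    then have "card v = card w" using inj w by (simp add: card_image inj_on_subset)
    then show ?thesis using w G by (simp add: configs_def configurations_def)
  qed
  moreover have "is_matching l m (image \<pi> ` G) M"
    unfolding is_matching_def
  proof (intro conjI M ballI impI, elim conjE imageE)
    fix h h' v w assume h: "h \<in> L" "h' \<in> L" "h \<in> v" "h' \<in> v" and w: "v = \<pi> ` w" "w \<in> G"
    obtain x x' where x: "h = \<pi> x" "h' = \<pi> x'" "x \<in> w" "x' \<in> w" using h w by blast
    have "w \<subseteq> V" using w P by (auto simp: partition_on_def)
    then have "x \<in> L" "x' \<in> L" using x h \<pi>(2) by auto
    then have "x = x'" using G x w by (auto simp: configs_def is_matching_def)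
    then show "h = h'" using x by simp
  qed
  ultimately show ?thesis by (simp add: configs_def configurations_def)
qed

lemma finite_configs: "finite configs"
proof (rule finite_subset)
  show "configs \<subseteq> Pow (Pow V)" using partition by (auto simp: partition_on_def)
qed auto

text \<open>Cut the half-edges into consecutive intervals of length d, reserve a different interval
  for each marked half-edge, and permute the half-edges so that each marked one lands in its own
  interval.\<close>

lemma configs_nonempty: "configs \<noteq> {}"
proof -
  obtain n where n: "l * m = d * n" using dvd by blast
  define f where "f h = (h - 1) div d" for h :: nat
  define G0 where "G0 = (\<lambda>i. {d * i<..d * i + d}) ` {..<n}"
  have f: "h \<in> {d * i<..d * i + d} \<longleftrightarrow> h > 0 \<and> f h = i" for h i
  proof -
    have "f h = i" if "d * i \<le> h - 1" "h - 1 < d * i + d"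
      unfolding f_def by (rule div_nat_eqI) (use that in \<open>simp_all add: mult.commute\<close>)
    moreover have "d * f h \<le> h - 1" "h - 1 < d * f h + d"
      using d dividend_less_times_div[of d "h - 1"] by (simp_all add: f_def)
    ultimately have "d * i \<le> h - 1 \<and> h - 1 < d * i + d \<longleftrightarrow> f h = i" by blast
    then show ?thesis by auto
  qed
  have block_le: "d * i + d \<le> d * n" if "i < n" for i
    using mult_le_mono2[of "Suc i" n d] that by simp
  have P: "partition_on V G0"
  proof (rule partition_onI)
    show "\<Union>G0 = V"
    proof (intro equalityI subsetI)
      fix h assume "h \<in> \<Union>G0"
      then obtain i where i: "i < n" "d * i < h" "h \<le> d * i + d" by (auto simp: G0_def)
      have "d * i + d \<le> d * n" using i(1) by (rule block_le)
      then show "h \<in> V" using i n by auto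
    next
      fix h assume h: "h \<in> V"
      then have "f h < n" unfolding f_def n using d by (intro less_mult_imp_div_less) (auto simp: mult.commute)
      moreover have "h \<in> {d * f h<..d * f h + d}" using f h by auto
      ultimately show "h \<in> \<Union>G0" unfolding G0_def by blast
    qed
    show "disjnt p q" if pq: "p \<in> G0" "q \<in> G0" "p \<noteq> q" for p q
    proof -
      obtain i j where ij: "p = {d * i<..d * i + d}" "q = {d * j<..d * j + d}" using pq by (auto simp: G0_def)
      have "False" if "h \<in> p" "h \<in> q" for h
        using f[of h i] f[of h j] that ij pq(3) by metis
      then show ?thesis by (auto simp: disjnt_def)
    qed
    show "{} \<notin> G0" using d by (auto simp: G0_def)
  qed
  have "card L \<le> n"
  proof -
    have "d * card L \<le> l * m" unfolding card_L using mult_le_mono2[OF card_M, of l] by (simp add: mult_ac)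
    then show ?thesis using n d by simp
  qed
  moreover have "finite L" using L_subset finite_subset by blast
  ultimately obtain e where e: "inj_on e L" "e ` L \<subseteq> {..<n}"
    using card_le_inj[of L "{..<n}"] by auto
  \<comment> \<open>\<open>d * e q + 1\<close> is the first element of the interval reserved for
    \<open>q\<close>; it is moved to \<open>q\<close>.\<close>
  have "\<exists>\<pi>. bij_betw \<pi> V V \<and> (\<forall>q\<in>L. \<pi> (d * e q + 1) = id q)"
  proof (rule permutation_extending)
    show "inj_on (\<lambda>q. d * e q + 1) L" using e(1) d by (auto simp: inj_on_def)
    show "(\<lambda>q. d * e q + 1) ` L \<subseteq> V"
    proof clarify
      fix q assume "q \<in> L"
      then have "e q < n" using e by auto
      then have "d * e q + d \<le> d * n" by (rule block_le)
      then show "d * e q + 1 \<in> V" using n d by auto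
    qed
  qed (use L_subset in auto)
  then obtain \<pi> where \<pi>: "bij_betw \<pi> V V" "\<And>q. q \<in> L \<Longrightarrow> \<pi> (d * e q + 1) = q" by auto
  have inj: "inj_on \<pi> V" using \<pi>(1) by (simp add: bij_betw_def)
  have "partition_on V (image \<pi> ` G0)"
    using partition_on_map[OF P inj] \<pi>(1) by (simp add: bij_betw_def)
  moreover have "card v = d" if v: "v \<in> image \<pi> ` G0" for v
  proof -
    obtain w where w: "w \<in> G0" "v = \<pi> ` w" using v by auto
    have "w \<subseteq> V" using w P by (auto simp: partition_on_def)
    then have "card v = card w" using inj w by (simp add: card_image inj_on_subset)
    then show ?thesis using w by (auto simp: G0_def)
  qed
  moreover have "is_matching l m (image \<pi> ` G0) M"
    unfolding is_matching_def
  proof (intro conjI M ballI impI, elim conjE imageE)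
    fix h h' v w assume h: "h \<in> L" "h' \<in> L" "h \<in> v" "h' \<in> v" and w: "v = \<pi> ` w" "w \<in> G0"
    have wV: "w \<subseteq> V" using w P by (auto simp: partition_on_def)
    have key: "d * e q + 1 \<in> w" if q: "q \<in> L" "q \<in> v" for q
    proof -
      obtain x where x: "q = \<pi> x" "x \<in> w" using q w by blast
      have "e q < n" using e q by auto
      then have "d * e q + d \<le> d * n" by (rule block_le)
      then have "d * e q + 1 \<in> V" using n d by auto
      then have "x = d * e q + 1" using inj_onD[OF inj, of x "d * e q + 1"] x wV \<pi>(2)[OF q(1)] by auto
      then show ?thesis using x by simp
    qed
    obtain i where i: "w = {d * i<..d * i + d}" using w by (auto simp: G0_def)
    have "f (d * e h + 1) = f (d * e h' + 1)" using key[of h] key[of h'] h f unfolding i by metis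
    then have "e h = e h'" using d by (simp add: f_def)
    then show "h = h'" using e(1) h by (auto dest: inj_onD)
  qed
  ultimately have "image \<pi> ` G0 \<in> configs" by (simp add: configs_def configurations_def)
  then show ?thesis by blast
qed

end

text \<open>Otherwise \<open>{1..n}\<close> becomes \<open>{Suc 0..n}\<close> and facts stated for \<open>V\<close> no longer match.\<close>

declare One_nat_def [simp del]

context planted
begin

text \<open>\<open>links\<close> compares only blocks, so by itself it would admit a degenerate
  cycle whose two half-edges at one hyperedge coincide. Injectivity excludes this.\<close>

definition labelled :: "nat set set \<Rightarrow> ('q \<Rightarrow> 'q) \<Rightarrow> 'q set \<Rightarrow> ('q \<times> bool \<Rightarrow> nat) set" where
  "labelled G \<sigma> I = {t \<in> H.links id I \<inter> blocks.links V (cls G) \<sigma> I. inj_on t (I \<times> UNIV)}"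

lemma links_config: "G \<in> configs \<Longrightarrow> blocks.links V (cls G) \<sigma> I = {t \<in> I \<times> UNIV \<rightarrow>\<^sub>E V.
    (\<forall>q\<in>I. cls G (t (q, True)) = cls G (t (\<sigma> q, False))) \<and> inj_on (\<lambda>q. cls G (t (q, True))) I}"
  by (rule blocks.links_def[OF blocks_config])

lemma L_iff: "x \<in> V \<Longrightarrow> x \<in> L \<longleftrightarrow> hyperedge_of l x \<in> M"
  by (simp add: half_edges_of_def)

lemma finite_tuples: "finite Q \<Longrightarrow> finite (Q \<rightarrow>\<^sub>E V)"
  by (intro finite_PiE) auto

text \<open>The two half-edges with index q belong to the same hyperedge and so have the same mark.
  Hence the patterns \<open>\<tau> \<circ> fst\<close>, one bit per hyperedge, account for every
  tuple.\<close>

lemma card_labelled: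
  assumes I: "finite I"
  shows "card (labelled G \<sigma> I) = (\<Sum>\<tau>\<in>I \<rightarrow>\<^sub>E UNIV.
    card (H.links id I \<inter> blocks.links V (cls G) \<sigma> I \<inter> marked_tuples V L (\<tau> \<circ> fst) (I \<times> UNIV)))"
proof -
  let ?X = "\<lambda>\<tau>. H.links id I \<inter> blocks.links V (cls G) \<sigma> I \<inter> marked_tuples V L (\<tau> \<circ> fst) (I \<times> UNIV)"
  have eq: "labelled G \<sigma> I = (\<Union>\<tau>\<in>I \<rightarrow>\<^sub>E UNIV. ?X \<tau>)"
  proof (intro equalityI subsetI)
    fix t assume t: "t \<in> labelled G \<sigma> I"
    then have tV: "t \<in> I \<times> UNIV \<rightarrow>\<^sub>E V" and hyp: "\<And>q. q \<in> I \<Longrightarrow> hyperedge_of l (t (q, True)) = hyperedge_of l (t (q, False))"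
      by (auto simp: labelled_def H.links_def)
    have mark: "t (q, s) \<in> L \<longleftrightarrow> t (q, True) \<in> L" if "q \<in> I" for q s
    proof -
      have "t (q, True) \<in> V" "t (q, False) \<in> V" using tV that by auto
      then have "t (q, False) \<in> L \<longleftrightarrow> t (q, True) \<in> L" using hyp[OF that] by (simp only: L_iff)
      then show ?thesis by (cases s) simp_all
    qed
    have X: "t \<in> ?X (\<lambda>q\<in>I. t (q, True) \<in> L)"
    proof -
      have "t \<in> marked_tuples V L ((\<lambda>q\<in>I. t (q, True) \<in> L) \<circ> fst) (I \<times> UNIV)"
        unfolding marked_tuples_def
      proof (intro CollectI conjI ballI tV)
        show "inj_on t (I \<times> UNIV)" using t by (simp add: labelled_def)
        fix x :: "_ \<times> bool" assume "x \<in> I \<times> UNIV"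
        then show "t x \<in> L \<longleftrightarrow> ((\<lambda>q\<in>I. t (q, True) \<in> L) \<circ> fst) x"
          using mark[of "fst x" "snd x"] by (cases x) simp
      qed
      then show ?thesis using t by (simp add: labelled_def)
    qed
    show "t \<in> (\<Union>\<tau>\<in>I \<rightarrow>\<^sub>E UNIV. ?X \<tau>)"
      by (rule UN_I[of "\<lambda>q\<in>I. t (q, True) \<in> L"]) (simp, rule X)
  qed (auto simp: labelled_def marked_tuples_def)
  show ?thesis unfolding eq
  proof (rule card_UN_disjoint)
    show "finite (I \<rightarrow>\<^sub>E (UNIV :: bool set))" using I by (intro finite_PiE) auto
    show "\<forall>\<tau>\<in>I \<rightarrow>\<^sub>E UNIV. finite (?X \<tau>)"
      using I finite_tuples[of "I \<times> (UNIV :: bool set)"]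
      by (intro ballI finite_subset[of "?X _" "I \<times> UNIV \<rightarrow>\<^sub>E V"]) (auto simp: marked_tuples_def)
    show "\<forall>\<tau>\<in>I \<rightarrow>\<^sub>E UNIV. \<forall>\<tau>'\<in>I \<rightarrow>\<^sub>E UNIV. \<tau> \<noteq> \<tau>' \<longrightarrow> ?X \<tau> \<inter> ?X \<tau>' = {}"
    proof (intro ballI impI)
      fix \<tau> \<tau>' :: "_ \<Rightarrow> bool" assume \<tau>: "\<tau> \<in> I \<rightarrow>\<^sub>E UNIV" "\<tau>' \<in> I \<rightarrow>\<^sub>E UNIV" "\<tau> \<noteq> \<tau>'"
      then obtain q where "q \<in> I" "\<tau> q \<noteq> \<tau>' q" using PiE_ext[OF \<tau>(1,2)] by blast
      show "?X \<tau> \<inter> ?X \<tau>' = {}"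
      proof (rule equals0I)
        fix t assume "t \<in> ?X \<tau> \<inter> ?X \<tau>'"
        then have "t (q, True) \<in> L \<longleftrightarrow> \<tau> q" "t (q, True) \<in> L \<longleftrightarrow> \<tau>' q"
          using \<open>q \<in> I\<close> by (auto simp: marked_tuples_def)
        then show False using \<open>\<tau> q \<noteq> \<tau>' q\<close> by blast
      qed
    qed
  qed
qed

lemma links_invariant:
  assumes \<sigma>: "bij_betw \<sigma> I I" and \<pi>: "bij_betw \<pi> V V" "\<And>x. x \<in> V \<Longrightarrow> \<pi> x \<in> L \<longleftrightarrow> x \<in> L"
    and G: "G \<in> configs" and t: "t \<in> blocks.links V (cls G) \<sigma> I"
  shows "(\<lambda>x\<in>I \<times> UNIV. \<pi> (t x)) \<in> blocks.links V (cls (image \<pi> ` G)) \<sigma> I"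
proof -
  have inj: "inj_on \<pi> V" using \<pi>(1) by (simp add: bij_betw_def)
  have t': "t \<in> I \<times> UNIV \<rightarrow>\<^sub>E V" "\<forall>q\<in>I. cls G (t (q, True)) = cls G (t (\<sigma> q, False))"
    "inj_on (\<lambda>q. cls G (t (q, True))) I"
    using t unfolding links_config[OF G] by simp_all
  have tV: "t (q, s) \<in> V" if "q \<in> I" for q s
    by (rule PiE_mem[OF t'(1)]) (use that in simp)
  note P = partition[OF G]
  let ?u = "\<lambda>x\<in>I \<times> UNIV. \<pi> (t x)"
  have cls_u: "cls (image \<pi> ` G) (?u (q, s)) = \<pi> ` cls G (t (q, s))" if "q \<in> I" for q s
    using that by (simp add: cls_image[OF P inj tV])
  have nq: "\<sigma> q \<in> I" if "q \<in> I" for q using that bij_betwE[OF \<sigma>] by auto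
  have "?u \<in> I \<times> UNIV \<rightarrow>\<^sub>E V"
  proof (rule PiE_I)
    fix x :: "_ \<times> bool" assume "x \<in> I \<times> UNIV"
    then show "?u x \<in> V" using bij_betwE[OF \<pi>(1)] PiE_mem[OF t'(1)] by simp
  qed simp
  moreover have "\<forall>q\<in>I. cls (image \<pi> ` G) (?u (q, True)) = cls (image \<pi> ` G) (?u (\<sigma> q, False))"
  proof
    fix q assume q: "q \<in> I"
    then have "cls G (t (q, True)) = cls G (t (\<sigma> q, False))"
      using t'(2) by blast
    then show "cls (image \<pi> ` G) (?u (q, True)) = cls (image \<pi> ` G) (?u (\<sigma> q, False))"
      by (simp only: cls_u[OF q] cls_u[OF nq[OF q]])
  qed
  moreover have "inj_on (\<lambda>q. cls (image \<pi> ` G) (?u (q, True))) I"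
  proof (rule inj_onI)
    fix q q' assume q: "q \<in> I" "q' \<in> I" "cls (image \<pi> ` G) (?u (q, True)) = cls (image \<pi> ` G) (?u (q', True))"
    then have "\<pi> ` cls G (t (q, True)) = \<pi> ` cls G (t (q', True))" by (simp only: cls_u)
    moreover have sub: "cls G (t (q, s)) \<subseteq> V" if "q \<in> I" for q s
      using cls_in(1)[OF P tV[OF that]] P unfolding partition_on_def by blast
    ultimately have "cls G (t (q, True)) = cls G (t (q', True))"
      using inj_on_image_eq_iff[OF inj sub[OF q(1)] sub[OF q(2)]] by simp
    then show "q = q'" using t'(3) q by (auto dest: inj_onD)
  qed
  moreover have "image \<pi> ` G \<in> configs" by (rule configs_invariant[OF \<pi>(1) _ G]) (rule \<pi>(2))
  ultimately show ?thesis by (simp only: links_config) simp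
qed

lemma avg_invariant:
  assumes "finite Q"
    and "\<And>\<pi> G t. bij_betw \<pi> V V \<Longrightarrow> (\<And>x. x \<in> V \<Longrightarrow> \<pi> x \<in> L \<longleftrightarrow> x \<in> L) \<Longrightarrow> G \<in> configs \<Longrightarrow>
      t \<in> B G \<Longrightarrow> t \<in> Q \<rightarrow>\<^sub>E V \<Longrightarrow> (\<lambda>q\<in>Q. \<pi> (t q)) \<in> B (image \<pi> ` G)"
  shows "avg configs (\<lambda>G. real (card (A \<inter> B G \<inter> marked_tuples V L \<tau> Q))) =
    real (card (A \<inter> marked_tuples V L \<tau> Q)) / real (card (marked_tuples V L \<tau> Q))
     * avg configs (\<lambda>G. real (card (B G \<inter> marked_tuples V L \<tau> Q)))"
proof (rule avg_card_invariant)
  show "\<Union>G = V" if "G \<in> configs" for G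
    using partition_onD1[OF partition[OF that]] by (rule sym)
qed (fact finite_atLeastAtMost L_subset finite_configs assms configs_invariant)+

lemma avg_labelled:
  assumes I: "finite I" and \<sigma>: "bij_betw \<sigma> I I"
  shows "avg configs (\<lambda>G. real (card (labelled G \<sigma> I))) = (\<Sum>\<tau>\<in>I \<rightarrow>\<^sub>E UNIV.
     real (card (H.links id I \<inter> marked_tuples V L (\<tau> \<circ> fst) (I \<times> UNIV))) / real (card (marked_tuples V L (\<tau> \<circ> fst) (I \<times> (UNIV :: bool set))))
     * avg configs (\<lambda>G. real (card (blocks.links V (cls G) \<sigma> I \<inter> marked_tuples V L (\<tau> \<circ> fst) (I \<times> UNIV)))))"
proof -
  have "finite (I \<times> (UNIV :: bool set))" using I by simp
  then show ?thesis
    unfolding card_labelled[OF I] of_nat_sum avg_sum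
    by (intro sum.cong[OF refl] avg_invariant) (assumption | rule links_invariant[OF \<sigma>])+
qed

definition side :: "bool \<Rightarrow> nat set" where
  "side s = (if s then L else V - L)"

lemma side_subset: "side s \<subseteq> V" using L_subset by (auto simp: side_def)

text \<open>Whether a half-edge is marked depends on its hyperedge only, so a partner in the same
  hyperedge has the same mark automatically.\<close>

lemma hyperedge_pairs: "H.pairs (side s) (side s) = H.pairs (side s) V"
  using L_iff L_subset by (auto simp: H.pairs_def side_def)

lemma card_hyperedge_pairs: "card (H.pairs (side s) (side s)) = card (side s) * (l - 1)"
  unfolding hyperedge_pairs by (rule H.card_pairs_all[OF side_subset])

lemma card_side: "real (card (side s)) = (if s then real l * card M else real l * (real m - card M))"
proof -
  have "card M \<le> m" using card_mono[OF _ M] by simp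
  moreover have "card (V - L) = l * m - l * card M"
    using L_subset finite_subset[OF L_subset] by (subst card_Diff_subset) (simp_all add: card_L)
  ultimately show ?thesis by (simp add: side_def card_L right_diff_distrib of_nat_diff)
qed

lemma card_vertex_pairs:
  assumes G: "G \<in> configs"
  shows "real (card (blocks.pairs (cls G) (side s) (side s'))) =
    (if s \<and> s' then 0 else if s \<or> s' then real l * card M * (real d - 1) else real l * (real m - 2 * card M) * (real d - 1))"
proof -
  interpret C: blocks V "cls G" d by (rule blocks_config[OF G])
  note P = C.pairs_transversal[OF L_subset cls_inj_on_L[OF G]]
  have d1: "real (d - 1) = real d - 1" using d by (simp add: of_nat_diff)
  have "real (card (C.pairs (V - L) (V - L))) + 2 * (real (card L) * real (d - 1)) = real (card V) * real (d - 1)"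
    using arg_cong[OF P(4), of real] by (simp only: of_nat_add of_nat_mult of_nat_numeral)
  then have "real (card (C.pairs (V - L) (V - L))) = real l * (real m - 2 * card M) * (real d - 1)"
    unfolding d1 card_L by (simp add: algebra_simps)
  then show ?thesis
    using P d1 by (simp add: side_def card_L)
qed

lemma card_links_hyperedges:
  "card (H.links id I \<inter> marked_tuples V L (\<tau> \<circ> fst) (I \<times> UNIV)) =
    card (injfam (\<lambda>q. H.pairs (side (\<tau> q)) (side (\<tau> q))) (\<lambda>p. hyperedge_of l (fst p)) I)"
  by (simp add: H.card_links_marked[OF bij_betw_id L_subset] side_def)

lemma card_links_vertices:
  assumes "G \<in> configs" "bij_betw \<sigma> I I"
  shows "card (blocks.links V (cls G) \<sigma> I \<inter> marked_tuples V L (\<tau> \<circ> fst) (I \<times> UNIV)) =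
    card (injfam (\<lambda>q. blocks.pairs (cls G) (side (\<tau> q)) (side (\<tau> (\<sigma> q)))) (\<lambda>p. cls G (fst p)) I)"
  using blocks.card_links_marked[OF blocks_config[OF assms(1)] assms(2) L_subset] by (simp add: side_def)

lemma marked_tuples_side: "marked_tuples V L \<tau> Q = injfam (\<lambda>q. side (\<tau> q)) id Q"
  using marked_tuples_injfam[OF L_subset] by (simp add: side_def)

end

section \<open>Limits of expected counts for a planted matching of fixed density\<close>

text \<open>The index set \<open>S\<close> is kept apart from the density \<open>\<beta>\<close>:
  for the unconditioned law the density is 0 while m still runs through the values admissible for
  the original \<beta>. This is also why \<beta> = 0 is allowed.\<close>

locale planted_limit =
  fixes d l :: nat and \<beta> :: real and M :: "nat \<Rightarrow> nat set" and S :: "nat set"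
  assumes d: "d \<ge> 2" and l: "l \<ge> 2" and \<beta>: "0 \<le> \<beta>" "\<beta> < 1 / real d"
    and S: "\<And>m. m \<in> S \<Longrightarrow> d dvd l * m \<and> M m \<subseteq> {1..m} \<and> real (card (M m)) = real m * \<beta>"
begin

abbreviation "F \<equiv> inf at_top (principal S)"

lemma planted: 
  assumes "m \<in> S"
  shows "planted d l m (M m)"
proof
  have "real (d * card (M m)) = real m * (real d * \<beta>)" using S[OF assms] by simp
  also have "\<dots> \<le> real m * 1" using \<beta> d by (intro mult_left_mono) (auto simp: field_simps)
  finally have "real (d * card (M m)) \<le> real m" by simp
  then show "d * card (M m) \<le> m" by (simp only: of_nat_le_iff)
qed (use d l S[OF assms] in auto)

lemma eventually_S: "eventually (\<lambda>m. m \<in> S \<and> m > 0) F"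
  by (auto simp: eventually_inf_principal intro: eventually_mono[OF eventually_gt_at_top[of 0]])

lemma filterlim_real: "filterlim real at_top F"
  by (rule filterlim_mono[OF filterlim_real_sequentially order_refl]) simp

lemma \<beta>_half: "\<beta> < 1 / 2"
proof -
  have "1 / real d \<le> 1 / 2" using d by (intro divide_left_mono) auto
  then show ?thesis using \<beta> by simp
qed

definition dens :: "bool \<Rightarrow> real" where
  "dens s = (if s then \<beta> else 1 - \<beta>)"

text \<open>Among the \<open>l * m * (d - 1)\<close> ordered pairs of distinct half-edges of a common vertex, the
  marks are \<open>s, s'\<close> with frequency \<open>pair_dens s s'\<close>.\<close>

definition pair_dens :: "bool \<Rightarrow> bool \<Rightarrow> real" where
  "pair_dens s s' = (if s \<and> s' then 0 else if s \<or> s' then \<beta> else 1 - 2 * \<beta>)"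

abbreviation "HE m \<equiv> {1..l * m}"
abbreviation "MH m \<equiv> half_edges_of l m (M m)"
abbreviation "\<Omega> m \<equiv> planted.configs d l m (M m)"
abbreviation "SD m \<equiv> planted.side l m (M m)"

lemma tendsto_eventually_div:
  assumes "\<And>m. m \<in> S \<Longrightarrow> f m = c * real m"
  shows "((\<lambda>m. f m / real m) \<longlongrightarrow> c) F"
proof (rule tendsto_eventually)
  show "eventually (\<lambda>m. f m / real m = c) F"
    using eventually_S by eventually_elim (use assms in simp)
qed

lemma hyperedge_links_tendsto:
  assumes I: "finite I"
  shows "((\<lambda>m. real (card (blocks.links (HE m) (hyperedge_of l) id I \<inter> marked_tuples (HE m) (MH m) (\<tau> \<circ> fst) (I \<times> UNIV))) / real m ^ card I)
     \<longlongrightarrow> (\<Prod>q\<in>I. real l * (real l - 1) * dens (\<tau> q))) F"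
proof -
  let ?P = "\<lambda>m q. blocks.pairs (hyperedge_of l) (SD m (\<tau> q)) (SD m (\<tau> q))"
  have "((\<lambda>m. real (card (injfam (?P m) (\<lambda>p. hyperedge_of l (fst p)) I)) / real m ^ card I)
     \<longlongrightarrow> (\<Prod>q\<in>I. real l * (real l - 1) * dens (\<tau> q))) F"
  proof (rule card_injfam_tendsto[OF I filterlim_real, where c = "l * l"])
    fix q
    show "eventually (\<lambda>m. finite (?P m q) \<and> (\<forall>z. card {y \<in> ?P m q. hyperedge_of l (fst y) = z} \<le> l * l)) F"
      using eventually_S
    proof eventually_elim
      case (elim m)
      interpret planted d l m "M m" by (rule planted) (use elim in simp)
      show ?case by (intro conjI allI H.finite_pairs H.card_pairs_conflict side_subset)
    qed
    show "((\<lambda>m. real (card (?P m q)) / real m) \<longlongrightarrow> real l * (real l - 1) * dens (\<tau> q)) F"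
    proof (rule tendsto_eventually_div)
      fix m assume "m \<in> S"
      interpret planted d l m "M m" by (rule planted) fact
      show "real (card (?P m q)) = real l * (real l - 1) * dens (\<tau> q) * real m"
        unfolding card_hyperedge_pairs of_nat_mult card_side
        using S[OF \<open>m \<in> S\<close>] l by (simp add: dens_def of_nat_diff algebra_simps)
    qed
  qed
  then show ?thesis
  proof (rule Lim_transform_eventually)
    show "eventually (\<lambda>m. real (card (injfam (?P m) (\<lambda>p. hyperedge_of l (fst p)) I)) / real m ^ card I =
      real (card (blocks.links (HE m) (hyperedge_of l) id I \<inter> marked_tuples (HE m) (MH m) (\<tau> \<circ> fst) (I \<times> UNIV))) / real m ^ card I) F"
      using eventually_S
    proof eventually_elim
      case (elim m)
      interpret planted d l m "M m" by (rule planted) (use elim in simp)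
      show ?case unfolding card_links_hyperedges ..
    qed
  qed
qed

lemma marked_tuples_tendsto:
  assumes Q: "finite Q"
  shows "((\<lambda>m. real (card (marked_tuples (HE m) (MH m) \<tau> Q)) / real m ^ card Q) \<longlongrightarrow> (\<Prod>q\<in>Q. real l * dens (\<tau> q))) F"
proof -
  have "((\<lambda>m. real (card (injfam (\<lambda>q. SD m (\<tau> q)) id Q)) / real m ^ card Q) \<longlongrightarrow> (\<Prod>q\<in>Q. real l * dens (\<tau> q))) F"
  proof (rule card_injfam_tendsto[OF Q filterlim_real, where c = 1])
    fix q
    show "eventually (\<lambda>m. finite (SD m (\<tau> q)) \<and> (\<forall>z. card {y \<in> SD m (\<tau> q). id y = z} \<le> 1)) F"
      using eventually_S
    proof eventually_elim
      case (elim m)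
      interpret planted d l m "M m" by (rule planted) (use elim in simp)
      have "{y \<in> SD m (\<tau> q). id y = z} \<subseteq> {z}" for z by auto
      then have "card {y \<in> SD m (\<tau> q). id y = z} \<le> 1" for z
        using card_mono[of "{z}" "{y \<in> SD m (\<tau> q). id y = z}"] by simp
      then show ?case using finite_subset[OF side_subset] by simp
    qed
    show "((\<lambda>m. real (card (SD m (\<tau> q))) / real m) \<longlongrightarrow> real l * dens (\<tau> q)) F"
    proof (rule tendsto_eventually_div)
      fix m assume "m \<in> S"
      interpret planted d l m "M m" by (rule planted) fact
      show "real (card (SD m (\<tau> q))) = real l * dens (\<tau> q) * real m"
        unfolding card_side using S[OF \<open>m \<in> S\<close>] by (simp add: dens_def algebra_simps)
    qed
  qed
  then show ?thesis
  proof (rule Lim_transform_eventually)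
    show "eventually (\<lambda>m. real (card (injfam (\<lambda>q. SD m (\<tau> q)) id Q)) / real m ^ card Q =
      real (card (marked_tuples (HE m) (MH m) \<tau> Q)) / real m ^ card Q) F"
      using eventually_S
    proof eventually_elim
      case (elim m)
      interpret planted d l m "M m" by (rule planted) (use elim in simp)
      show ?case unfolding marked_tuples_side ..
    qed
  qed
qed

lemma eventually_configs: "eventually (\<lambda>m. finite (\<Omega> m) \<and> \<Omega> m \<noteq> {}) F"
  using eventually_S
proof eventually_elim
  case (elim m)
  interpret planted d l m "M m" by (rule planted) (use elim in simp)
  show ?case using finite_configs configs_nonempty by simp
qed

text \<open>The classes vary with the configuration but the pair counts do not, so every selection
  of configurations has the same limit, and therefore the average has it too.\<close>

lemma vertex_links_tendsto:
  assumes I: "finite I" and \<sigma>: "bij_betw \<sigma> I I"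
  shows "((\<lambda>m. avg (\<Omega> m) (\<lambda>G. real (card (blocks.links (HE m) (cls G) \<sigma> I \<inter> marked_tuples (HE m) (MH m) (\<tau> \<circ> fst) (I \<times> UNIV)))) / real m ^ card I)
     \<longlongrightarrow> (\<Prod>q\<in>I. real l * (real d - 1) * pair_dens (\<tau> q) (\<tau> (\<sigma> q)))) F"
proof -
  let ?X = "\<lambda>m G. real (card (blocks.links (HE m) (cls G) \<sigma> I \<inter> marked_tuples (HE m) (MH m) (\<tau> \<circ> fst) (I \<times> UNIV))) / real m ^ card I"
  have "((\<lambda>m. avg (\<Omega> m) (?X m)) \<longlongrightarrow> (\<Prod>q\<in>I. real l * (real d - 1) * pair_dens (\<tau> q) (\<tau> (\<sigma> q)))) F"
  proof (rule avg_tendsto_of_selections[OF eventually_configs])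
    fix G assume G: "eventually (\<lambda>m. G m \<in> \<Omega> m) F"
    let ?P = "\<lambda>m q. blocks.pairs (cls (G m)) (SD m (\<tau> q)) (SD m (\<tau> (\<sigma> q)))"
    have "((\<lambda>m. real (card (injfam (?P m) (\<lambda>p. cls (G m) (fst p)) I)) / real m ^ card I)
     \<longlongrightarrow> (\<Prod>q\<in>I. real l * (real d - 1) * pair_dens (\<tau> q) (\<tau> (\<sigma> q)))) F"
    proof (rule card_injfam_tendsto[OF I filterlim_real, where c = "d * d"])
      fix q
      show "eventually (\<lambda>m. finite (?P m q) \<and> (\<forall>z. card {y \<in> ?P m q. cls (G m) (fst y) = z} \<le> d * d)) F"
        using eventually_S G
      proof eventually_elim
        case (elim m)
        interpret planted d l m "M m" by (rule planted) (use elim in simp)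
        interpret C: blocks "HE m" "cls (G m)" d by (rule blocks_config[OF elim(2)])
        show ?case by (intro conjI allI C.finite_pairs C.card_pairs_conflict side_subset)
      qed
      show "((\<lambda>m. real (card (?P m q)) / real m) \<longlongrightarrow> real l * (real d - 1) * pair_dens (\<tau> q) (\<tau> (\<sigma> q))) F"
      proof (rule tendsto_eventually)
        show "eventually (\<lambda>m. real (card (?P m q)) / real m = real l * (real d - 1) * pair_dens (\<tau> q) (\<tau> (\<sigma> q))) F"
          using eventually_S G
        proof eventually_elim
          case (elim m)
          interpret planted d l m "M m" by (rule planted) (use elim in simp)
          have "real (card (?P m q)) = real l * (real d - 1) * pair_dens (\<tau> q) (\<tau> (\<sigma> q)) * real m"
            unfolding card_vertex_pairs[OF elim(2)] using S[of m] elim by (simp add: pair_dens_def algebra_simps)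
          then show ?case using elim by simp
        qed
      qed
    qed
    then show "((\<lambda>m. ?X m (G m)) \<longlongrightarrow> (\<Prod>q\<in>I. real l * (real d - 1) * pair_dens (\<tau> q) (\<tau> (\<sigma> q)))) F"
    proof (rule Lim_transform_eventually)
      show "eventually (\<lambda>m. real (card (injfam (?P m) (\<lambda>p. cls (G m) (fst p)) I)) / real m ^ card I = ?X m (G m)) F"
        using eventually_S G
      proof eventually_elim
        case (elim m)
        interpret planted d l m "M m" by (rule planted) (use elim in simp)
        show ?case unfolding card_links_vertices[OF elim(2) \<sigma>] ..
      qed
    qed
  qed
  moreover have "avg (\<Omega> m) (?X m) = avg (\<Omega> m) (\<lambda>G. real (card (blocks.links (HE m) (cls G) \<sigma> I \<inter> marked_tuples (HE m) (MH m) (\<tau> \<circ> fst) (I \<times> UNIV)))) / real m ^ card I" for m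
    by (simp add: avg_def sum_divide_distrib[symmetric])
  ultimately show ?thesis by simp
qed

lemma dens_eq_0: "dens s = 0 \<Longrightarrow> s \<and> \<beta> = 0"
  using \<beta>_half by (auto simp: dens_def split: if_splits)

lemma marked_tuples_empty:
  assumes "m \<in> S" "q \<in> Q" "dens (\<tau> q) = 0"
  shows "marked_tuples (HE m) (MH m) \<tau> Q = {}"
proof -
  interpret planted d l m "M m" by (rule planted) fact
  have "card (MH m) = 0" using dens_eq_0[OF assms(3)] S[OF assms(1)] by (simp add: card_L)
  then have "MH m = {}" using finite_subset[OF L_subset] by simp
  then show ?thesis using dens_eq_0[OF assms(3)] assms(2) by (auto simp: marked_tuples_def)
qed

text \<open>If \<open>\<beta> = 0\<close>, the terms with a marked hyperedge are \<open>0\<close> on both sides, on the right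
  because \<open>dens True = 0\<close> and \<open>x / 0 = 0\<close>.\<close>

lemma avg_labelled_tendsto:
  assumes I: "finite I" and \<sigma>: "bij_betw \<sigma> I I"
  shows "((\<lambda>m. avg (\<Omega> m) (\<lambda>G. real (card (planted.labelled l m G \<sigma> I))))
     \<longlongrightarrow> (\<Sum>\<tau>\<in>I \<rightarrow>\<^sub>E UNIV. \<Prod>q\<in>I. (real l - 1) * (real d - 1) * (pair_dens (\<tau> q) (\<tau> (\<sigma> q)) / dens (\<tau> q)))) F"
proof -
  let ?A = "\<lambda>m \<tau>. real (card (blocks.links (HE m) (hyperedge_of l) id I \<inter> marked_tuples (HE m) (MH m) (\<tau> \<circ> fst) (I \<times> UNIV)))"
  let ?B = "\<lambda>m \<tau>. avg (\<Omega> m) (\<lambda>G. real (card (blocks.links (HE m) (cls G) \<sigma> I \<inter> marked_tuples (HE m) (MH m) (\<tau> \<circ> fst) (I \<times> UNIV))))"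
  let ?I = "\<lambda>m \<tau>. real (card (marked_tuples (HE m) (MH m) (\<tau> \<circ> fst) (I \<times> (UNIV :: bool set))))"
  have "((\<lambda>m. ?A m \<tau> / ?I m \<tau> * ?B m \<tau>) \<longlongrightarrow> (\<Prod>q\<in>I. (real l - 1) * (real d - 1) * (pair_dens (\<tau> q) (\<tau> (\<sigma> q)) / dens (\<tau> q)))) F" for \<tau>
  proof (cases "\<exists>q\<in>I. dens (\<tau> q) = 0")
    case True
    then obtain q where q: "q \<in> I" "dens (\<tau> q) = 0" by blast
    have "eventually (\<lambda>m. ?A m \<tau> / ?I m \<tau> * ?B m \<tau> = 0) F"
      using eventually_S
    proof eventually_elim
      case (elim m)
      have "marked_tuples (HE m) (MH m) (\<tau> \<circ> fst) (I \<times> (UNIV :: bool set)) = {}"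
        by (rule marked_tuples_empty[of _ "(q, True)"]) (use elim q in auto)
      then show ?case by simp
    qed
    moreover have "(\<Prod>q\<in>I. (real l - 1) * (real d - 1) * (pair_dens (\<tau> q) (\<tau> (\<sigma> q)) / dens (\<tau> q))) = 0"
      using I q by (intro prod_zero) auto
    ultimately show ?thesis by (simp add: tendsto_eventually)
  next
    case False
    then have nz: "dens (\<tau> q) \<noteq> 0" if "q \<in> I" for q using that by blast
    let ?K = "card I"
    have cQ: "card (I \<times> (UNIV :: bool set)) = ?K + ?K" by (simp add: card_cartesian_product)
    have "(\<Prod>x\<in>I \<times> (UNIV :: bool set). real l * dens ((\<tau> \<circ> fst) x)) = (\<Prod>q\<in>I. \<Prod>s\<in>(UNIV :: bool set). real l * dens (\<tau> q))"
      unfolding prod.cartesian_product by (simp add: case_prod_beta)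
    also have "\<dots> = (\<Prod>q\<in>I. (real l * dens (\<tau> q)) ^ 2)" by simp
    finally have pI: "(\<Prod>x\<in>I \<times> (UNIV :: bool set). real l * dens ((\<tau> \<circ> fst) x)) = (\<Prod>q\<in>I. (real l * dens (\<tau> q)) ^ 2)" .
    have i: "((\<lambda>m. ?I m \<tau> / real m ^ (?K + ?K)) \<longlongrightarrow> (\<Prod>q\<in>I. (real l * dens (\<tau> q)) ^ 2)) F"
      using marked_tuples_tendsto[of "I \<times> (UNIV :: bool set)" "\<tau> \<circ> fst"] I unfolding pI cQ by simp
    have nz2: "(\<Prod>q\<in>I. (real l * dens (\<tau> q)) ^ 2) \<noteq> 0" using I nz l by auto
    \<comment> \<open>Both link counts are of order at most m^K, while the number of tuples is of
      order m^(2K), as each hyperedge carries two half-edges. The powers of m cancel.\<close>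
    have "((\<lambda>m. (?A m \<tau> / real m ^ ?K) / (?I m \<tau> / real m ^ (?K + ?K)) * (?B m \<tau> / real m ^ ?K)) \<longlongrightarrow>
       (\<Prod>q\<in>I. real l * (real l - 1) * dens (\<tau> q)) / (\<Prod>q\<in>I. (real l * dens (\<tau> q)) ^ 2) *
       (\<Prod>q\<in>I. real l * (real d - 1) * pair_dens (\<tau> q) (\<tau> (\<sigma> q)))) F"
      by (intro tendsto_mult tendsto_divide hyperedge_links_tendsto[OF I] i nz2 vertex_links_tendsto[OF I \<sigma>])
    also have "(\<Prod>q\<in>I. real l * (real l - 1) * dens (\<tau> q)) / (\<Prod>q\<in>I. (real l * dens (\<tau> q)) ^ 2) *
       (\<Prod>q\<in>I. real l * (real d - 1) * pair_dens (\<tau> q) (\<tau> (\<sigma> q))) =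
       (\<Prod>q\<in>I. (real l - 1) * (real d - 1) * (pair_dens (\<tau> q) (\<tau> (\<sigma> q)) / dens (\<tau> q)))"
      unfolding prod_dividef[symmetric] prod.distrib[symmetric]
      by (intro prod.cong refl) (use nz l in \<open>simp add: power2_eq_square field_simps\<close>)
    finally show ?thesis
    proof (rule Lim_transform_eventually)
      show "eventually (\<lambda>m. (?A m \<tau> / real m ^ ?K) / (?I m \<tau> / real m ^ (?K + ?K)) * (?B m \<tau> / real m ^ ?K) = ?A m \<tau> / ?I m \<tau> * ?B m \<tau>) F"
        using eventually_S by eventually_elim (simp add: power_add)
    qed
  qed
  then have "((\<lambda>m. \<Sum>\<tau>\<in>I \<rightarrow>\<^sub>E UNIV. ?A m \<tau> / ?I m \<tau> * ?B m \<tau>) \<longlongrightarrow>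
     (\<Sum>\<tau>\<in>I \<rightarrow>\<^sub>E UNIV. \<Prod>q\<in>I. (real l - 1) * (real d - 1) * (pair_dens (\<tau> q) (\<tau> (\<sigma> q)) / dens (\<tau> q)))) F"
    by (intro tendsto_sum)
  then show ?thesis
  proof (rule Lim_transform_eventually)
    show "eventually (\<lambda>m. (\<Sum>\<tau>\<in>I \<rightarrow>\<^sub>E UNIV. ?A m \<tau> / ?I m \<tau> * ?B m \<tau>) = avg (\<Omega> m) (\<lambda>G. real (card (planted.labelled l m G \<sigma> I)))) F"
      using eventually_S
    proof eventually_elim
      case (elim m)
      interpret planted d l m "M m" by (rule planted) (use elim in simp)
      show ?case unfolding avg_labelled[OF I \<sigma>] ..
    qed
  qed
qed

end

section \<open>The transfer matrix\<close>

lemma bij_betw_curry: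
  "bij_betw (\<lambda>t. \<lambda>j\<in>J. \<lambda>i\<in>K j. t (j, i)) (PiE (Sigma J K) (\<lambda>x. S (fst x) (snd x))) (PiE J (\<lambda>j. PiE (K j) (S j)))"
proof (rule bij_betw_byWitness[where f' = "\<lambda>u. \<lambda>x\<in>Sigma J K. u (fst x) (snd x)"])
  show "\<forall>t\<in>PiE (Sigma J K) (\<lambda>x. S (fst x) (snd x)). (\<lambda>x\<in>Sigma J K. (\<lambda>j\<in>J. \<lambda>i\<in>K j. t (j, i)) (fst x) (snd x)) = t"
  proof
    fix t assume t: "t \<in> PiE (Sigma J K) (\<lambda>x. S (fst x) (snd x))"
    show "(\<lambda>x\<in>Sigma J K. (\<lambda>j\<in>J. \<lambda>i\<in>K j. t (j, i)) (fst x) (snd x)) = t"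
    proof
      fix x show "(\<lambda>x\<in>Sigma J K. (\<lambda>j\<in>J. \<lambda>i\<in>K j. t (j, i)) (fst x) (snd x)) x = t x"
        using PiE_arb[OF t, of x] by (cases x) auto
    qed
  qed
  show "\<forall>u\<in>PiE J (\<lambda>j. PiE (K j) (S j)). (\<lambda>j\<in>J. \<lambda>i\<in>K j. (\<lambda>x\<in>Sigma J K. u (fst x) (snd x)) (j, i)) = u"
  proof
    fix u assume u: "u \<in> PiE J (\<lambda>j. PiE (K j) (S j))"
    show "(\<lambda>j\<in>J. \<lambda>i\<in>K j. (\<lambda>x\<in>Sigma J K. u (fst x) (snd x)) (j, i)) = u"
    proof
      fix j show "(\<lambda>j\<in>J. \<lambda>i\<in>K j. (\<lambda>x\<in>Sigma J K. u (fst x) (snd x)) (j, i)) j = u j"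
      proof (cases "j \<in> J")
        case True
        then have uj: "u j \<in> PiE (K j) (S j)" using u by (rule PiE_mem[rotated])
        show ?thesis
        proof
          fix i show "(\<lambda>j\<in>J. \<lambda>i\<in>K j. (\<lambda>x\<in>Sigma J K. u (fst x) (snd x)) (j, i)) j i = u j i"
            using True PiE_arb[OF uj, of i] by simp
        qed
      next
        case False
        then show ?thesis using PiE_arb[OF u False] by simp
      qed
    qed
  qed
  show "(\<lambda>t. \<lambda>j\<in>J. \<lambda>i\<in>K j. t (j, i)) ` PiE (Sigma J K) (\<lambda>x. S (fst x) (snd x)) \<subseteq> PiE J (\<lambda>j. PiE (K j) (S j))"
  proof (intro image_subsetI PiE_I)
    fix t j i assume "t \<in> PiE (Sigma J K) (\<lambda>x. S (fst x) (snd x))" "j \<in> J" "i \<in> K j"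
    then show "(\<lambda>j\<in>J. \<lambda>i\<in>K j. t (j, i)) j i \<in> S j i" using PiE_mem[of t _ _ "(j, i)"] by fastforce
  qed auto
  show "(\<lambda>u. \<lambda>x\<in>Sigma J K. u (fst x) (snd x)) ` PiE J (\<lambda>j. PiE (K j) (S j)) \<subseteq> PiE (Sigma J K) (\<lambda>x. S (fst x) (snd x))"
  proof (intro image_subsetI PiE_I)
    fix u x assume "u \<in> PiE J (\<lambda>j. PiE (K j) (S j))" "x \<in> Sigma J K"
    then show "(\<lambda>x\<in>Sigma J K. u (fst x) (snd x)) x \<in> S (fst x) (snd x)"
      using PiE_mem[of u J _ "fst x"] PiE_mem[of "u (fst x)" _ _ "snd x"] by (cases x) auto
  qed auto
qed

definition rotate_in :: "nat \<Rightarrow> nat \<Rightarrow> nat" where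
  "rotate_in k i = Suc i mod k"

text \<open>One permutation shifts all cycles of a family at once, so that a family of node-disjoint
  cycles is again a single linked tuple.\<close>

definition rotate_family :: "('j \<Rightarrow> nat) \<Rightarrow> 'j \<times> nat \<Rightarrow> 'j \<times> nat" where
  "rotate_family len x = (fst x, rotate_in (len (fst x)) (snd x))"

lemma bij_betw_rotate_in: "bij_betw (rotate_in k) {..<k} {..<k}"
proof -
  have "inj_on (rotate_in k) {..<k}"
    by (auto simp: inj_on_def rotate_in_def mod_Suc split: if_splits)
  moreover have "rotate_in k ` {..<k} \<subseteq> {..<k}" by (auto simp: rotate_in_def)
  ultimately show ?thesis by (simp add: bij_betw_def endo_inj_surj)
qed

lemma rotate_in_less: "i < k \<Longrightarrow> rotate_in k i < k"
  by (simp add: rotate_in_def)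

lemma bij_betw_rotate_family:
  assumes "finite J"
  shows "bij_betw (rotate_family len) (SIGMA j:J. {..<len j}) (SIGMA j:J. {..<len j})"
proof -
  have "inj_on (rotate_family len) (SIGMA j:J. {..<len j})"
    using bij_betw_rotate_in unfolding inj_on_def rotate_family_def bij_betw_def
    by (auto simp: inj_on_def)
  moreover have "rotate_family len ` (SIGMA j:J. {..<len j}) \<subseteq> (SIGMA j:J. {..<len j})"
    by (auto simp: rotate_family_def rotate_in_less)
  moreover have "finite (SIGMA j:J. {..<len j})" using assms by auto
  ultimately show ?thesis by (simp add: bij_betw_def endo_inj_surj)
qed

text \<open>The rotation never leaves a cycle, so the marks on different cycles can be summed
  separately. This factorisation is the source of the independence in the limit.\<close>

lemma sum_prod_rotate_family:
  fixes \<phi> :: "bool \<Rightarrow> bool \<Rightarrow> real"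
  assumes J: "finite J"
  shows "(\<Sum>\<tau>\<in>(SIGMA j:J. {..<len j}) \<rightarrow>\<^sub>E UNIV. \<Prod>x\<in>(SIGMA j:J. {..<len j}). \<phi> (\<tau> x) (\<tau> (rotate_family len x))) =
    (\<Prod>j\<in>J. \<Sum>\<tau>\<in>{..<len j} \<rightarrow>\<^sub>E UNIV. \<Prod>i<len j. \<phi> (\<tau> i) (\<tau> (rotate_in (len j) i)))"
proof -
  let ?I = "SIGMA j:J. {..<len j}"
  have "(\<Prod>j\<in>J. \<Sum>\<tau>\<in>{..<len j} \<rightarrow>\<^sub>E UNIV. \<Prod>i<len j. \<phi> (\<tau> i) (\<tau> (rotate_in (len j) i))) =
    (\<Sum>u\<in>PiE J (\<lambda>j. {..<len j} \<rightarrow>\<^sub>E UNIV). \<Prod>j\<in>J. \<Prod>i<len j. \<phi> (u j i) (u j (rotate_in (len j) i)))"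
    by (rule prod_sum_PiE[OF J]) (auto intro: finite_PiE)
  also have "\<dots> = (\<Sum>\<tau>\<in>?I \<rightarrow>\<^sub>E UNIV. \<Prod>j\<in>J. \<Prod>i<len j. \<phi> ((\<lambda>j\<in>J. \<lambda>i\<in>{..<len j}. \<tau> (j, i)) j i) ((\<lambda>j\<in>J. \<lambda>i\<in>{..<len j}. \<tau> (j, i)) j (rotate_in (len j) i)))"
    by (rule sum.reindex_bij_betw[symmetric]) (rule bij_betw_curry[where S = "\<lambda>_ _. UNIV"])
  also have "\<dots> = (\<Sum>\<tau>\<in>?I \<rightarrow>\<^sub>E UNIV. \<Prod>j\<in>J. \<Prod>i<len j. \<phi> (\<tau> (j, i)) (\<tau> (rotate_family len (j, i))))"
    by (intro sum.cong prod.cong refl) (simp add: rotate_family_def rotate_in_less)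
  also have "\<dots> = (\<Sum>\<tau>\<in>?I \<rightarrow>\<^sub>E UNIV. \<Prod>x\<in>?I. \<phi> (\<tau> x) (\<tau> (rotate_family len x)))"
    by (intro sum.cong refl, subst prod.Sigma) (use J in \<open>auto simp: case_prod_beta\<close>)
  finally show ?thesis by simp
qed

text \<open>\<open>walks \<phi> n\<close> is the n-th power of the two by two matrix
  \<open>\<phi>\<close>.\<close>

fun walks :: "(bool \<Rightarrow> bool \<Rightarrow> real) \<Rightarrow> nat \<Rightarrow> bool \<Rightarrow> bool \<Rightarrow> real" where
  "walks \<phi> 0 x y = of_bool (x = y)"
| "walks \<phi> (Suc n) x y = (\<Sum>z\<in>UNIV. walks \<phi> n x z * \<phi> z y)"

text \<open>The weight \<open>h\<close> of the two end points is arbitrary, so that the induction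
  can absorb the last step of the walk into it. It later serves to close the walk up.\<close>

lemma sum_walks:
  fixes \<phi> :: "bool \<Rightarrow> bool \<Rightarrow> real"
  shows "(\<Sum>\<tau>\<in>{..<Suc n} \<rightarrow>\<^sub>E UNIV. (\<Prod>i<n. \<phi> (\<tau> i) (\<tau> (Suc i))) * h (\<tau> 0) (\<tau> n)) =
    (\<Sum>x\<in>UNIV. \<Sum>y\<in>UNIV. walks \<phi> n x y * h x y)"
proof (induction n arbitrary: h)
  case 0
  have "(\<Sum>\<tau>\<in>{..<Suc 0} \<rightarrow>\<^sub>E UNIV. h (\<tau> 0) (\<tau> 0)) = (\<Sum>x\<in>(UNIV :: bool set). h x x)"
    by (rule sum.reindex_bij_witness[of _ "\<lambda>x. \<lambda>i\<in>{..<Suc 0}. x" "\<lambda>\<tau>. \<tau> 0"])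
       (auto simp: PiE_def extensional_def fun_eq_iff)
  then show ?case by (simp add: UNIV_bool)
next
  case (Suc n)
  have "(\<Sum>\<tau>\<in>{..<Suc (Suc n)} \<rightarrow>\<^sub>E UNIV. (\<Prod>i<Suc n. \<phi> (\<tau> i) (\<tau> (Suc i))) * h (\<tau> 0) (\<tau> (Suc n))) =
    (\<Sum>(z, \<tau>)\<in>UNIV \<times> ({..<Suc n} \<rightarrow>\<^sub>E UNIV). (\<Prod>i<n. \<phi> (\<tau> i) (\<tau> (Suc i))) * (\<phi> (\<tau> n) z * h (\<tau> 0) z))"
    by (rule sum.reindex_bij_witness[of _ "\<lambda>(z, \<tau>). \<tau>(Suc n := z)" "\<lambda>\<tau>. (\<tau> (Suc n), \<tau>(Suc n := undefined))"])
       (auto simp: PiE_def extensional_def fun_eq_iff mult.assoc)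
  also have "\<dots> = (\<Sum>\<tau>\<in>{..<Suc n} \<rightarrow>\<^sub>E UNIV. \<Sum>z\<in>UNIV. (\<Prod>i<n. \<phi> (\<tau> i) (\<tau> (Suc i))) * (\<phi> (\<tau> n) z * h (\<tau> 0) z))"
    by (subst sum.swap) (simp add: sum.cartesian_product)
  also have "\<dots> = (\<Sum>\<tau>\<in>{..<Suc n} \<rightarrow>\<^sub>E UNIV. (\<Prod>i<n. \<phi> (\<tau> i) (\<tau> (Suc i))) * (\<lambda>x y. \<Sum>z\<in>UNIV. \<phi> y z * h x z) (\<tau> 0) (\<tau> n))"
    by (simp add: sum_distrib_left)
  also have "\<dots> = (\<Sum>x\<in>UNIV. \<Sum>y\<in>UNIV. walks \<phi> n x y * (\<Sum>z\<in>UNIV. \<phi> y z * h x z))"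
    by (rule Suc.IH)
  also have "\<dots> = (\<Sum>x\<in>UNIV. \<Sum>y\<in>UNIV. walks \<phi> (Suc n) x y * h x y)"
    by (simp add: UNIV_bool algebra_simps)
  finally show ?case .
qed

text \<open>Cut the cycle at index 0: the factors with i < k - 1 form a walk, and the wrap-around
  factor returns to the starting mark. The sum is therefore the trace of the k-th power.\<close>

lemma sum_prod_rotate_in:
  fixes \<phi> :: "bool \<Rightarrow> bool \<Rightarrow> real"
  assumes "k > 0"
  shows "(\<Sum>\<tau>\<in>{..<k} \<rightarrow>\<^sub>E UNIV. \<Prod>i<k. \<phi> (\<tau> i) (\<tau> (rotate_in k i))) = walks \<phi> k False False + walks \<phi> k True True"
proof -
  obtain n where k: "k = Suc n" using assms gr0_implies_Suc by blast
  have "(\<Prod>i<k. \<phi> (\<tau> i) (\<tau> (rotate_in k i))) = (\<Prod>i<n. \<phi> (\<tau> i) (\<tau> (Suc i))) * \<phi> (\<tau> n) (\<tau> 0)" for \<tau>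
  proof -
    have "(\<Prod>i<n. \<phi> (\<tau> i) (\<tau> (rotate_in k i))) = (\<Prod>i<n. \<phi> (\<tau> i) (\<tau> (Suc i)))"
      by (intro prod.cong refl) (simp add: rotate_in_def k)
    then show ?thesis by (simp add: k rotate_in_def)
  qed
  then have "(\<Sum>\<tau>\<in>{..<k} \<rightarrow>\<^sub>E UNIV. \<Prod>i<k. \<phi> (\<tau> i) (\<tau> (rotate_in k i))) =
    (\<Sum>\<tau>\<in>{..<Suc n} \<rightarrow>\<^sub>E UNIV. (\<Prod>i<n. \<phi> (\<tau> i) (\<tau> (Suc i))) * (\<lambda>x y. \<phi> y x) (\<tau> 0) (\<tau> n))"
    by (simp add: k)
  also have "\<dots> = (\<Sum>x\<in>UNIV. \<Sum>y\<in>UNIV. walks \<phi> n x y * \<phi> y x)" by (rule sum_walks)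
  also have "\<dots> = walks \<phi> k False False + walks \<phi> k True True" by (simp add: k UNIV_bool)
  finally show ?thesis .
qed

lemma walks_scale: "walks (\<lambda>x y. c * \<phi> x y) n x y = c ^ n * walks \<phi> n x y"
  by (induction n arbitrary: y) (simp_all add: UNIV_bool algebra_simps)

context planted_limit
begin

text \<open>For \<open>\<beta> > 0\<close> the transfer matrix has the eigenvalues \<open>1\<close> and \<open>- \<beta> / (1 - \<beta>)\<close>.\<close>

lemma walks_trace:
  assumes "k > 0"
  defines "\<phi> \<equiv> \<lambda>s s'. pair_dens s s' / dens s"
  shows "walks \<phi> k False False + walks \<phi> k True True = 1 + (- 1) ^ k * \<beta> ^ k / (1 - \<beta>) ^ k"
proof -
  define r where "r = \<beta> / (1 - \<beta>)"
  have b: "1 - \<beta> > 0" using \<beta>_half by simp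
  have r: "r \<ge> 0" "(- 1) ^ k * \<beta> ^ k / (1 - \<beta>) ^ k = (- r) ^ k"
    using b \<beta> by (simp_all add: r_def power_divide power_minus[of "_ / _"] power_minus[of r])
  have FF: "\<phi> False False = 1 - r" and FT: "\<phi> False True = r" and TT: "\<phi> True True = 0"
    using b by (simp_all add: \<phi>_def pair_dens_def dens_def r_def field_simps)
  show ?thesis
  proof (cases "\<beta> = 0")
    case True
    \<comment> \<open>Here \<open>dens True = 0\<close> makes the row of True vanish, since x / 0 =
      0. The matrix has the single nonzero entry 1 at False, False, so its trace powers are 1, which
      agrees with r = 0.\<close>
    then have dT: "dens True = 0" and r0: "r = 0" unfolding dens_def r_def by simp_all
    have TF: "\<phi> True False = 0" by (simp add: \<phi>_def dT)
    have "walks \<phi> n False False = 1 \<and> walks \<phi> n False True = 0" for n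
      by (induction n) (simp_all add: UNIV_bool FF FT TT TF r0)
    moreover have "walks \<phi> (Suc n) True True = 0" for n
      by (simp add: UNIV_bool TT FT r0)
    ultimately show ?thesis using assms r0 unfolding r(2) by (cases k) auto
  next
    case False
    then have TF: "\<phi> True False = 1" by (simp add: \<phi>_def pair_dens_def dens_def)
    have r1: "1 + r \<noteq> 0" using r by simp
    \<comment> \<open>The spectral decomposition: the eigenvalue 1 contributes the stationary law
      (1, r) / (1 + r) to both rows, the rest decays as the n-th power of -r.\<close>
    have "walks \<phi> n False False = (1 + (- r) ^ n * r) / (1 + r) \<and> walks \<phi> n False True = (r - (- r) ^ n * r) / (1 + r) \<and>
      walks \<phi> n True False = (1 - (- r) ^ n) / (1 + r) \<and> walks \<phi> n True True = (r + (- r) ^ n) / (1 + r)" for n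
    proof (induction n)
      case 0
      show ?case using r1 by simp
    next
      case (Suc n)
      show ?case using r1
        by (simp only: walks.simps UNIV_bool sum.insert finite.intros Suc.IH FF FT TT TF)
           (simp add: Suc.IH FF FT TT TF divide_simps, simp add: algebra_simps)
    qed
    then have "walks \<phi> k False False + walks \<phi> k True True = ((1 + r) + (- r) ^ k * (1 + r)) / (1 + r)"
      by (simp add: add_divide_distrib[symmetric] algebra_simps)
    also have "\<dots> = 1 + (- r) ^ k" using r1 by (simp add: add_divide_distrib)
    finally show ?thesis unfolding r(2) .
  qed
qed

lemma avg_labelled_family_tendsto:
  assumes J: "finite J" and len: "\<And>j. j \<in> J \<Longrightarrow> len j > 0"
  shows "((\<lambda>m. avg (\<Omega> m) (\<lambda>G. real (card (planted.labelled l m G (rotate_family len) (SIGMA j:J. {..<len j})))))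
    \<longlongrightarrow> (\<Prod>j\<in>J. 2 * real (len j) * planted_cycle_rate d l \<beta> (len j))) F"
proof -
  let ?c = "(real l - 1) * (real d - 1)"
  let ?\<phi> = "\<lambda>s s'. pair_dens s s' / dens s"
  have "((\<lambda>m. avg (\<Omega> m) (\<lambda>G. real (card (planted.labelled l m G (rotate_family len) (SIGMA j:J. {..<len j})))))
     \<longlongrightarrow> (\<Sum>\<tau>\<in>(SIGMA j:J. {..<len j}) \<rightarrow>\<^sub>E UNIV. \<Prod>x\<in>(SIGMA j:J. {..<len j}). ?c * ?\<phi> (\<tau> x) (\<tau> (rotate_family len x)))) F"
    using J by (intro avg_labelled_tendsto bij_betw_rotate_family) auto
  also have "(\<Sum>\<tau>\<in>(SIGMA j:J. {..<len j}) \<rightarrow>\<^sub>E UNIV. \<Prod>x\<in>(SIGMA j:J. {..<len j}). ?c * ?\<phi> (\<tau> x) (\<tau> (rotate_family len x))) =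
     (\<Prod>j\<in>J. \<Sum>\<tau>\<in>{..<len j} \<rightarrow>\<^sub>E UNIV. \<Prod>i<len j. ?c * ?\<phi> (\<tau> i) (\<tau> (rotate_in (len j) i)))"
    by (rule sum_prod_rotate_family[OF J])
  also have "\<dots> = (\<Prod>j\<in>J. 2 * real (len j) * planted_cycle_rate d l \<beta> (len j))"
  proof (rule prod.cong[OF refl])
    fix j assume j: "j \<in> J"
    have "(\<Sum>\<tau>\<in>{..<len j} \<rightarrow>\<^sub>E UNIV. \<Prod>i<len j. ?c * ?\<phi> (\<tau> i) (\<tau> (rotate_in (len j) i))) =
      ?c ^ len j * (walks ?\<phi> (len j) False False + walks ?\<phi> (len j) True True)"
      unfolding sum_prod_rotate_in[OF len[OF j], where \<phi> = "\<lambda>s s'. ?c * ?\<phi> s s'"] walks_scale by (simp add: distrib_left)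
    also have "\<dots> = 2 * real (len j) * planted_cycle_rate d l \<beta> (len j)"
    proof -
      have "?c ^ len j = (real d - 1) ^ len j * (real l - 1) ^ len j"
        by (simp only: power_mult_distrib mult.commute)
      then show ?thesis
        unfolding walks_trace[OF len[OF j]] planted_cycle_rate_def cycle_rate_def
        using len[OF j] by (simp del: power_mult_distrib)
    qed
    finally show "(\<Sum>\<tau>\<in>{..<len j} \<rightarrow>\<^sub>E UNIV. \<Prod>i<len j. ?c * ?\<phi> (\<tau> i) (\<tau> (rotate_in (len j) i))) =
      2 * real (len j) * planted_cycle_rate d l \<beta> (len j)" .
  qed
  finally show ?thesis .
qed

end

section \<open>Sets of half-edges meeting few nodes\<close>

context planted
begin

definition bad :: "nat \<Rightarrow> nat set set \<Rightarrow> nat set set" where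
  "bad R G = {W. W \<subseteq> V \<and> card W \<le> R \<and> card (hyperedge_of l ` W) + card (cls G ` W) < card W}"

definition few_hyperedges :: "nat \<Rightarrow> nat \<Rightarrow> (nat \<Rightarrow> nat) set" where
  "few_hyperedges s h = {t \<in> {..<s} \<rightarrow>\<^sub>E V. card (hyperedge_of l ` t ` {..<s}) \<le> h}"

definition few_vertices :: "nat \<Rightarrow> nat \<Rightarrow> nat set set \<Rightarrow> (nat \<Rightarrow> nat) set" where
  "few_vertices s v G = {t \<in> {..<s} \<rightarrow>\<^sub>E V. card (cls G ` t ` {..<s}) \<le> v}"

lemma finite_bad: "finite (bad R G)"
  by (rule finite_subset[of _ "Pow V"]) (auto simp: bad_def)

text \<open>Invariance is available for tuples with prescribed marks, so each bad set is enumerated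
  and sorted by its size s, by the numbers h and v of hyperedges and vertices it meets, where h + v
  < s, and by its marks.\<close>

lemma card_bad_le:
  "card (bad R G) \<le> (\<Sum>s\<le>R. \<Sum>h<s. \<Sum>v<s - h. \<Sum>\<tau>\<in>{..<s} \<rightarrow>\<^sub>E UNIV.
     card (few_hyperedges s h \<inter> few_vertices s v G \<inter> marked_tuples V L \<tau> {..<s}))"
proof -
  let ?X = "\<lambda>s h v \<tau>. few_hyperedges s h \<inter> few_vertices s v G \<inter> marked_tuples V L \<tau> {..<s}"
  have "bad R G \<subseteq> (\<Union>s\<le>R. \<Union>h<s. \<Union>v<s - h. \<Union>\<tau>\<in>{..<s} \<rightarrow>\<^sub>E UNIV. (\<lambda>t. t ` {..<s}) ` ?X s h v \<tau>)"
  proof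
    fix W assume "W \<in> bad R G"
    then have W: "W \<subseteq> V" "card W \<le> R" "card (hyperedge_of l ` W) + card (cls G ` W) < card W"
      by (simp_all add: bad_def)
    have fW: "finite W" using W(1) by (rule finite_subset) simp
    obtain e where e: "bij_betw e {0..<card W} W" using ex_bij_betw_nat_finite[OF fW] by blast
    let ?s = "card W"
    define t where "t = restrict e {..<?s}"
    have tW: "t ` {..<?s} = W" using e by (auto simp: t_def bij_betw_def atLeast0LessThan)
    have inj: "inj_on t {..<?s}" using e by (auto simp: t_def bij_betw_def atLeast0LessThan inj_on_def)
    have tV: "t \<in> {..<?s} \<rightarrow>\<^sub>E V" using tW W(1) by (intro PiE_I) (blast, simp add: t_def)
    let ?\<tau> = "\<lambda>q\<in>{..<?s}. t q \<in> L"
    have "t \<in> ?X ?s (card (hyperedge_of l ` W)) (card (cls G ` W)) ?\<tau>"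
      using tV inj by (simp add: few_hyperedges_def few_vertices_def marked_tuples_def tW)
    then have "W \<in> (\<lambda>t. t ` {..<?s}) ` ?X ?s (card (hyperedge_of l ` W)) (card (cls G ` W)) ?\<tau>"
      using tW by (intro image_eqI[of _ _ t]) simp_all
    moreover have "?\<tau> \<in> {..<?s} \<rightarrow>\<^sub>E UNIV" by simp
    moreover have "card (cls G ` W) < ?s - card (hyperedge_of l ` W)" "card (hyperedge_of l ` W) < ?s" using W(3) by simp_all
    ultimately show "W \<in> (\<Union>s\<le>R. \<Union>h<s. \<Union>v<s - h. \<Union>\<tau>\<in>{..<s} \<rightarrow>\<^sub>E UNIV. (\<lambda>t. t ` {..<s}) ` ?X s h v \<tau>)"
      using W(2) by (intro UN_I[of ?s] UN_I[of "card (hyperedge_of l ` W)"] UN_I[of "card (cls G ` W)"] UN_I[of ?\<tau>]) simp_all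
  qed
  moreover have fX: "finite (?X s h v \<tau>)" for s h v \<tau>
    by (rule finite_subset[OF _ finite_tuples[of "{..<s}"]]) (auto simp: few_hyperedges_def)
  have fP: "finite ({..<s} \<rightarrow>\<^sub>E (UNIV :: bool set))" for s :: nat by (intro finite_PiE) auto
  moreover have "finite (\<Union>s\<le>R. \<Union>h<s. \<Union>v<s - h. \<Union>\<tau>\<in>{..<s} \<rightarrow>\<^sub>E UNIV. (\<lambda>t. t ` {..<s}) ` ?X s h v \<tau>)"
    by (intro finite_UN_I finite_imageI fX fP finite_atMost finite_lessThan)
  ultimately have "card (bad R G) \<le> card (\<Union>s\<le>R. \<Union>h<s. \<Union>v<s - h. \<Union>\<tau>\<in>{..<s} \<rightarrow>\<^sub>E UNIV. (\<lambda>t. t ` {..<s}) ` ?X s h v \<tau>)"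
    by (intro card_mono)
  also have "\<dots> \<le> (\<Sum>s\<le>R. \<Sum>h<s. \<Sum>v<s - h. \<Sum>\<tau>\<in>{..<s} \<rightarrow>\<^sub>E UNIV. card (?X s h v \<tau>))"
    by (intro order.trans[OF card_UN_le sum_mono] order.trans[OF card_UN_le] card_image_le fX fP finite_atMost finite_lessThan sum_mono)
  finally show ?thesis .
qed

lemma few_vertices_invariant:
  assumes \<pi>: "bij_betw \<pi> V V" and G: "G \<in> configs" and t: "t \<in> few_vertices s v G"
  shows "(\<lambda>q\<in>{..<s}. \<pi> (t q)) \<in> few_vertices s v (image \<pi> ` G)"
proof -
  have inj: "inj_on \<pi> V" using \<pi> by (simp add: bij_betw_def)
  have t': "t \<in> {..<s} \<rightarrow>\<^sub>E V" "card (cls G ` t ` {..<s}) \<le> v" using t by (simp_all add: few_vertices_def)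
  have tV: "t q \<in> V" if "q < s" for q by (rule PiE_mem[OF t'(1)]) (use that in simp)
  have "cls (image \<pi> ` G) ` (\<lambda>q\<in>{..<s}. \<pi> (t q)) ` {..<s} = image \<pi> ` cls G ` t ` {..<s}"
    unfolding image_image using cls_image[OF partition[OF G] inj tV] by (intro image_cong refl) simp
  then have "card (cls (image \<pi> ` G) ` (\<lambda>q\<in>{..<s}. \<pi> (t q)) ` {..<s}) \<le> card (cls G ` t ` {..<s})"
    by (simp only: card_image_le finite_imageI finite_lessThan)
  moreover have "(\<lambda>q\<in>{..<s}. \<pi> (t q)) \<in> {..<s} \<rightarrow>\<^sub>E V"
    using tV bij_betwE[OF \<pi>] by (intro PiE_I) simp_all
  ultimately show ?thesis using t'(2) by (simp add: few_vertices_def)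
qed

text \<open>By invariance the average is a product of two counts divided by the number of all tuples
  of this pattern. Both counts come from covering a tuple by few blocks; there are at most m
  hyperedges, and the crude bound l m on the number of vertices suffices.\<close>

lemma avg_few_le:
  assumes s: "s > 0"
  shows "avg configs (\<lambda>G. real (card (few_hyperedges s h \<inter> few_vertices s v G \<inter> marked_tuples V L \<tau> {..<s})))
    \<le> real m ^ h * real (h * l) ^ s * (real (l * m) ^ v * real (v * d) ^ s) / real (card (marked_tuples V L \<tau> {..<s}))"
proof -
  let ?I = "marked_tuples V L \<tau> {..<s}"
  have Q: "finite {..<s}" "{..<s} \<noteq> {}" using s by auto
  have "card (few_hyperedges s h \<inter> ?I) \<le> card (few_hyperedges s h)"
    by (intro card_mono) (auto simp: few_hyperedges_def finite_tuples)
  also have "\<dots> \<le> card (hyperedge_of l ` V) ^ h * (h * l) ^ card {..<s}"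
    unfolding few_hyperedges_def by (rule H.card_tuples_few_blocks[OF Q])
  also have "card (hyperedge_of l ` V) \<le> m"
    using card_mono[of "{1..m}" "hyperedge_of l ` V"] hyperedge_of_in[of _ l m] by fastforce
  finally have 1: "card (few_hyperedges s h \<inter> ?I) \<le> m ^ h * (h * l) ^ s" by (simp add: power_mono mult_right_mono)
  have 2: "card (few_vertices s v G \<inter> ?I) \<le> (l * m) ^ v * (v * d) ^ s" if G: "G \<in> configs" for G
  proof -
    interpret C: blocks V "cls G" d by (rule blocks_config[OF G])
    have "card (few_vertices s v G \<inter> ?I) \<le> card (few_vertices s v G)"
      by (intro card_mono) (auto simp: few_vertices_def finite_tuples)
    also have "\<dots> \<le> card (cls G ` V) ^ v * (v * d) ^ card {..<s}"
      unfolding few_vertices_def by (rule C.card_tuples_few_blocks[OF Q])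
    also have "card (cls G ` V) \<le> l * m" by (rule card_cls_image_le[OF G])
    finally show ?thesis by (simp add: power_mono mult_right_mono)
  qed
  have "avg configs (\<lambda>G. real (card (few_vertices s v G \<inter> ?I))) \<le> avg configs (\<lambda>G. real (l * m) ^ v * real (v * d) ^ s)"
    using 2 by (intro avg_mono) (metis of_nat_mono of_nat_mult of_nat_power)
  also have "\<dots> = real (l * m) ^ v * real (v * d) ^ s"
    using finite_configs configs_nonempty by (simp add: avg_def)
  finally have 3: "avg configs (\<lambda>G. real (card (few_vertices s v G \<inter> ?I))) \<le> real (l * m) ^ v * real (v * d) ^ s" .
  have "avg configs (\<lambda>G. real (card (few_hyperedges s h \<inter> few_vertices s v G \<inter> ?I))) =
      real (card (few_hyperedges s h \<inter> ?I)) / real (card ?I) * avg configs (\<lambda>G. real (card (few_vertices s v G \<inter> ?I)))"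
    by (rule avg_invariant) (auto intro: few_vertices_invariant)
  also have "\<dots> \<le> (real m ^ h * real (h * l) ^ s) / real (card ?I) * (real (l * m) ^ v * real (v * d) ^ s)"
    using of_nat_mono[OF 1, where 'a = real]
    by (intro mult_mono divide_right_mono 3 avg_nonneg) simp_all
  finally show ?thesis by simp
qed

end

context planted_limit
begin

text \<open>The numerator is of order at most m^(h + v) and the number of tuples of order m^s, so at
  least one factor 1 / m remains. If some mark has density 0, there are no tuples at all and the
  quotient is x / 0 = 0.\<close>

lemma few_tendsto_0:
  assumes hv: "h + v < s"
  shows "((\<lambda>m. real m ^ h * real (h * l) ^ s * (real (l * m) ^ v * real (v * d) ^ s) /
     real (card (marked_tuples (HE m) (MH m) \<tau> {..<s}))) \<longlongrightarrow> 0) F"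
proof (cases "\<exists>q<s. dens (\<tau> q) = 0")
  case True
  then obtain q where q: "q < s" "dens (\<tau> q) = 0" by blast
  have "eventually (\<lambda>m. real m ^ h * real (h * l) ^ s * (real (l * m) ^ v * real (v * d) ^ s) /
     real (card (marked_tuples (HE m) (MH m) \<tau> {..<s})) = 0) F"
    using eventually_S
  proof eventually_elim
    case (elim m)
    have "marked_tuples (HE m) (MH m) \<tau> {..<s} = {}"
      by (rule marked_tuples_empty[of _ q]) (use elim q in auto)
    then show ?case by simp
  qed
  then show ?thesis by (rule tendsto_eventually)
next
  case False
  then have nz: "(\<Prod>q<s. real l * dens (\<tau> q)) \<noteq> 0" using l by auto
  let ?C = "real (h * l) ^ s * (real l ^ v * real (v * d) ^ s)"
  have "((\<lambda>m. inverse (real m) ^ (s - (h + v))) \<longlongrightarrow> 0 ^ (s - (h + v))) F"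
    using filterlim_real by (intro tendsto_power tendsto_inverse_0_at_top)
  moreover have "(0 :: real) ^ (s - (h + v)) = 0" using hv by simp
  ultimately have inv0: "((\<lambda>m. inverse (real m) ^ (s - (h + v))) \<longlongrightarrow> 0) F" by (simp only:)
  have "((\<lambda>m. ?C * inverse (real m) ^ (s - (h + v)) / (real (card (marked_tuples (HE m) (MH m) \<tau> {..<s})) / real m ^ card {..<s}))
      \<longlongrightarrow> ?C * 0 / (\<Prod>q<s. real l * dens (\<tau> q))) F"
    by (intro tendsto_divide tendsto_mult tendsto_const inv0 marked_tuples_tendsto nz) simp
  then have "((\<lambda>m. ?C * inverse (real m) ^ (s - (h + v)) / (real (card (marked_tuples (HE m) (MH m) \<tau> {..<s})) / real m ^ s))
      \<longlongrightarrow> 0) F" by simp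
  then show ?thesis
  proof (rule Lim_transform_eventually)
    show "eventually (\<lambda>m. ?C * inverse (real m) ^ (s - (h + v)) / (real (card (marked_tuples (HE m) (MH m) \<tau> {..<s})) / real m ^ s) =
      real m ^ h * real (h * l) ^ s * (real (l * m) ^ v * real (v * d) ^ s) / real (card (marked_tuples (HE m) (MH m) \<tau> {..<s}))) F"
      using eventually_S
    proof eventually_elim
      case (elim m)
      have "real m ^ s = real m ^ (s - (h + v)) * (real m ^ h * real m ^ v)"
        using hv by (simp flip: power_add)
      then have "inverse (real m) ^ (s - (h + v)) * real m ^ s = real m ^ h * real m ^ v"
        using elim by (simp add: power_inverse)
      then have "?C * (inverse (real m) ^ (s - (h + v)) * real m ^ s) = real m ^ h * real (h * l) ^ s * (real (l * m) ^ v * real (v * d) ^ s)"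
        by (simp add: power_mult_distrib mult_ac)
      then show ?case by (simp add: mult.assoc)
    qed
  qed
qed

lemma avg_bad_tendsto_0: "((\<lambda>m. avg (\<Omega> m) (\<lambda>G. real (card (planted.bad l m R G)))) \<longlongrightarrow> 0) F"
proof (rule tendsto_sandwich[of "\<lambda>_. 0"])
  let ?b = "\<lambda>m s h v \<tau>. real m ^ h * real (h * l) ^ s * (real (l * m) ^ v * real (v * d) ^ s) / real (card (marked_tuples (HE m) (MH m) \<tau> {..<s}))"
  have "((\<lambda>m. \<Sum>s\<le>R. \<Sum>h<s. \<Sum>v<s - h. \<Sum>\<tau>\<in>{..<s} \<rightarrow>\<^sub>E UNIV. ?b m s h v \<tau>)
     \<longlongrightarrow> (\<Sum>s\<le>R. \<Sum>h<s. \<Sum>v<s - h. \<Sum>\<tau>\<in>{..<s} \<rightarrow>\<^sub>E (UNIV :: bool set). 0)) F"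
    by (intro tendsto_sum few_tendsto_0) auto
  then show "((\<lambda>m. \<Sum>s\<le>R. \<Sum>h<s. \<Sum>v<s - h. \<Sum>\<tau>\<in>{..<s} \<rightarrow>\<^sub>E UNIV. ?b m s h v \<tau>) \<longlongrightarrow> 0) F"
    by simp
  show "eventually (\<lambda>m. avg (\<Omega> m) (\<lambda>G. real (card (planted.bad l m R G)))
      \<le> (\<Sum>s\<le>R. \<Sum>h<s. \<Sum>v<s - h. \<Sum>\<tau>\<in>{..<s} \<rightarrow>\<^sub>E UNIV. ?b m s h v \<tau>)) F"
    using eventually_S
  proof eventually_elim
    case (elim m)
    interpret planted d l m "M m" by (rule planted) (use elim in simp)
    have "avg configs (\<lambda>G. real (card (bad R G))) \<le> avg configs (\<lambda>G. \<Sum>s\<le>R. \<Sum>h<s. \<Sum>v<s - h. \<Sum>\<tau>\<in>{..<s} \<rightarrow>\<^sub>E UNIV.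
       real (card (few_hyperedges s h \<inter> few_vertices s v G \<inter> marked_tuples V L \<tau> {..<s})))"
      by (rule avg_mono) (use of_nat_mono[OF card_bad_le, where 'a = real] in simp)
    also have "\<dots> \<le> (\<Sum>s\<le>R. \<Sum>h<s. \<Sum>v<s - h. \<Sum>\<tau>\<in>{..<s} \<rightarrow>\<^sub>E UNIV. ?b m s h v \<tau>)"
      unfolding avg_sum by (intro sum_mono avg_few_le) auto
    finally show ?case .
  qed
qed (auto intro!: always_eventually avg_nonneg)

end

section \<open>Cycles and families of cycles\<close>

definition node_disjoint :: "nat \<Rightarrow> nat set set \<Rightarrow> nat set \<Rightarrow> nat set \<Rightarrow> bool" where
  "node_disjoint l G H H' \<longleftrightarrow> hyperedge_of l ` H \<inter> hyperedge_of l ` H' = {} \<and> cls G ` H \<inter> cls G ` H' = {}"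

text \<open>The bounds say that a and b differ by less than k, so k can divide the difference only
  if it is 0. Stated this way they also cover the range from 1 to k, which a reflection
  needs.\<close>

lemma add_mod_inj:
  fixes r a b k :: nat
  assumes "(r + a) mod k = (r + b) mod k" "a < b + k" "b < a + k"
  shows "a = b"
proof -
  have le: "x = y" if "x \<le> y" "(r + y) mod k = (r + x) mod k" "y < x + k" for x y
  proof -
    have "k dvd y - x" using mod_eq_dvd_iff_nat[of "r + x" "r + y" k] that by simp
    moreover have "y - x < k" using that(1,3) by arith
    ultimately have "y - x = 0" using nat_dvd_not_less[of "y - x" k] by (cases "y - x = 0") simp_all
    then show ?thesis using that(1) by simp
  qed
  show ?thesis
  proof (cases "a \<le> b")
    case True
    show ?thesis by (rule le) (use assms True in simp_all)
  next
    case False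
    have "b = a" by (rule le) (use assms False in simp_all)
    then show ?thesis by simp
  qed
qed

text \<open>Every fibre of \<open>f\<close> has at least two elements, and a single fibre with three
  makes the inequality strict. It is applied to hyperedges and to vertices, giving a degree count
  for a union of cycles.\<close>

lemma card_ge_twice_image:
  fixes W :: "'a set" and f :: "'a \<Rightarrow> 'b"
  assumes W: "finite W" and two: "\<And>x. x \<in> W \<Longrightarrow> \<exists>y\<in>W. y \<noteq> x \<and> f y = f x"
  shows "2 * card (f ` W) \<le> card W"
    and "x \<in> W \<Longrightarrow> y \<in> W \<Longrightarrow> z \<in> W \<Longrightarrow> x \<noteq> y \<Longrightarrow> y \<noteq> z \<Longrightarrow> x \<noteq> z \<Longrightarrow> f x = f y \<Longrightarrow> f y = f z
      \<Longrightarrow> 2 * card (f ` W) < card W"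
proof -
  let ?B = "\<lambda>w. {x \<in> W. f x = w}"
  have eq: "card W = (\<Sum>w\<in>f ` W. card (?B w))"
    using sum.group[OF W finite_imageI[OF W] subset_refl, of "\<lambda>_. 1 :: nat" f] by simp
  have ge: "2 \<le> card (?B w)" if w: "w \<in> f ` W" for w
  proof -
    obtain x where x: "x \<in> W" "w = f x" using w by blast
    obtain y where y: "y \<in> W" "y \<noteq> x" "f y = f x" using two[OF x(1)] by blast
    have "card {x, y} \<le> card (?B w)" using W x y by (intro card_mono) auto
    then show ?thesis using y by simp
  qed
  have c: "2 * card (f ` W) = (\<Sum>w\<in>f ` W. 2)" by simp
  show "2 * card (f ` W) \<le> card W" unfolding c eq by (intro sum_mono ge)
  assume xyz: "x \<in> W" "y \<in> W" "z \<in> W" "x \<noteq> y" "y \<noteq> z" "x \<noteq> z" "f x = f y" "f y = f z"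
  have "card {x, y, z} \<le> card (?B (f x))" using W xyz by (intro card_mono) auto
  then have "2 < card (?B (f x))" using xyz by simp
  then show "2 * card (f ` W) < card W" unfolding c eq
    using W xyz(1) ge by (intro sum_strict_mono_ex1) auto
qed

context planted
begin

definition cycles :: "nat \<Rightarrow> nat set set \<Rightarrow> nat set set" where
  "cycles k G = {H. is_cycle l m G k H}"

abbreviation "ring k G \<equiv> labelled G (rotate_in k) {..<k}"
abbreviation "support k t \<equiv> t ` ({..<k} \<times> (UNIV :: bool set))"

lemma labelledD:
  assumes G: "G \<in> configs" and t: "t \<in> labelled G \<sigma> I"
  shows "t \<in> I \<times> UNIV \<rightarrow>\<^sub>E V" and "inj_on t (I \<times> UNIV)"
    and "q \<in> I \<Longrightarrow> hyperedge_of l (t (q, s)) = hyperedge_of l (t (q, s'))"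
    and "q \<in> I \<Longrightarrow> cls G (t (q, True)) = cls G (t (\<sigma> q, False))"
    and "q \<in> I \<Longrightarrow> q' \<in> I \<Longrightarrow> hyperedge_of l (t (q, s)) = hyperedge_of l (t (q', s')) \<Longrightarrow> q = q'"
    and "q \<in> I \<Longrightarrow> q' \<in> I \<Longrightarrow> cls G (t (q, True)) = cls G (t (q', True)) \<Longrightarrow> q = q'"
proof -
  have t1: "t \<in> H.links id I" "t \<in> blocks.links V (cls G) \<sigma> I" and inj: "inj_on t (I \<times> UNIV)"
    using t by (simp_all add: labelled_def)
  have h: "t \<in> I \<times> UNIV \<rightarrow>\<^sub>E V" "\<forall>q\<in>I. hyperedge_of l (t (q, True)) = hyperedge_of l (t (q, False))"
    "inj_on (\<lambda>q. hyperedge_of l (t (q, True))) I"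
    using t1(1) by (simp_all add: H.links_def)
  have c: "\<forall>q\<in>I. cls G (t (q, True)) = cls G (t (\<sigma> q, False))" "inj_on (\<lambda>q. cls G (t (q, True))) I"
    using t1(2) unfolding links_config[OF G] by simp_all
  show "t \<in> I \<times> UNIV \<rightarrow>\<^sub>E V" "inj_on t (I \<times> UNIV)" by fact+
  show same: "hyperedge_of l (t (q, s)) = hyperedge_of l (t (q, s'))" if "q \<in> I" for q s s'
    using h(2) that by (cases s; cases s') simp_all
  show "q = q'" if "q \<in> I" "q' \<in> I" "hyperedge_of l (t (q, s)) = hyperedge_of l (t (q', s'))"
    using inj_onD[OF h(3), of q q'] same[OF that(1), of s True] same[OF that(2), of s' True] that by simp
  show "q \<in> I \<Longrightarrow> cls G (t (q, True)) = cls G (t (\<sigma> q, False))" using c(1) by blast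
  show "q = q'" if "q \<in> I" "q' \<in> I" "cls G (t (q, True)) = cls G (t (q', True))"
    using inj_onD[OF c(2), of q q'] that by simp
qed

lemma labelledI:
  assumes G: "G \<in> configs" and "t \<in> I \<times> UNIV \<rightarrow>\<^sub>E V" "inj_on t (I \<times> UNIV)"
    and "\<And>q. q \<in> I \<Longrightarrow> hyperedge_of l (t (q, True)) = hyperedge_of l (t (q, False))"
    and "\<And>q. q \<in> I \<Longrightarrow> cls G (t (q, True)) = cls G (t (\<sigma> q, False))"
    and "inj_on (\<lambda>q. hyperedge_of l (t (q, True))) I" "inj_on (\<lambda>q. cls G (t (q, True))) I"
  shows "t \<in> labelled G \<sigma> I"
  using assms(2-) by (simp add: labelled_def H.links_def links_config[OF G])

lemma finite_labelled: "finite I \<Longrightarrow> finite (labelled G \<sigma> I)"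
  by (rule finite_subset[OF _ finite_tuples[of "I \<times> UNIV"]]) (auto simp: labelled_def H.links_def)

text \<open>The dictionary is \<open>a i = t (i, False)\<close> and
  \<open>c i = t (i, True)\<close>: the hyperedge with index i is entered at False and left at True,
  and the vertex \<open>v i\<close> is the class of \<open>t (i, False)\<close>.\<close>

lemma cycles_eq:
  assumes G: "G \<in> configs" and k: "k > 0"
  shows "cycles k G = support k ` ring k G"
proof (intro equalityI subsetI)
  note P = partition[OF G]
  let ?\<sigma> = "rotate_in k"
  fix H assume "H \<in> cycles k G"
  then obtain e v a c where *: "inj_on e {..<k}" "e ` {..<k} \<subseteq> {1..m}" "inj_on v {..<k}" "v ` {..<k} \<subseteq> G"
    and ac: "\<And>i. i < k \<Longrightarrow> a i \<noteq> c i \<and> hyperedge_of l (a i) = e i \<and> hyperedge_of l (c i) = e i \<and> a i \<in> v i \<and> c i \<in> v (Suc i mod k)"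
    and H: "H = a ` {..<k} \<union> c ` {..<k}"
    unfolding cycles_def is_cycle_def by auto
  define t where "t = (\<lambda>x\<in>{..<k} \<times> (UNIV :: bool set). if snd x then c (fst x) else a (fst x))"
  have tF: "t (i, False) = a i" and tT: "t (i, True) = c i" if "i < k" for i using that by (simp_all add: t_def)
  have vG: "v i \<in> G" if "i < k" for i using *(4) that by auto
  have vV: "v i \<subseteq> V" if "i < k" for i using vG[OF that] P by (auto simp: partition_on_def)
  have ca: "cls G (a i) = v i" if "i < k" for i using cls_eq[OF P vG[OF that]] ac[OF that] by blast
  have cc: "cls G (c i) = v (?\<sigma> i)" if "i < k" for i
    using cls_eq[OF P vG[OF rotate_in_less[OF that]]] ac[OF that] unfolding rotate_in_def by blast
  have ee: "hyperedge_of l (t (i, s)) = e i" if "i < k" for i s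
    using ac[OF that] tF[OF that] tT[OF that] by (cases s) simp_all
  have "t \<in> ring k G"
  proof (rule labelledI[OF G])
    show "t \<in> {..<k} \<times> UNIV \<rightarrow>\<^sub>E V"
    proof (rule PiE_I)
      fix x :: "nat \<times> bool" assume x: "x \<in> {..<k} \<times> UNIV"
      then have "fst x < k" by auto
      then have "a (fst x) \<in> V" "c (fst x) \<in> V"
        using ac[of "fst x"] vV[of "fst x"] vV[OF rotate_in_less[of "fst x" k]] unfolding rotate_in_def by blast+
      then show "t x \<in> V" using x by (simp add: t_def)
    qed (simp add: t_def)
    show "inj_on t ({..<k} \<times> UNIV)"
    proof (rule inj_onI)
      fix x y assume xy: "x \<in> {..<k} \<times> (UNIV :: bool set)" "y \<in> {..<k} \<times> (UNIV :: bool set)" "t x = t y"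
      obtain i s j s' where x: "x = (i, s)" "y = (j, s')" by (metis surj_pair)
      have ij: "i < k" "j < k" using xy x by auto
      have "e i = e j" using ee[OF ij(1), of s] ee[OF ij(2), of s'] xy(3) x by simp
      then have "i = j" using *(1) ij by (auto dest: inj_onD)
      moreover have "s = s'" using xy(3) x \<open>i = j\<close> tF[OF ij(1)] tT[OF ij(1)] ac[OF ij(1)] by (cases s; cases s') auto
      ultimately show "x = y" using x by simp
    qed
    show "hyperedge_of l (t (q, True)) = hyperedge_of l (t (q, False))" if "q \<in> {..<k}" for q
      using ee that by simp
    show "cls G (t (q, True)) = cls G (t (?\<sigma> q, False))" if "q \<in> {..<k}" for q
      using that tT tF cc ca rotate_in_less by simp
    show "inj_on (\<lambda>q. hyperedge_of l (t (q, True))) {..<k}"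
      using *(1) ee by (simp add: inj_on_def)
    have "inj_on (v \<circ> ?\<sigma>) {..<k}"
      using bij_betw_rotate_in[of k] *(3) by (intro comp_inj_on) (auto simp: bij_betw_def)
    then show "inj_on (\<lambda>q. cls G (t (q, True))) {..<k}"
      using tT cc by (simp add: inj_on_def)
  qed
  moreover have "support k t = H"
  proof -
    have "{..<k} \<times> (UNIV :: bool set) = (\<lambda>i. (i, False)) ` {..<k} \<union> (\<lambda>i. (i, True)) ` {..<k}"
      by (auto simp: image_iff)
    then show ?thesis unfolding H by (simp only: image_Un image_image) (simp add: tF tT)
  qed
  ultimately show "H \<in> support k ` ring k G" by blast
next
  note P = partition[OF G]
  let ?\<sigma> = "rotate_in k"
  fix H assume "H \<in> support k ` ring k G"
  then obtain t where t: "t \<in> ring k G" and H: "H = support k t" by blast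
  note D = labelledD[OF G t]
  have tV: "t (i, s) \<in> V" if "i < k" for i s by (rule PiE_mem[OF D(1)]) (use that in simp)
  define v where "v i = cls G (t (i, False))" for i
  have "is_cycle l m G k H"
    unfolding is_cycle_def
  proof (intro conjI exI allI impI)
    show "1 \<le> k" using k by simp
    show "inj_on (\<lambda>i. hyperedge_of l (t (i, False))) {..<k}" using D(5) by (auto simp: inj_on_def)
    show "(\<lambda>i. hyperedge_of l (t (i, False))) ` {..<k} \<subseteq> {1..m}"
      using hyperedge_of_in[OF tV] by blast
    show "v ` {..<k} \<subseteq> G" using cls_in(1)[OF P tV] by (auto simp: v_def)
    show "inj_on v {..<k}"
    proof (rule inj_onI)
      fix i j assume ij: "i \<in> {..<k}" "j \<in> {..<k}" "v i = v j"
      obtain i' j' where ij': "i' < k" "j' < k" "i = ?\<sigma> i'" "j = ?\<sigma> j'"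
        using ij(1,2) bij_betw_rotate_in[of k] unfolding bij_betw_def by blast
      then have "i' = j'" using D(6)[of i' j'] D(4)[of i'] D(4)[of j'] ij(3) by (simp add: v_def)
      then show "i = j" using ij' by simp
    qed
    fix i assume i: "i < k"
    show "t (i, False) \<noteq> t (i, True)" using inj_onD[OF D(2), of "(i, False)" "(i, True)"] i by auto
    show "hyperedge_of l (t (i, True)) = hyperedge_of l (t (i, False))" using D(3) i by blast
    show "t (i, False) \<in> v i" using cls_in(2)[OF P tV[OF i]] by (simp add: v_def)
    show "t (i, True) \<in> v (Suc i mod k)"
      using cls_in(2)[OF P tV[OF i], of True] D(4)[of i] i by (simp add: v_def rotate_in_def)
  next
    have "{..<k} \<times> (UNIV :: bool set) = (\<lambda>i. (i, False)) ` {..<k} \<union> (\<lambda>i. (i, True)) ` {..<k}"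
      by (auto simp: image_iff)
    then show "H = (\<lambda>i. t (i, False)) ` {..<k} \<union> (\<lambda>i. t (i, True)) ` {..<k}"
      unfolding H by (simp only: image_Un image_image)
  qed simp
  then show "H \<in> cycles k G" by (simp add: cycles_def)
qed

text \<open>Each node of a cycle is incident to exactly two of its half-edges, so a half-edge
  determines its partner at either of its nodes.\<close>

lemma ring_partner:
  assumes G: "G \<in> configs" and t: "t \<in> ring k G" and i: "i < k" and y: "y \<in> support k t"
  shows "hyperedge_of l y = hyperedge_of l (t (i, s)) \<Longrightarrow> y \<noteq> t (i, s) \<Longrightarrow> y = t (i, \<not> s)"
    and "cls G y = cls G (t (i, True)) \<Longrightarrow> y \<noteq> t (i, True) \<Longrightarrow> y = t (rotate_in k i, False)"
proof -
  note D = labelledD[OF G t]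
  obtain j s' where j: "j < k" "y = t (j, s')" using y by auto
  show "y = t (i, \<not> s)" if "hyperedge_of l y = hyperedge_of l (t (i, s))" "y \<noteq> t (i, s)"
  proof -
    have "j = i" using D(5)[of j i s' s] j i that(1) by simp
    then show ?thesis using that(2) j by (cases s; cases s') simp_all
  qed
  show "y = t (rotate_in k i, False)" if c: "cls G y = cls G (t (i, True))" "y \<noteq> t (i, True)"
  proof (cases s')
    case True
    then have "j = i" using D(6)[of j i] j i c(1) by simp
    then show ?thesis using True c(2) j by simp
  next
    case False
    obtain j' where j': "j' < k" "j = rotate_in k j'"
      using j(1) bij_betw_rotate_in[of k] unfolding bij_betw_def by blast
    then have "j' = i" using D(6)[of j' i] D(4)[of j'] i j c(1) False by simp
    then show ?thesis using False j j' by simp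
  qed
qed

text \<open>After the first half-edge the traversal is forced: partners at hyperedges and at
  vertices are taken alternately, and they depend on the support only.\<close>

lemma ring_determined:
  assumes G: "G \<in> configs" and t: "t \<in> ring k G" "t' \<in> ring k G" and supp: "support k t = support k t'"
    and k: "k > 0" and start: "t (0, False) = t' (0, False)"
  shows "t = t'"
proof -
  note D = labelledD[OF G t(1)] and D' = labelledD[OF G t(2)]
  have step1: "t (i, True) = t' (i, True)" if i: "i < k" and eq: "t (i, False) = t' (i, False)" for i
  proof -
    have "t' (i, True) \<in> support k t" using i unfolding supp by blast
    moreover have "hyperedge_of l (t' (i, True)) = hyperedge_of l (t (i, False))" using D'(3)[of i True False] i eq by simp
    moreover have "t' (i, True) \<noteq> t (i, False)" unfolding eq using inj_onD[OF D'(2), of "(i, True)" "(i, False)"] i by auto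
    ultimately show ?thesis using ring_partner(1)[OF G t(1) i, of "t' (i, True)" False] by simp
  qed
  have step2: "t (rotate_in k i, False) = t' (rotate_in k i, False)" if i: "i < k" and eq: "t (i, True) = t' (i, True)" for i
  proof -
    have ri: "rotate_in k i < k" using i by (rule rotate_in_less)
    have "t' (rotate_in k i, False) \<in> support k t" using ri unfolding supp by blast
    moreover have "cls G (t' (rotate_in k i, False)) = cls G (t (i, True))" using D'(4)[of i] i eq by simp
    moreover have "t' (rotate_in k i, False) \<noteq> t (i, True)" unfolding eq
      using inj_onD[OF D'(2), of "(rotate_in k i, False)" "(i, True)"] i ri by auto
    ultimately show ?thesis using ring_partner(2)[OF G t(1) i, of "t' (rotate_in k i, False)"] by simp
  qed
  have F: "i < k \<Longrightarrow> t (i, False) = t' (i, False)" for i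
  proof (induction i)
    case 0
    show ?case by (rule start)
  next
    case (Suc i)
    then have "t (rotate_in k i, False) = t' (rotate_in k i, False)" using step1[of i] step2[of i] by simp
    then show ?case using Suc.prems by (simp add: rotate_in_def)
  qed
  show ?thesis
  proof (rule PiE_ext[OF D(1) D'(1)])
    fix x assume "x \<in> {..<k} \<times> (UNIV :: bool set)"
    then obtain i s where "x = (i, s)" "i < k" by auto
    then show "t x = t' x" using F[of i] step1[of i] by (cases s) simp_all
  qed
qed

text \<open>The dihedral group acts on the labelled cycles; \<open>flip\<close> singles out the reflections.\<close>

lemma ring_reindex:
  assumes G: "G \<in> configs" and t: "t \<in> ring k G" and \<rho>: "bij_betw \<rho> {..<k} {..<k}"
    and comm: "\<And>i. i < k \<Longrightarrow> \<not> flip \<Longrightarrow> rotate_in k (\<rho> i) = \<rho> (rotate_in k i)"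
    and anti: "\<And>i. i < k \<Longrightarrow> flip \<Longrightarrow> rotate_in k (\<rho> (rotate_in k i)) = \<rho> i"
  defines "t' \<equiv> \<lambda>x\<in>{..<k} \<times> UNIV. t (\<rho> (fst x), snd x \<noteq> flip)"
  shows "t' \<in> ring k G" and "support k t' = support k t"
proof -
  note D = labelledD[OF G t]
  have \<rho>k: "\<rho> i < k" if "i < k" for i using bij_betwE[OF \<rho>] that by simp
  have \<rho>inj: "i = j" if "\<rho> i = \<rho> j" "i < k" "j < k" for i j
    using \<rho> that by (auto simp: bij_betw_def dest: inj_onD)
  have t': "t' (i, s) = t (\<rho> i, s \<noteq> flip)" if "i < k" for i s using that by (simp add: t'_def)
  have tV: "t (i, s) \<in> V" if "i < k" for i s by (rule PiE_mem[OF D(1)]) (use that in simp)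
  show "t' \<in> ring k G"
  proof (rule labelledI[OF G])
    show "t' \<in> {..<k} \<times> UNIV \<rightarrow>\<^sub>E V"
    proof (rule PiE_I)
      fix x :: "nat \<times> bool" assume "x \<in> {..<k} \<times> UNIV"
      then show "t' x \<in> V" using tV \<rho>k by (auto simp: t'_def)
    qed (simp add: t'_def)
    show "inj_on t' ({..<k} \<times> UNIV)"
    proof (rule inj_onI)
      fix x y assume xy: "x \<in> {..<k} \<times> (UNIV :: bool set)" "y \<in> {..<k} \<times> (UNIV :: bool set)" "t' x = t' y"
      obtain i s j s' where x: "x = (i, s)" "y = (j, s')" by (metis surj_pair)
      have ij: "i < k" "j < k" using xy x by auto
      have "(\<rho> i, s \<noteq> flip) = (\<rho> j, s' \<noteq> flip)"
        by (rule inj_onD[OF D(2)]) (use xy(3) x ij t' \<rho>k in simp_all)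
      then show "x = y" using x ij \<rho>inj by auto
    qed
    show "hyperedge_of l (t' (q, True)) = hyperedge_of l (t' (q, False))" if "q \<in> {..<k}" for q
    proof -
      have q: "q < k" using that by simp
      show ?thesis unfolding t'[OF q] by (rule D(3)) (simp add: \<rho>k[OF q])
    qed
    show "inj_on (\<lambda>q. hyperedge_of l (t' (q, True))) {..<k}"
    proof (rule inj_onI)
      fix i j assume ij: "i \<in> {..<k}" "j \<in> {..<k}" and eq: "hyperedge_of l (t' (i, True)) = hyperedge_of l (t' (j, True))"
      then have "i < k" "j < k" by simp_all
      then have "\<rho> i = \<rho> j" using D(5)[of "\<rho> i" "\<rho> j"] eq \<rho>k t' by simp
      then show "i = j" using \<rho>inj ij by simp
    qed
    show "cls G (t' (q, True)) = cls G (t' (rotate_in k q, False))" if "q \<in> {..<k}" for q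
    proof -
      have q: "q < k" using that by simp
      have rq: "rotate_in k q < k" by (rule rotate_in_less[OF q])
      show ?thesis
      proof (cases flip)
        case False
        then show ?thesis using D(4)[of "\<rho> q"] \<rho>k[OF q] comm[OF q] t'[OF q] t'[OF rq] by simp
      next
        \<comment> \<open>A reflection exchanges the two half-edges of every hyperedge, so this is
          the link of \<open>t\<close> at \<open>\<rho> (rotate_in k q)\<close>, read
          backwards.\<close>
        case True
        then show ?thesis using D(4)[of "\<rho> (rotate_in k q)"] \<rho>k[OF rq] anti[OF q] t'[OF q] t'[OF rq] by simp
      qed
    qed
    show "inj_on (\<lambda>q. cls G (t' (q, True))) {..<k}"
    proof (rule inj_onI)
      fix i j assume "i \<in> {..<k}" "j \<in> {..<k}" and eq: "cls G (t' (i, True)) = cls G (t' (j, True))"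
      then have ij: "i < k" "j < k" by simp_all
      have "\<rho> i = \<rho> j"
      proof (cases flip)
        case False
        then show ?thesis using D(6)[of "\<rho> i" "\<rho> j"] eq \<rho>k ij t' by simp
      next
        case True
        have ri: "rotate_in k i < k" "rotate_in k j < k" using ij rotate_in_less by auto
        have "cls G (t (\<rho> (rotate_in k i), True)) = cls G (t (\<rho> (rotate_in k j), True))"
          using D(4)[of "\<rho> (rotate_in k i)"] D(4)[of "\<rho> (rotate_in k j)"] \<rho>k[OF ri(1)] \<rho>k[OF ri(2)] anti[OF ij(1) True] anti[OF ij(2) True]
            eq t'[OF ij(1)] t'[OF ij(2)] True by simp
        then have "\<rho> (rotate_in k i) = \<rho> (rotate_in k j)" using D(6) \<rho>k[OF ri(1)] \<rho>k[OF ri(2)] by simp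
        then show ?thesis using anti[OF ij(1) True] anti[OF ij(2) True] by simp
      qed
      then show "i = j" using \<rho>inj ij by simp
    qed
  qed
  show "support k t' = support k t"
  proof -
    have "bij_betw (\<lambda>x. (\<rho> (fst x), snd x \<noteq> flip)) ({..<k} \<times> UNIV) ({..<k} \<times> (UNIV :: bool set))"
    proof -
      have "inj_on (\<lambda>x. (\<rho> (fst x), snd x \<noteq> flip)) ({..<k} \<times> (UNIV :: bool set))"
        using \<rho>inj by (auto simp: inj_on_def)
      moreover have "(\<lambda>x. (\<rho> (fst x), snd x \<noteq> flip)) ` ({..<k} \<times> (UNIV :: bool set)) \<subseteq> {..<k} \<times> UNIV"
        using \<rho>k by auto
      ultimately show ?thesis by (simp add: bij_betw_def endo_inj_surj)
    qed
    then have "support k t = t ` (\<lambda>x. (\<rho> (fst x), snd x \<noteq> flip)) ` ({..<k} \<times> (UNIV :: bool set))"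
      by (simp only: bij_betw_def)
    also have "\<dots> = support k t'" unfolding image_image by (intro image_cong refl) (simp add: t'_def)
    finally show ?thesis by simp
  qed
qed

lemma card_support: "G \<in> configs \<Longrightarrow> t \<in> ring k G \<Longrightarrow> card (support k t) = 2 * k"
  using labelledD(2)[of G t] by (simp add: card_image card_cartesian_product)

text \<open>A labelling is determined by its first half-edge \<open>t (0, False)\<close>, and each
  of the 2 k half-edges of the cycle occurs as such. This covers k = 1, where the two labellings
  differ by exchanging the two half-edges.\<close>

lemma card_ring_fibre:
  assumes G: "G \<in> configs" and k: "k > 0" and H: "H \<in> cycles k G"
  shows "card {t \<in> ring k G. support k t = H} = 2 * k"
proof -
  obtain t where t: "t \<in> ring k G" "H = support k t" using H unfolding cycles_eq[OF G k] by blast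
  have "bij_betw (\<lambda>t. t (0, False)) {t \<in> ring k G. support k t = H} H"
    unfolding bij_betw_def
  proof
    show "inj_on (\<lambda>t. t (0, False)) {t \<in> ring k G. support k t = H}"
      using ring_determined[OF G _ _ _ k] by (intro inj_onI) auto
    show "(\<lambda>t. t (0, False)) ` {t \<in> ring k G. support k t = H} = H"
    proof (intro equalityI subsetI)
      fix x assume "x \<in> (\<lambda>t. t (0, False)) ` {t \<in> ring k G. support k t = H}"
      then show "x \<in> H" using k by auto
    next
      fix x assume "x \<in> H"
      then obtain r s where x: "r < k" "x = t (r, s)" using t(2) by auto
      have shift: "(r + i) mod k = (if r + i < k then r + i else r + i - k)" if "i \<le> k" for i
        using x(1) that by (auto simp: mod_if)
      \<comment> \<open>If \<open>x = t (r, False)\<close>, start at r and go forward; if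
        \<open>x = t (r, True)\<close>, start at r and go backward. Writing r + (k - i) instead of r
        - i avoids truncated subtraction.\<close>
      define \<rho> where "\<rho> i = (if s then (r + (k - i)) mod k else (r + i) mod k)" for i
      have bij: "bij_betw \<rho> {..<k} {..<k}"
      proof -
        have "inj_on \<rho> {..<k}"
        proof (rule inj_onI)
          fix i j assume ij: "i \<in> {..<k}" "j \<in> {..<k}" "\<rho> i = \<rho> j"
          show "i = j"
          proof (cases s)
            case True
            have "k - i = k - j"
              by (rule add_mod_inj[of r "k - i" k "k - j"]) (use ij True in \<open>auto simp: \<rho>_def\<close>)
            then show ?thesis using ij by auto
          next
            case False
            show ?thesis by (rule add_mod_inj[of r i k j]) (use ij False in \<open>auto simp: \<rho>_def\<close>)
          qed
        qed
        moreover have "\<rho> ` {..<k} \<subseteq> {..<k}" using k by (auto simp: \<rho>_def)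
        ultimately show ?thesis by (simp add: bij_betw_def endo_inj_surj)
      qed
      have comm: "rotate_in k (\<rho> i) = \<rho> (rotate_in k i)" if "i < k" "\<not> s" for i
        using that by (simp add: \<rho>_def rotate_in_def mod_simps)
      have anti: "rotate_in k (\<rho> (rotate_in k i)) = \<rho> i" if "i < k" "s" for i
      \<comment> \<open>At the last index the rotation returns to 0, where the reflection uses k - 0
        instead of k - Suc i; the two agree modulo k.\<close>
      proof (cases "Suc i = k")
        case True
        then have "r + (k - i) = Suc r" by simp
        then show ?thesis using True that by (simp add: \<rho>_def rotate_in_def mod_simps)
      next
        case False
        then have "Suc (r + (k - Suc i)) = r + (k - i)" "Suc i < k" using that by simp_all
        then show ?thesis using that by (simp add: \<rho>_def rotate_in_def mod_simps)
      qed
      let ?t = "\<lambda>y\<in>{..<k} \<times> UNIV. t (\<rho> (fst y), snd y \<noteq> s)"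
      have tH: "?t \<in> {t \<in> ring k G. support k t = H}"
        using ring_reindex[OF G t(1) bij comm anti] t(2) by simp
      have x0: "x = ?t (0, False)"
        using k x shift[of 0] by (simp add: \<rho>_def)
      show "x \<in> (\<lambda>t. t (0, False)) ` {t \<in> ring k G. support k t = H}"
        by (rule image_eqI[where x = ?t]) (rule x0, rule tH)
    qed
  qed
  then have "card {t \<in> ring k G. support k t = H} = card H" by (rule bij_betw_same_card)
  also have "\<dots> = 2 * k" using card_support[OF G t(1)] t(2) by simp
  finally show ?thesis .
qed

section \<open>Families of node-disjoint cycles and their labellings\<close>

definition families :: "'j set \<Rightarrow> ('j \<Rightarrow> nat) \<Rightarrow> nat set set \<Rightarrow> ('j \<Rightarrow> nat set) set" where
  "families J len G = {H \<in> PiE J (\<lambda>j. cycles (len j) G). \<forall>i\<in>J. \<forall>j\<in>J. i \<noteq> j \<longrightarrow> node_disjoint l G (H i) (H j)}"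

text \<open>Distinctness of vertices is recorded at the half-edges \<open>t (q, True)\<close> only.
  Since every vertex of the cycle carries one of them, any comparison of vertices can be moved
  there.\<close>

lemma ring_cls_True:
  assumes G: "G \<in> configs" and t: "t \<in> ring k G" and i: "i < k"
  shows "\<exists>i'<k. cls G (t (i, s)) = cls G (t (i', True))"
proof (cases s)
  case True
  then show ?thesis using i by auto
next
  case False
  obtain i' where i': "i' < k" "i = rotate_in k i'"
    using i bij_betw_rotate_in[of k] unfolding bij_betw_def by blast
  then show ?thesis using labelledD(4)[OF G t, of i'] False by (intro exI[of _ i']) simp
qed

lemma labelled_family_component:
  assumes G: "G \<in> configs" and t: "t \<in> labelled G (rotate_family len) (SIGMA j:J. {..<len j})" and j: "j \<in> J"
  shows "(\<lambda>x\<in>{..<len j} \<times> UNIV. t ((j, fst x), snd x)) \<in> ring (len j) G" (is "?u \<in> _")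
proof (rule labelledI[OF G])
  note D = labelledD[OF G t]
  have u: "?u (i, s) = t ((j, i), s)" if "i < len j" for i s using that by simp
  have I: "(j, i) \<in> (SIGMA j:J. {..<len j})" if "i < len j" for i using that j by simp
  show "?u \<in> {..<len j} \<times> UNIV \<rightarrow>\<^sub>E V"
  proof (rule PiE_I)
    fix x :: "nat \<times> bool" assume x: "x \<in> {..<len j} \<times> UNIV"
    have "t ((j, fst x), snd x) \<in> V" by (rule PiE_mem[OF D(1)]) (use x I in auto)
    then show "?u x \<in> V" using x by simp
  qed simp
  show "inj_on ?u ({..<len j} \<times> UNIV)"
  proof (rule inj_onI)
    fix x y assume xy: "x \<in> {..<len j} \<times> (UNIV :: bool set)" "y \<in> {..<len j} \<times> (UNIV :: bool set)" "?u x = ?u y"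
    have "((j, fst x), snd x) = ((j, fst y), snd y)"
      by (rule inj_onD[OF D(2)]) (use xy I in auto)
    then show "x = y" by (simp add: prod_eq_iff)
  qed
  show "hyperedge_of l (?u (q, True)) = hyperedge_of l (?u (q, False))" if "q \<in> {..<len j}" for q
    using D(3)[OF I, of q] that by simp
  show "cls G (?u (q, True)) = cls G (?u (rotate_in (len j) q, False))" if "q \<in> {..<len j}" for q
    using D(4)[OF I, of q] that rotate_in_less[of q "len j"] by (simp add: rotate_family_def)
  show "inj_on (\<lambda>q. hyperedge_of l (?u (q, True))) {..<len j}"
  proof (rule inj_onI)
    fix q q' assume "q \<in> {..<len j}" "q' \<in> {..<len j}" "hyperedge_of l (?u (q, True)) = hyperedge_of l (?u (q', True))"
    then have "(j, q) = (j, q')" using D(5)[OF I I, of q q' True True] by simp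
    then show "q = q'" by simp
  qed
  show "inj_on (\<lambda>q. cls G (?u (q, True))) {..<len j}"
  proof (rule inj_onI)
    fix q q' assume "q \<in> {..<len j}" "q' \<in> {..<len j}" "cls G (?u (q, True)) = cls G (?u (q', True))"
    then have "(j, q) = (j, q')" using D(6)[OF I I, of q q'] by simp
    then show "q = q'" by simp
  qed
qed

lemma labelled_family_node_disjoint:
  assumes G: "G \<in> configs" and t: "t \<in> labelled G (rotate_family len) (SIGMA j:J. {..<len j})"
    and ij: "i \<in> J" "j \<in> J" "i \<noteq> j"
  shows "node_disjoint l G (support (len i) (\<lambda>x\<in>{..<len i} \<times> UNIV. t ((i, fst x), snd x)))
    (support (len j) (\<lambda>x\<in>{..<len j} \<times> UNIV. t ((j, fst x), snd x)))"
proof -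
  note D = labelledD[OF G t]
  let ?u = "\<lambda>j. \<lambda>x\<in>{..<len j} \<times> UNIV. t ((j, fst x), snd x)"
  have I: "(j, q) \<in> (SIGMA j:J. {..<len j})" if "j \<in> J" "q < len j" for j q using that by simp
  have False if "q < len i" "q' < len j" "hyperedge_of l (?u i (q, s)) = hyperedge_of l (?u j (q', s'))" for q q' s s'
    using D(5)[OF I[OF ij(1) that(1)] I[OF ij(2) that(2)], of s s'] that ij(3) by simp
  moreover have False if q: "q < len i" "q' < len j" "cls G (?u i (q, s)) = cls G (?u j (q', s'))" for q q' s s'
  proof -
    obtain p where p: "p < len i" "cls G (?u i (q, s)) = cls G (?u i (p, True))"
      using ring_cls_True[OF G labelled_family_component[OF G t ij(1)] q(1)] by blast
    obtain p' where p': "p' < len j" "cls G (?u j (q', s')) = cls G (?u j (p', True))"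
      using ring_cls_True[OF G labelled_family_component[OF G t ij(2)] q(2)] by blast
    have "cls G (t ((i, p), True)) = cls G (t ((j, p'), True))"
      using p p' q(3) by simp
    then show False using D(6)[OF I[OF ij(1) p(1)] I[OF ij(2) p'(1)]] ij(3) by simp
  qed
  ultimately show ?thesis unfolding node_disjoint_def
    by (intro conjI equals0I) (elim IntE imageE; clarsimp; metis)+
qed

lemma labelled_family_combine:
  assumes G: "G \<in> configs" and u: "u \<in> PiE J (\<lambda>j. ring (len j) G)"
    and disj: "\<And>i j. i \<in> J \<Longrightarrow> j \<in> J \<Longrightarrow> i \<noteq> j \<Longrightarrow> node_disjoint l G (support (len i) (u i)) (support (len j) (u j))"
  shows "(\<lambda>y\<in>(SIGMA j:J. {..<len j}) \<times> UNIV. u (fst (fst y)) (snd (fst y), snd y))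
    \<in> labelled G (rotate_family len) (SIGMA j:J. {..<len j})" (is "?t \<in> _")
proof (rule labelledI[OF G])
  let ?I = "SIGMA j:J. {..<len j}"
  have uj: "u j \<in> ring (len j) G" if "j \<in> J" for j using u that by (rule PiE_mem)
  note D = labelledD[OF G uj]
  have t: "?t (q, s) = u (fst q) (snd q, s)" if "q \<in> ?I" for q s using that by simp
  have q: "fst q \<in> J" "snd q < len (fst q)" if "q \<in> ?I" for q using that by auto
  have mem: "u (fst q) (snd q, s) \<in> support (len (fst q)) (u (fst q))" if "q \<in> ?I" for q s
    using q(2)[OF that] by blast
  \<comment> \<open>Node-disjointness confines every coincidence of hyperedges or vertices to one
    cycle, where the conditions on that cycle alone apply.\<close>
  have same: "fst q = fst q'" if qq: "q \<in> ?I" "q' \<in> ?I" and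
    "hyperedge_of l (?t (q, s)) = hyperedge_of l (?t (q', s')) \<or> cls G (?t (q, s)) = cls G (?t (q', s'))" for q q' s s'
  proof (rule ccontr)
    assume "fst q \<noteq> fst q'"
    then have "node_disjoint l G (support (len (fst q)) (u (fst q))) (support (len (fst q')) (u (fst q')))"
      using q qq by (intro disj)
    moreover have "hyperedge_of l (u (fst q) (snd q, s)) = hyperedge_of l (u (fst q') (snd q', s')) \<or>
        cls G (u (fst q) (snd q, s)) = cls G (u (fst q') (snd q', s'))"
      using that(3) t[OF qq(1)] t[OF qq(2)] by simp
    ultimately show False using mem[OF qq(1), of s] mem[OF qq(2), of s'] unfolding node_disjoint_def by blast
  qed
  show "?t \<in> ?I \<times> UNIV \<rightarrow>\<^sub>E V"
  proof (rule PiE_I)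
    fix y :: "('a \<times> nat) \<times> bool" assume y: "y \<in> ?I \<times> UNIV"
    then have yI: "fst y \<in> ?I" by auto
    have "u (fst (fst y)) (snd (fst y), snd y) \<in> V"
      by (rule PiE_mem[OF D(1)[OF q(1)[OF yI]]]) (use q(2)[OF yI] in simp)
    then show "?t y \<in> V" using y by simp
  qed simp
  show "inj_on ?t (?I \<times> UNIV)"
  proof (rule inj_onI)
    fix x y assume xy: "x \<in> ?I \<times> (UNIV :: bool set)" "y \<in> ?I \<times> (UNIV :: bool set)" "?t x = ?t y"
    obtain p s p' s' where x: "x = (p, s)" "y = (p', s')" by (metis surj_pair)
    have pI: "p \<in> ?I" "p' \<in> ?I" using xy x by auto
    have f: "fst p = fst p'" using same[OF pI, of s s'] xy(3) x by simp
    have "(snd p, s) = (snd p', s')"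
      by (rule inj_onD[OF D(2)[OF q(1)[OF pI(1)]]]) (use xy(3) x t[OF pI(1)] t[OF pI(2)] f q(2)[OF pI(1)] q(2)[OF pI(2)] in simp_all)
    then show "x = y" using x f by (simp add: prod_eq_iff)
  qed
  show "hyperedge_of l (?t (p, True)) = hyperedge_of l (?t (p, False))" if "p \<in> ?I" for p
    unfolding t[OF that] by (rule D(3)[OF q(1)[OF that]]) (use q(2)[OF that] in simp)
  show "cls G (?t (p, True)) = cls G (?t (rotate_family len p, False))" if p: "p \<in> ?I" for p
  proof -
    have "rotate_family len p \<in> ?I" using q[OF p] rotate_in_less by (simp add: rotate_family_def)
    then show ?thesis unfolding t[OF p] t[OF \<open>rotate_family len p \<in> ?I\<close>]
      using D(4)[OF q(1)[OF p], of "snd p"] q(2)[OF p] by (simp add: rotate_family_def)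
  qed
  show "inj_on (\<lambda>q. hyperedge_of l (?t (q, True))) ?I"
  proof (rule inj_onI)
    fix p p' assume p: "p \<in> ?I" "p' \<in> ?I" "hyperedge_of l (?t (p, True)) = hyperedge_of l (?t (p', True))"
    then have f: "fst p = fst p'" using same[OF p(1,2), of True True] by blast
    have "snd p = snd p'"
      by (rule D(5)[OF q(1)[OF p(1)], of _ _ True True]) (use p(3) t[OF p(1)] t[OF p(2)] f q(2)[OF p(1)] q(2)[OF p(2)] in simp_all)
    then show "p = p'" using f by (simp add: prod_eq_iff)
  qed
  show "inj_on (\<lambda>q. cls G (?t (q, True))) ?I"
  proof (rule inj_onI)
    fix p p' assume p: "p \<in> ?I" "p' \<in> ?I" "cls G (?t (p, True)) = cls G (?t (p', True))"
    then have f: "fst p = fst p'" using same[OF p(1,2), of True True] by blast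
    have "snd p = snd p'"
      by (rule D(6)[OF q(1)[OF p(1)]]) (use p(3) t[OF p(1)] t[OF p(2)] f q(2)[OF p(1)] q(2)[OF p(2)] in simp_all)
    then show "p = p'" using f by (simp add: prod_eq_iff)
  qed
qed

lemma finite_cycles: "G \<in> configs \<Longrightarrow> k > 0 \<Longrightarrow> finite (cycles k G)"
  unfolding cycles_eq by (intro finite_imageI finite_labelled) simp

text \<open>A labelled family is a tuple of labelled cycles whose supports are pairwise
  node-disjoint. As disjointness depends on the supports only, each cycle can be labelled
  independently, in 2 k ways for length k.\<close>

lemma card_labelled_family:
  assumes G: "G \<in> configs" and J: "finite J" and len: "\<And>j. j \<in> J \<Longrightarrow> len j > 0"
  shows "card (labelled G (rotate_family len) (SIGMA j:J. {..<len j})) = (\<Prod>j\<in>J. 2 * len j) * card (families J len G)"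
proof -
  let ?I = "SIGMA j:J. {..<len j}"
  let ?L = "labelled G (rotate_family len) ?I"
  let ?U = "{u \<in> PiE J (\<lambda>j. ring (len j) G). \<forall>i\<in>J. \<forall>j\<in>J. i \<noteq> j \<longrightarrow> node_disjoint l G (support (len i) (u i)) (support (len j) (u j))}"
  let ?to = "\<lambda>t. \<lambda>j\<in>J. \<lambda>x\<in>{..<len j} \<times> UNIV. t ((j, fst x), snd x)"
  let ?from = "\<lambda>u. \<lambda>y\<in>?I \<times> UNIV. u (fst (fst y)) (snd (fst y), snd y)"
  have "bij_betw ?to ?L ?U"
  proof (rule bij_betw_byWitness[where f' = ?from])
    show "\<forall>t\<in>?L. ?from (?to t) = t"
    proof
      fix t assume t: "t \<in> ?L"
      show "?from (?to t) = t"
      proof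
        fix y show "?from (?to t) y = t y"
          using PiE_arb[OF labelledD(1)[OF G t], of y] by (cases "y \<in> ?I \<times> UNIV") auto
      qed
    qed
    show "\<forall>u\<in>?U. ?to (?from u) = u"
    proof
      fix u assume "u \<in> ?U"
      then have u: "u \<in> PiE J (\<lambda>j. ring (len j) G)" by simp
      show "?to (?from u) = u"
      proof
        fix j show "?to (?from u) j = u j"
        proof (cases "j \<in> J")
          case True
          have uj: "u j \<in> {..<len j} \<times> UNIV \<rightarrow>\<^sub>E V" using labelledD(1)[OF G PiE_mem[OF u True]] .
          show ?thesis
          proof
            fix x show "?to (?from u) j x = u j x"
              using True PiE_arb[OF uj, of x] by (cases x) auto
          qed
        next
          case False
          then show ?thesis using PiE_arb[OF u False] by simp
        qed
      qed
    qed
    show "?to ` ?L \<subseteq> ?U"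
    proof (intro image_subsetI CollectI conjI ballI impI)
      fix t assume t: "t \<in> ?L"
      have e: "?to t j = (\<lambda>x\<in>{..<len j} \<times> UNIV. t ((j, fst x), snd x))" if "j \<in> J" for j
        using that by (rule restrict_apply')
      show "?to t \<in> PiE J (\<lambda>j. ring (len j) G)"
      proof (rule PiE_I)
        show "?to t j \<in> ring (len j) G" if "j \<in> J" for j
          unfolding e[OF that] by (rule labelled_family_component[OF G t that])
        show "?to t j = undefined" if "j \<notin> J" for j using that by simp
      qed
      show "node_disjoint l G (support (len i) (?to t i)) (support (len j) (?to t j))" if "i \<in> J" "j \<in> J" "i \<noteq> j" for i j
        unfolding e[OF that(1)] e[OF that(2)] by (rule labelled_family_node_disjoint[OF G t that])
    qed
    show "?from ` ?U \<subseteq> ?L"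
    proof (intro image_subsetI labelled_family_combine[OF G])
      fix u assume u: "u \<in> ?U"
      then show "u \<in> PiE J (\<lambda>j. ring (len j) G)" by blast
      show "node_disjoint l G (support (len i) (u i)) (support (len j) (u j))" if "i \<in> J" "j \<in> J" "i \<noteq> j" for i j
        using u that by blast
    qed
  qed
  then have "card ?L = card ?U" by (rule bij_betw_same_card)
  also have "?U = (\<Union>H\<in>families J len G. PiE J (\<lambda>j. {t \<in> ring (len j) G. support (len j) t = H j}))"
  proof (intro equalityI subsetI)
    fix u assume u: "u \<in> ?U"
    let ?H = "\<lambda>j\<in>J. support (len j) (u j)"
    have "support (len j) (u j) \<in> cycles (len j) G" if j: "j \<in> J" for j
    proof -
      have "u \<in> PiE J (\<lambda>j. ring (len j) G)" using u by simp
      then have "u j \<in> ring (len j) G" using j by (rule PiE_mem)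
      then show ?thesis unfolding cycles_eq[OF G len[OF j]] by (rule imageI)
    qed
    then have "?H \<in> families J len G" using u by (simp add: families_def)
    moreover have "u \<in> PiE J (\<lambda>j. {t \<in> ring (len j) G. support (len j) t = ?H j})"
      using u by (auto simp: PiE_iff)
    ultimately show "u \<in> (\<Union>H\<in>families J len G. PiE J (\<lambda>j. {t \<in> ring (len j) G. support (len j) t = H j}))"
      by blast
  next
    fix u assume "u \<in> (\<Union>H\<in>families J len G. PiE J (\<lambda>j. {t \<in> ring (len j) G. support (len j) t = H j}))"
    then obtain H where H: "H \<in> families J len G" "u \<in> PiE J (\<lambda>j. {t \<in> ring (len j) G. support (len j) t = H j})" by blast
    have "u j \<in> ring (len j) G \<and> support (len j) (u j) = H j" if "j \<in> J" for j using PiE_mem[OF H(2) that] by simp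
    then show "u \<in> ?U" using H by (simp add: families_def PiE_iff)
  qed
  also have "card \<dots> = (\<Sum>H\<in>families J len G. card (PiE J (\<lambda>j. {t \<in> ring (len j) G. support (len j) t = H j})))"
  proof (rule card_UN_disjoint)
    have "finite (PiE J (\<lambda>j. cycles (len j) G))" using J len finite_cycles[OF G] by (intro finite_PiE) auto
    then show "finite (families J len G)" by (rule rev_finite_subset) (auto simp: families_def)
    show "\<forall>H\<in>families J len G. finite (PiE J (\<lambda>j. {t \<in> ring (len j) G. support (len j) t = H j}))"
      by (intro ballI finite_PiE J) (rule finite_subset[OF _ finite_labelled[OF finite_lessThan]], blast)
    show "\<forall>H\<in>families J len G. \<forall>H'\<in>families J len G. H \<noteq> H' \<longrightarrow>
      PiE J (\<lambda>j. {t \<in> ring (len j) G. support (len j) t = H j}) \<inter> PiE J (\<lambda>j. {t \<in> ring (len j) G. support (len j) t = H' j}) = {}"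
    proof (intro ballI impI equals0I)
      fix H H' u assume H: "H \<in> families J len G" "H' \<in> families J len G" "H \<noteq> H'"
        and u: "u \<in> PiE J (\<lambda>j. {t \<in> ring (len j) G. support (len j) t = H j}) \<inter> PiE J (\<lambda>j. {t \<in> ring (len j) G. support (len j) t = H' j})"
      have "H j = H' j" if "j \<in> J" for j
        using PiE_mem[OF IntD1[OF u] that] PiE_mem[OF IntD2[OF u] that] by simp
      then have "H = H'" using H(1,2) unfolding families_def by (intro PiE_ext[where k = J]) auto
      then show False using H(3) by simp
    qed
  qed
  also have "\<dots> = (\<Sum>H\<in>families J len G. \<Prod>j\<in>J. 2 * len j)"
  proof (rule sum.cong[OF refl])
    fix H assume "H \<in> families J len G"
    then have "H \<in> PiE J (\<lambda>j. cycles (len j) G)" by (simp add: families_def)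
    then have "card {t \<in> ring (len j) G. support (len j) t = H j} = 2 * len j" if "j \<in> J" for j
      using card_ring_fibre[OF G len[OF that]] PiE_mem that by fast
    then show "card (PiE J (\<lambda>j. {t \<in> ring (len j) G. support (len j) t = H j})) = (\<Prod>j\<in>J. 2 * len j)"
      using J by (simp add: card_PiE cong: prod.cong)
  qed
  also have "\<dots> = (\<Prod>j\<in>J. 2 * len j) * card (families J len G)" by simp
  finally show ?thesis .
qed

section \<open>Cycles that share a node\<close>

lemma cycle_partners:
  assumes G: "G \<in> configs" and k: "k > 0" and H: "H \<in> cycles k G" and x: "x \<in> H"
  shows "\<exists>y\<in>H. y \<noteq> x \<and> hyperedge_of l y = hyperedge_of l x"
    and "\<exists>y\<in>H. y \<noteq> x \<and> cls G y = cls G x"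
proof -
  obtain t where t: "t \<in> ring k G" "H = support k t" using H unfolding cycles_eq[OF G k] by blast
  note D = labelledD[OF G t(1)]
  obtain i s where i: "i < k" "x = t (i, s)" using x t(2) by auto
  have ne: "t (i, s) \<noteq> t (j, s')" if "(i, s) \<noteq> (j, s')" "i < k" "j < k" for i s j s'
    using inj_onD[OF D(2), of "(i, s)" "(j, s')"] that by auto
  have mem: "t (j, s') \<in> H" if "j < k" for j s' using that unfolding t(2) by blast
  show "\<exists>y\<in>H. y \<noteq> x \<and> hyperedge_of l y = hyperedge_of l x"
    using mem[OF i(1), of "\<not> s"] ne[of i "\<not> s" i s] D(3)[of i "\<not> s" s] i by (intro bexI[of _ "t (i, \<not> s)"]) auto
  show "\<exists>y\<in>H. y \<noteq> x \<and> cls G y = cls G x"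
  proof (cases s)
    case True
    have r: "rotate_in k i < k" by (rule rotate_in_less[OF i(1)])
    show ?thesis
      using mem[OF r, of False] ne[of "rotate_in k i" False i True] D(4)[of i] i r True
      by (intro bexI[of _ "t (rotate_in k i, False)"]) auto
  next
    case False
    obtain j where j: "j < k" "i = rotate_in k j"
      using i(1) bij_betw_rotate_in[of k] unfolding bij_betw_def by blast
    then show ?thesis
      using mem[OF j(1), of True] ne[of j True i False] D(4)[of j] i False
      by (intro bexI[of _ "t (j, True)"]) auto
  qed
qed

text \<open>A cycle is connected: going around it alternately through hyperedges and vertices,
  membership in \<open>S\<close> spreads from one half-edge to all.\<close>

lemma cycle_subset_closed:
  assumes G: "G \<in> configs" and k: "k > 0" and H: "H \<in> cycles k G" and S: "H \<inter> S \<noteq> {}"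
    and hyp: "\<And>x y. x \<in> H \<Longrightarrow> x \<in> S \<Longrightarrow> y \<in> H \<Longrightarrow> hyperedge_of l x = hyperedge_of l y \<Longrightarrow> y \<in> S"
    and vert: "\<And>x y. x \<in> H \<Longrightarrow> x \<in> S \<Longrightarrow> y \<in> H \<Longrightarrow> cls G x = cls G y \<Longrightarrow> y \<in> S"
  shows "H \<subseteq> S"
proof -
  obtain t where t: "t \<in> ring k G" "H = support k t" using H unfolding cycles_eq[OF G k] by blast
  note D = labelledD[OF G t(1)]
  have mem: "t (j, s) \<in> H" if "j < k" for j s using that unfolding t(2) by blast
  obtain r s0 where r: "r < k" "t (r, s0) \<in> S" using S t(2) by auto
  have "t ((r + n) mod k, s) \<in> S" for n s
  proof (induction n arbitrary: s)
    case 0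
    have "t (r, s) \<in> S" by (rule hyp[OF mem[OF r(1)] r(2) mem[OF r(1)]]) (rule D(3), use r in simp)
    then show ?case using r by simp
  next
    case (Suc n)
    let ?i = "(r + n) mod k"
    have i: "?i < k" using k by simp
    have ri: "rotate_in k ?i < k" by (rule rotate_in_less[OF i])
    have "t (rotate_in k ?i, False) \<in> S"
      by (rule vert[OF mem[OF i] Suc.IH[of True] mem[OF ri]]) (rule D(4), use i in simp)
    then have "t (rotate_in k ?i, s) \<in> S"
      by (rule hyp[OF mem[OF ri] _ mem[OF ri]]) (rule D(3), use ri in simp)
    moreover have "rotate_in k ?i = (r + Suc n) mod k" by (simp add: rotate_in_def mod_simps)
    ultimately show ?case by simp
  qed
  \<comment> \<open>Starting from r, the index i is reached after k - r + i steps.\<close>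
  then have all: "t ((r + (k - r + i)) mod k, s) \<in> S" for i s .
  have "t (i, s) \<in> S" if "i < k" for i s
  proof -
    have "r + (k - r + i) = k + i" using r(1) by simp
    then show ?thesis using all[of i s] that by simp
  qed
  then show ?thesis unfolding t(2) by auto
qed

lemma cycles_subset: "G \<in> configs \<Longrightarrow> k > 0 \<Longrightarrow> H \<in> cycles k G \<Longrightarrow> H \<subseteq> V \<and> card H = 2 * k"
  using cycles_eq[of G k] card_support[of G _ k] labelledD(1)[of G] by (fastforce simp: PiE_iff)

text \<open>If two distinct cycles share a node, some node of the union of a family containing them
  has degree at least three, so the union has more half-edges than nodes.\<close>

lemma touching_cycles_bad:
  assumes G: "G \<in> configs" and J: "finite J" and len: "\<And>j. j \<in> J \<Longrightarrow> len j > 0"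
    and H: "\<And>j. j \<in> J \<Longrightarrow> H j \<in> cycles (len j) G"
    and ij: "i \<in> J" "j \<in> J" "H i \<noteq> H j" and touch: "\<not> node_disjoint l G (H i) (H j)"
  shows "\<Union>(H ` J) \<in> bad (\<Sum>j\<in>J. 2 * len j) G"
proof -
  let ?W = "\<Union>(H ` J)"
  have sub: "H j \<subseteq> V" "card (H j) = 2 * len j" if "j \<in> J" for j
    using cycles_subset[OF G len[OF that] H[OF that]] by simp_all
  have W: "?W \<subseteq> V" using sub by blast
  have fW: "finite ?W" using W by (rule finite_subset) simp
  have cW: "card ?W \<le> (\<Sum>j\<in>J. 2 * len j)"
    using card_UN_le[OF J, of H] sub(2) by simp
  have ph: "\<exists>y\<in>?W. y \<noteq> x \<and> hyperedge_of l y = hyperedge_of l x" and pc: "\<exists>y\<in>?W. y \<noteq> x \<and> cls G y = cls G x"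
    if "x \<in> ?W" for x
  proof -
    obtain a where a: "a \<in> J" "x \<in> H a" using \<open>x \<in> ?W\<close> by blast
    show "\<exists>y\<in>?W. y \<noteq> x \<and> hyperedge_of l y = hyperedge_of l x" "\<exists>y\<in>?W. y \<noteq> x \<and> cls G y = cls G x"
      using cycle_partners[OF G len[OF a(1)] H[OF a(1)] a(2)] a(1) by blast+
  qed
  note two_h = card_ge_twice_image(1)[OF fW ph] and two_c = card_ge_twice_image(1)[OF fW pc]
  have "card (hyperedge_of l ` ?W) + card (cls G ` ?W) < card ?W"
  proof (rule ccontr)
    assume "\<not> card (hyperedge_of l ` ?W) + card (cls G ` ?W) < card ?W"
    \<comment> \<open>Neither number of nodes exceeds half of \<open>card ?W\<close>; if their sum
      is not smaller than \<open>card ?W\<close>, both bounds are equalities, and no node carries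
      three half-edges of \<open>?W\<close>.\<close>
    then have nh: "\<not> 2 * card (hyperedge_of l ` ?W) < card ?W" and nc: "\<not> 2 * card (cls G ` ?W) < card ?W"
      using two_h two_c by linarith+
    have triple_h: False if "x \<in> ?W" "y \<in> ?W" "z \<in> ?W" "x \<noteq> y" "y \<noteq> z" "x \<noteq> z"
        "hyperedge_of l x = hyperedge_of l y" "hyperedge_of l y = hyperedge_of l z" for x y z
      using card_ge_twice_image(2)[OF fW ph that] nh by blast
    have triple_c: False if "x \<in> ?W" "y \<in> ?W" "z \<in> ?W" "x \<noteq> y" "y \<noteq> z" "x \<noteq> z"
        "cls G x = cls G y" "cls G y = cls G z" for x y z
      using card_ge_twice_image(2)[OF fW pc that] nc by blast
    \<comment> \<open>A half-edge common to two cycles has a partner at its hyperedge in each of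
      them. Two different partners would make three half-edges at one hyperedge.\<close>
    have close_h: "y \<in> H b" if ab: "a \<in> J" "b \<in> J" "x \<in> H a" "x \<in> H b" "y \<in> H a" "hyperedge_of l x = hyperedge_of l y" for a b x y
    proof -
      obtain z where "z \<in> H b" "z \<noteq> x" "hyperedge_of l z = hyperedge_of l x"
        using cycle_partners(1)[OF G len[OF ab(2)] H[OF ab(2)] ab(4)] by blast
      note z = this
      show ?thesis
      proof (rule ccontr)
        assume y: "y \<notin> H b"
        have W: "z \<in> ?W" "x \<in> ?W" "y \<in> ?W" using ab(1,2,3,5) z(1) by blast+
        have "x \<noteq> y" "z \<noteq> y" using ab(4) z(1) y by blast+
        then show False using triple_h[OF W z(2) \<open>x \<noteq> y\<close> \<open>z \<noteq> y\<close> z(3) ab(6)] by blast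
      qed
    qed
    have close_c: "y \<in> H b" if ab: "a \<in> J" "b \<in> J" "x \<in> H a" "x \<in> H b" "y \<in> H a" "cls G x = cls G y" for a b x y
    proof -
      obtain z where "z \<in> H b" "z \<noteq> x" "cls G z = cls G x"
        using cycle_partners(2)[OF G len[OF ab(2)] H[OF ab(2)] ab(4)] by blast
      note z = this
      show ?thesis
      proof (rule ccontr)
        assume y: "y \<notin> H b"
        have W: "z \<in> ?W" "x \<in> ?W" "y \<in> ?W" using ab(1,2,3,5) z(1) by blast+
        have "x \<noteq> y" "z \<noteq> y" using ab(4) z(1) y by blast+
        then show False using triple_c[OF W z(2) \<open>x \<noteq> y\<close> \<open>z \<noteq> y\<close> z(3) ab(6)] by blast
      qed
    qed
    obtain x y where xy: "x \<in> H i" "y \<in> H j" "hyperedge_of l x = hyperedge_of l y \<or> cls G x = cls G y"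
      using touch unfolding node_disjoint_def by blast
    \<comment> \<open>The common node carries x, the partner of x in \<open>H i\<close>, and y. Only
      two of them can be distinct, so y lies in \<open>H i\<close>.\<close>
    have "y \<in> H i"
    proof (rule ccontr)
      assume y: "y \<notin> H i"
      then have "x \<noteq> y" using xy by auto
      from xy(3) show False
      proof
        assume e: "hyperedge_of l x = hyperedge_of l y"
        obtain z where z: "z \<in> H i" "z \<noteq> x" "hyperedge_of l z = hyperedge_of l x"
          using cycle_partners(1)[OF G len[OF ij(1)] H[OF ij(1)] xy(1)] by blast
        moreover have "z \<in> ?W" "x \<in> ?W" "y \<in> ?W" using xy(1,2) ij(1,2) z(1) by blast+
        moreover have "z \<noteq> y" using z(1) y by blast
        ultimately show False using triple_h[of z x y] e \<open>x \<noteq> y\<close> by blast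
      next
        assume e: "cls G x = cls G y"
        obtain z where z: "z \<in> H i" "z \<noteq> x" "cls G z = cls G x"
          using cycle_partners(2)[OF G len[OF ij(1)] H[OF ij(1)] xy(1)] by blast
        moreover have "z \<in> ?W" "x \<in> ?W" "y \<in> ?W" using xy(1,2) ij(1,2) z(1) by blast+
        moreover have "z \<noteq> y" using z(1) y by blast
        ultimately show False using triple_c[of z x y] e \<open>x \<noteq> y\<close> by blast
      qed
    qed
    then have ne: "H i \<inter> H j \<noteq> {}" "H j \<inter> H i \<noteq> {}" using xy(2) by auto
    \<comment> \<open>From a common half-edge the agreement of partners spreads around both cycles,
      which forces them to be equal.\<close>
    have "H i \<subseteq> H j"
      by (rule cycle_subset_closed[OF G len[OF ij(1)] H[OF ij(1)] ne(1)])
         (use close_h[OF ij(1,2)] close_c[OF ij(1,2)] in blast)+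
    moreover have "H j \<subseteq> H i"
      by (rule cycle_subset_closed[OF G len[OF ij(2)] H[OF ij(2)] ne(2)])
         (use close_h[OF ij(2,1)] close_c[OF ij(2,1)] in blast)+
    ultimately show False using ij(3) by blast
  qed
  then show ?thesis using W cW by (simp add: bad_def)
qed

definition inj_families :: "'j set \<Rightarrow> ('j \<Rightarrow> nat) \<Rightarrow> nat set set \<Rightarrow> ('j \<Rightarrow> nat set) set" where
  "inj_families J len G = {H \<in> PiE J (\<lambda>j. cycles (len j) G). inj_on H J}"

text \<open>A family of distinct cycles that is not node-disjoint consists of subsets of the bad set
  formed by its union. A set of at most R half-edges has at most 2^R subsets, hence contains at most
  (2^R)^|J| families. Conversely, node-disjoint cycles are distinct because cycles are
  nonempty.\<close>

lemma inj_families_bounds: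
  assumes G: "G \<in> configs" and J: "finite J" and len: "\<And>j. j \<in> J \<Longrightarrow> len j > 0"
  defines "R \<equiv> \<Sum>j\<in>J. 2 * len j"
  shows "card (families J len G) \<le> card (inj_families J len G)"
    and "card (inj_families J len G) \<le> card (families J len G) + card (bad R G) * (2 ^ R) ^ card J"
proof -
  have fin: "finite (PiE J (\<lambda>j. cycles (len j) G))" using J len finite_cycles[OF G] by (intro finite_PiE) auto
  then have fin': "finite (inj_families J len G)" "finite (families J len G)"
    by (auto simp: inj_families_def families_def)
  show "card (families J len G) \<le> card (inj_families J len G)"
  proof (rule card_mono[OF fin'(1)], rule subsetI)
    fix H assume "H \<in> families J len G"
    then have H: "H \<in> PiE J (\<lambda>j. cycles (len j) G)" and disj: "\<forall>i\<in>J. \<forall>j\<in>J. i \<noteq> j \<longrightarrow> node_disjoint l G (H i) (H j)"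
      by (simp_all add: families_def)
    have "inj_on H J"
    proof (rule inj_onI, rule ccontr)
      fix i j assume ij: "i \<in> J" "j \<in> J" "H i = H j" "i \<noteq> j"
      have "card (H i) = 2 * len i" using cycles_subset[OF G len[OF ij(1)] PiE_mem[OF H ij(1)]] by simp
      then have "H i \<noteq> {}" using len[OF ij(1)] by auto
      moreover have "node_disjoint l G (H i) (H i)" using disj ij by metis
      ultimately show False by (simp add: node_disjoint_def)
    qed
    then show "H \<in> inj_families J len G" using H by (simp add: inj_families_def)
  qed
  have "inj_families J len G \<subseteq> families J len G \<union> (\<Union>W\<in>bad R G. J \<rightarrow>\<^sub>E Pow W)"
  proof
    fix H assume "H \<in> inj_families J len G"
    then have H: "H \<in> PiE J (\<lambda>j. cycles (len j) G)" and inj: "inj_on H J" by (simp_all add: inj_families_def)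
    show "H \<in> families J len G \<union> (\<Union>W\<in>bad R G. J \<rightarrow>\<^sub>E Pow W)"
    proof (cases "H \<in> families J len G")
      case False
      then obtain i j where ij: "i \<in> J" "j \<in> J" "i \<noteq> j" "\<not> node_disjoint l G (H i) (H j)"
        using H unfolding families_def by blast
      have ne: "H i \<noteq> H j" using inj_onD[OF inj _ ij(1,2)] ij(3) by blast
      have "\<Union>(H ` J) \<in> bad R G"
        unfolding R_def by (rule touching_cycles_bad[OF G J len PiE_mem[OF H] ij(1,2) ne ij(4)])
      moreover have "H \<in> J \<rightarrow>\<^sub>E Pow (\<Union>(H ` J))"
      proof (rule PiE_I)
        show "H x = undefined" if "x \<notin> J" for x using H that by (rule PiE_arb)
      qed blast
      ultimately show ?thesis by blast
    qed simp
  qed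
  moreover have fW: "finite (J \<rightarrow>\<^sub>E Pow W)" if "W \<in> bad R G" for W
    using J that by (intro finite_PiE) (auto simp: bad_def intro: finite_subset)
  ultimately have "card (inj_families J len G) \<le> card (families J len G \<union> (\<Union>W\<in>bad R G. J \<rightarrow>\<^sub>E Pow W))"
    using fin'(2) finite_bad by (intro card_mono) auto
  also have "\<dots> \<le> card (families J len G) + card (\<Union>W\<in>bad R G. J \<rightarrow>\<^sub>E Pow W)" by (rule card_Un_le)
  also have "card (\<Union>W\<in>bad R G. J \<rightarrow>\<^sub>E Pow W) \<le> (\<Sum>W\<in>bad R G. card (J \<rightarrow>\<^sub>E Pow W))"
    by (rule card_UN_le[OF finite_bad])
  also have "\<dots> \<le> (\<Sum>W\<in>bad R G. (2 ^ R) ^ card J)"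
  proof (rule sum_mono)
    fix W assume W: "W \<in> bad R G"
    have "finite W" using W by (auto simp: bad_def intro: finite_subset)
    then have "card (Pow W) = 2 ^ card W" by (simp add: card_Pow)
    also have "\<dots> \<le> 2 ^ R" using W by (intro power_increasing) (auto simp: bad_def)
    finally show "card (J \<rightarrow>\<^sub>E Pow W) \<le> (2 ^ R) ^ card J"
      using J by (simp add: card_funcsetE power_mono)
  qed
  finally show "card (inj_families J len G) \<le> card (families J len G) + card (bad R G) * (2 ^ R) ^ card J" by simp
qed

end

section \<open>From families of distinct cycles to factorial moments\<close>

lemma card_inj_funcset:
  assumes A: "finite A"
  shows "card {f \<in> {..<n} \<rightarrow>\<^sub>E A. inj_on f {..<n}} = fact n * (card A choose n)"
proof -
  have "card {f \<in> {..<n} \<rightarrow>\<^sub>E A. inj_on f {..<n}} = (\<Prod>i = 0..<n. card A - i)"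
    using card_inj_on_subset_funcset[OF finite_lessThan A subset_refl, of n] by simp
  also have "\<dots> = fact n * (card A choose n)"
  proof (cases "n \<le> card A")
    case True
    have "real (\<Prod>i = 0..<n. card A - i) = (\<Prod>i = 0..<n. real (card A) - real i)"
      unfolding of_nat_prod using True by (intro prod.cong refl) (simp add: of_nat_diff)
    also have "\<dots> = fact n * (real (card A) gchoose n)" by (simp add: gbinomial_mult_fact)
    also have "\<dots> = real (fact n * (card A choose n))" by (simp add: binomial_gbinomial)
    finally show ?thesis by (simp only: of_nat_eq_iff)
  next
    case False
    then have "(\<Prod>i = 0..<n. card A - i) = 0" by (intro prod_zero bexI[of _ "card A"]) auto
    then show ?thesis using False by (simp add: binomial_eq_0)
  qed
  finally show ?thesis .
qed

lemma card_bij_betw_Collect: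
  assumes f: "bij_betw f A B" and P: "\<And>x. x \<in> A \<Longrightarrow> P x \<longleftrightarrow> Q (f x)"
  shows "card {x \<in> A. P x} = card {y \<in> B. Q y}"
proof -
  have "f ` {x \<in> A. P x} = {y \<in> B. Q y}"
    using f P unfolding bij_betw_def by blast
  moreover have "inj_on f {x \<in> A. P x}"
    using f unfolding bij_betw_def by (auto intro: inj_on_subset)
  ultimately show ?thesis using card_image by metis
qed

context planted
begin

lemma card_cycles: "cycle_count l m k G = card (cycles k G)"
  by (simp add: cycle_count_def cycles_def)

text \<open>The index (k, i) is the i-th slot for a k-cycle. Cycles of different lengths differ
  because a k-cycle has 2 k half-edges, so distinctness is a condition for each length separately
  and the count factors.\<close>

lemma card_inj_families_by_length:
  assumes G: "G \<in> configs"
  shows "card (inj_families (SIGMA k:{1..b}. {..<n k}) fst G) = (\<Prod>k=1..b. fact (n k) * (cycle_count l m k G choose n k))"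
proof -
  let ?J = "SIGMA k:{1..b}. {..<n k}"
  let ?A = "PiE ?J (\<lambda>x. cycles (fst x) G)" and ?B = "PiE {1..b} (\<lambda>k. {..<n k} \<rightarrow>\<^sub>E cycles k G)"
  let ?f = "\<lambda>H. \<lambda>k\<in>{1..b}. \<lambda>i\<in>{..<n k}. H (k, i)"
  have bij: "bij_betw ?f ?A ?B" by (rule bij_betw_curry[where S = "\<lambda>k i. cycles k G"])
  have eqv: "inj_on H ?J \<longleftrightarrow> (\<forall>k\<in>{1..b}. inj_on (?f H k) {..<n k})" if H: "H \<in> ?A" for H
  proof
    assume inj: "inj_on H ?J"
    show "\<forall>k\<in>{1..b}. inj_on (?f H k) {..<n k}"
    proof (intro ballI inj_onI)
      fix k i j assume "k \<in> {1..b}" "i \<in> {..<n k}" "j \<in> {..<n k}" "?f H k i = ?f H k j"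
      then have "(k, i) = (k, j)" by (intro inj_onD[OF inj]) simp_all
      then show "i = j" by simp
    qed
  next
    assume inj: "\<forall>k\<in>{1..b}. inj_on (?f H k) {..<n k}"
    show "inj_on H ?J"
    proof (rule inj_onI)
      fix x y assume xy: "x \<in> ?J" "y \<in> ?J" "H x = H y"
      have c: "card (H z) = 2 * fst z" if "z \<in> ?J" for z
        using cycles_subset[OF G _ PiE_mem[OF H that]] that by auto
      have f: "fst x = fst y" using c[OF xy(1)] c[OF xy(2)] xy(3) by simp
      obtain k i j where x: "x = (k, i)" "y = (k, j)" using f by (metis prod.collapse)
      have k: "k \<in> {1..b}" "i \<in> {..<n k}" "j \<in> {..<n k}" using xy(1,2) x by auto
      have "?f H k i = ?f H k j" using xy(3) k x by simp
      then have "i = j" using inj_onD[OF bspec[OF inj k(1)] _ k(2,3)] by blast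
      then show "x = y" using x by simp
    qed
  qed
  have "card {H \<in> ?A. inj_on H ?J} = card {u \<in> ?B. \<forall>k\<in>{1..b}. inj_on (u k) {..<n k}}"
    by (rule card_bij_betw_Collect[OF bij]) (rule eqv)
  also have "{u \<in> ?B. \<forall>k\<in>{1..b}. inj_on (u k) {..<n k}} = PiE {1..b} (\<lambda>k. {f \<in> {..<n k} \<rightarrow>\<^sub>E cycles k G. inj_on f {..<n k}})"
    by (simp add: set_eq_iff PiE_iff) blast
  also have "card \<dots> = (\<Prod>k=1..b. fact (n k) * (card (cycles k G) choose n k))"
    unfolding card_PiE[OF finite_atLeastAtMost] by (intro prod.cong refl card_inj_funcset finite_cycles[OF G]) simp
  finally show ?thesis by (simp add: inj_families_def card_cycles)
qed

end

context planted_limit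
begin

lemma avg_families_tendsto:
  assumes J: "finite J" and len: "\<And>j. j \<in> J \<Longrightarrow> len j > 0"
  shows "((\<lambda>m. avg (\<Omega> m) (\<lambda>G. real (card (planted.families l m J len G)))) \<longlongrightarrow> (\<Prod>j\<in>J. planted_cycle_rate d l \<beta> (len j))) F"
proof -
  let ?p = "\<Prod>j\<in>J. 2 * real (len j)"
  have p: "?p \<noteq> 0" using J len by (auto simp: prod_zero_iff)
  have "((\<lambda>m. avg (\<Omega> m) (\<lambda>G. real (card (planted.labelled l m G (rotate_family len) (SIGMA j:J. {..<len j})))) / ?p)
     \<longlongrightarrow> (\<Prod>j\<in>J. 2 * real (len j) * planted_cycle_rate d l \<beta> (len j)) / ?p) F"
    by (intro tendsto_divide tendsto_const avg_labelled_family_tendsto J len p)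
  also have "(\<Prod>j\<in>J. 2 * real (len j) * planted_cycle_rate d l \<beta> (len j)) / ?p = (\<Prod>j\<in>J. planted_cycle_rate d l \<beta> (len j))"
    using p unfolding prod.distrib[of "\<lambda>j. 2 * real (len j)"] by simp
  finally show ?thesis
  proof (rule Lim_transform_eventually)
    show "eventually (\<lambda>m. avg (\<Omega> m) (\<lambda>G. real (card (planted.labelled l m G (rotate_family len) (SIGMA j:J. {..<len j})))) / ?p
      = avg (\<Omega> m) (\<lambda>G. real (card (planted.families l m J len G)))) F"
      using eventually_S
    proof eventually_elim
      case (elim m)
      interpret planted d l m "M m" by (rule planted) (use elim in simp)
      have "avg configs (\<lambda>G. real (card (labelled G (rotate_family len) (SIGMA j:J. {..<len j})))) = avg configs (\<lambda>G. ?p * real (card (families J len G)))"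
        by (rule avg_cong) (simp add: card_labelled_family[OF _ J len])
      then show ?case using p unfolding avg_cmult by simp
    qed
  qed
qed

lemma avg_inj_families_tendsto:
  assumes J: "finite J" and len: "\<And>j. j \<in> J \<Longrightarrow> len j > 0"
  shows "((\<lambda>m. avg (\<Omega> m) (\<lambda>G. real (card (planted.inj_families l m J len G)))) \<longlongrightarrow> (\<Prod>j\<in>J. planted_cycle_rate d l \<beta> (len j))) F"
proof (rule tendsto_sandwich)
  define R where "R = (\<Sum>j\<in>J. 2 * len j)"
  let ?C = "real ((2 ^ R) ^ card J)"
  show "eventually (\<lambda>m. avg (\<Omega> m) (\<lambda>G. real (card (planted.families l m J len G))) \<le> avg (\<Omega> m) (\<lambda>G. real (card (planted.inj_families l m J len G)))) F"
    using eventually_S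
  proof eventually_elim
    case (elim m)
    interpret planted d l m "M m" by (rule planted) (use elim in simp)
    show ?case by (intro avg_mono of_nat_mono inj_families_bounds(1)[OF _ J len])
  qed
  show "eventually (\<lambda>m. avg (\<Omega> m) (\<lambda>G. real (card (planted.inj_families l m J len G))) \<le>
     avg (\<Omega> m) (\<lambda>G. real (card (planted.families l m J len G))) + ?C * avg (\<Omega> m) (\<lambda>G. real (card (planted.bad l m R G)))) F"
    using eventually_S
  proof eventually_elim
    case (elim m)
    interpret planted d l m "M m" by (rule planted) (use elim in simp)
    have "avg configs (\<lambda>G. real (card (inj_families J len G))) \<le> avg configs (\<lambda>G. real (card (families J len G)) + ?C * real (card (bad R G)))"
    proof (rule avg_mono)
      fix G assume G: "G \<in> configs"
      have "card (inj_families J len G) \<le> card (families J len G) + card (bad R G) * (2 ^ R) ^ card J"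
        unfolding R_def by (rule inj_families_bounds(2)[OF G J]) (rule len)
      from of_nat_mono[OF this, where 'a = real]
      show "real (card (inj_families J len G)) \<le> real (card (families J len G)) + ?C * real (card (bad R G))"
        by (simp add: mult.commute)
    qed
    then show ?case by (simp only: avg_add avg_cmult)
  qed
  show "((\<lambda>m. avg (\<Omega> m) (\<lambda>G. real (card (planted.families l m J len G)))) \<longlongrightarrow> (\<Prod>j\<in>J. planted_cycle_rate d l \<beta> (len j))) F"
    by (rule avg_families_tendsto[OF J len])
  show "((\<lambda>m. avg (\<Omega> m) (\<lambda>G. real (card (planted.families l m J len G))) + ?C * avg (\<Omega> m) (\<lambda>G. real (card (planted.bad l m R G))))
     \<longlongrightarrow> (\<Prod>j\<in>J. planted_cycle_rate d l \<beta> (len j))) F"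
    using tendsto_add[OF avg_families_tendsto[OF J len] tendsto_mult[OF tendsto_const[of ?C] avg_bad_tendsto_0[of R]]] by simp
qed

lemma factorial_moments_tendsto:
  "((\<lambda>m. avg (\<Omega> m) (\<lambda>G. \<Prod>k=1..b. real (cycle_count l m k G choose n k)))
    \<longlongrightarrow> (\<Prod>k=1..b. planted_cycle_rate d l \<beta> k ^ n k / fact (n k))) F"
proof -
  let ?J = "SIGMA k:{1..b}. {..<n k}"
  let ?p = "\<Prod>k=1..b. fact (n k) :: real"
  have p: "?p \<noteq> 0" by simp
  have "((\<lambda>m. avg (\<Omega> m) (\<lambda>G. real (card (planted.inj_families l m ?J fst G))) / ?p)
     \<longlongrightarrow> (\<Prod>x\<in>?J. planted_cycle_rate d l \<beta> (fst x)) / ?p) F"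
    by (intro tendsto_divide tendsto_const p avg_inj_families_tendsto) auto
  also have "(\<Prod>x\<in>?J. planted_cycle_rate d l \<beta> (fst x)) = (\<Prod>k=1..b. \<Prod>i<n k. planted_cycle_rate d l \<beta> k)"
    by (subst prod.Sigma) (simp_all add: case_prod_beta)
  also have "\<dots> / ?p = (\<Prod>k=1..b. planted_cycle_rate d l \<beta> k ^ n k / fact (n k))"
    by (simp add: prod_dividef)
  finally show ?thesis
  proof (rule Lim_transform_eventually)
    show "eventually (\<lambda>m. avg (\<Omega> m) (\<lambda>G. real (card (planted.inj_families l m ?J fst G))) / ?p
      = avg (\<Omega> m) (\<lambda>G. \<Prod>k=1..b. real (cycle_count l m k G choose n k))) F"
      using eventually_S
    proof eventually_elim
      case (elim m)
      interpret planted d l m "M m" by (rule planted) (use elim in simp)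
      have "avg configs (\<lambda>G. real (card (inj_families ?J fst G))) = avg configs (\<lambda>G. ?p * (\<Prod>k=1..b. real (cycle_count l m k G choose n k)))"
        by (rule avg_cong) (simp only: card_inj_families_by_length of_nat_prod of_nat_mult of_nat_fact prod.distrib)
      then show ?case using p unfolding avg_cmult by simp
    qed
  qed
qed

text \<open>Since \<beta> < 1 / 2, the ratio r is below 1 and the correction term is greater than
  -1. Positivity of the rates is needed for the formula of the Poisson probabilities.\<close>

lemma planted_cycle_rate_pos:
  assumes "k > 0"
  shows "planted_cycle_rate d l \<beta> k > 0"
proof -
  define r where "r = \<beta> / (1 - \<beta>)"
  have r: "0 \<le> r" "r < 1" using \<beta> \<beta>_half by (simp_all add: r_def)
  have "r ^ k < 1" using r assms by (simp add: power_less_one_iff)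
  moreover have "\<bar>(- 1) ^ k * \<beta> ^ k / (1 - \<beta>) ^ k\<bar> = r ^ k"
    using r \<beta> \<beta>_half by (simp add: abs_mult r_def power_divide)
  ultimately have "1 + (- 1) ^ k * \<beta> ^ k / (1 - \<beta>) ^ k > 0" by linarith
  moreover have "cycle_rate d l k > 0"
    using d l assms by (simp add: cycle_rate_def)
  ultimately show ?thesis by (simp add: planted_cycle_rate_def)
qed

text \<open>Conditioning a uniform law on an event of positive probability gives the uniform law on
  that event; positivity is \<open>configs_nonempty\<close>.\<close>

lemma cond_random_configuration:
  assumes "m \<in> S"
  shows "cond_pmf (random_configuration d l m) {G. is_matching l m G (M m)} = pmf_of_set (\<Omega> m)"
proof -
  interpret planted d l m "M m" by (rule planted) fact
  have conf: "configs = configurations d l m \<inter> {G. is_matching l m G (M m)}"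
    by (auto simp: configs_def)
  have fin: "finite (configurations d l m)"
    by (rule finite_subset[of _ "Pow (Pow {1..l * m})"]) (auto simp: configurations_def partition_on_def)
  have ne: "configurations d l m \<noteq> {}" using configs_nonempty conf by auto
  have inter: "set_pmf (random_configuration d l m) \<inter> {G. is_matching l m G (M m)} \<noteq> {}"
    using configs_nonempty conf fin ne by (simp add: random_configuration_def)
  show ?thesis
  proof (rule pmf_eqI)
    fix G
    show "pmf (cond_pmf (random_configuration d l m) {G. is_matching l m G (M m)}) G = pmf (pmf_of_set configs) G"
      unfolding pmf_cond[OF inter] pmf_of_set[OF configs_nonempty finite_configs]
      using fin ne configs_nonempty finite_configs
      by (simp add: random_configuration_def measure_pmf_of_set conf[symmetric] indicator_def)
         (auto simp: conf)
  qed
qed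

lemma conv_in_distribution_cycle_counts:
  "conv_in_distribution b
     (\<lambda>m. cycle_vector_law l m b (cond_pmf (random_configuration d l m) {G. is_matching l m G (M m)}))
     (indep_poisson_law b (planted_cycle_rate d l \<beta>)) F"
  unfolding cycle_vector_law_def
proof (rule conv_in_distribution_poisson_of_factorial_moments[OF eventually_configs])
  show "eventually (\<lambda>m. cond_pmf (random_configuration d l m) {G. is_matching l m G (M m)} = pmf_of_set (\<Omega> m)) F"
    using eventually_S by eventually_elim (simp add: cond_random_configuration)
qed (use planted_cycle_rate_pos factorial_moments_tendsto in auto)

end

section \<open>The unconditioned and the conditioned limit law\<close>

lemma indep_poisson_law_cong:
  "(\<And>k. k \<in> {1..b} \<Longrightarrow> r k = r' k) \<Longrightarrow> indep_poisson_law b r = indep_poisson_law b r'"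
  unfolding indep_poisson_law_def by (intro PiM_cong) simp_all

theorem lemma4p4:
  fixes d l b :: nat and \<beta> :: real and M0 :: "nat \<Rightarrow> nat set"
  assumes "d \<ge> 2" and "l \<ge> 2" and "0 < \<beta>" and "\<beta> < 1 / real d"
    and "\<And>m. m \<in> admissible d l \<beta> \<Longrightarrow> M0 m \<subseteq> {1..m} \<and> real (card (M0 m)) = real m * \<beta>"
  shows "conv_in_distribution b
           (\<lambda>m. cycle_vector_law l m b (random_configuration d l m))
           (indep_poisson_law b (cycle_rate d l))
           (inf at_top (principal (admissible d l \<beta>)))
       \<and> conv_in_distribution b
           (\<lambda>m. cycle_vector_law l m b
                  (cond_pmf (random_configuration d l m) {G. is_matching l m G (M0 m)}))
           (indep_poisson_law b (planted_cycle_rate d l \<beta>))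
           (inf at_top (principal (admissible d l \<beta>)))"
proof
  \<comment> \<open>Density 0 and the empty matching, along the same sequence of m as for the given
    \<beta>.\<close>
  interpret unplanted: planted_limit d l 0 "\<lambda>_. {}" "admissible d l \<beta>"
    by standard (use assms in \<open>auto simp: admissible_def\<close>)
  \<comment> \<open>The empty set is a matching of every configuration, so this conditions on a sure
    event.\<close>
  have "cond_pmf (random_configuration d l m) {G. is_matching l m G {}} = random_configuration d l m" for m
  proof (rule pmf_eqI)
    have "{G. is_matching l m G {}} = UNIV" by (simp add: is_matching_def half_edges_of_def)
    then show "pmf (cond_pmf (random_configuration d l m) {G. is_matching l m G {}}) G = pmf (random_configuration d l m) G" for G
      by (simp add: pmf_cond set_pmf_not_empty)
  qed
  moreover have "indep_poisson_law b (planted_cycle_rate d l 0) = indep_poisson_law b (cycle_rate d l)"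
    by (rule indep_poisson_law_cong) (simp add: planted_cycle_rate_def)
  ultimately show "conv_in_distribution b (\<lambda>m. cycle_vector_law l m b (random_configuration d l m))
     (indep_poisson_law b (cycle_rate d l)) (inf at_top (principal (admissible d l \<beta>)))"
    using unplanted.conv_in_distribution_cycle_counts[of b] by simp
next
  interpret planted_limit d l \<beta> M0 "admissible d l \<beta>"
    by standard (use assms in \<open>auto simp: admissible_def\<close>)
  show "conv_in_distribution b
     (\<lambda>m. cycle_vector_law l m b (cond_pmf (random_configuration d l m) {G. is_matching l m G (M0 m)}))
     (indep_poisson_law b (planted_cycle_rate d l \<beta>)) (inf at_top (principal (admissible d l \<beta>)))"
    by (rule conv_in_distribution_cycle_counts)
qed

end
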